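(* Let $m$ be a locally summable weight on a simplicial complex $\Sigma$. Then \begin{align*} \sigma(\Delta^+_D)\setminus\{0\}&=\sigma(\Delta^-_N)\setminus\{0\},\\ \sigma(\Delta^-_D)\setminus\{0\}&=\sigma(\Delta^+_N)\setminus\{0\},\\ \sigma(\Delta^H_D)\setminus\{0\}&=\sigma(\Delta^H_N)\setminus\{0\}, \end{align*} where $\sigma(\cdot)$ denotes the spectrum. The same is true for the essential, pure point, absolutely continuous and singular continuous spectrum in place of the spectrum.
   Context: Simplicial complex: $V$ is a countable set and $\hat\Sigma$ is a collection of finite subsets of $V$ closed under taking subsets. $\dim\tau=|\tau|-1$, $\hat\Sigma_k=\{\tau\in\hat\Sigma:\dim\tau=k\}$. A weight is a function $m:\hat\Sigma\to(0,\infty)$. Put $\Sigma=\hat\Sigma$ if $\sum_{v\in\hat\Sigma_0}m(v)<\infty$, and $\Sigma=\hat\Sigma\setminus\{\varnothing\}$ otherwise. For $\tau,\sigma\in\Sigma$, $\tau\prec\sigma$ (equivalently $\sigma\succ\tau$) means $\tau\subset\sigma$ and $|\sigma\setminus\tau|=1$. All sums are over elements of $\Sigma$. The weight is locally summable if $\sum_{\sigma\succ\tau}m(\sigma)<\infty$ for all $\tau\in\Sigma$. Functions: $F=\mathbb{R}^{\Sigma}$; $F^c$ is the subspace of finitely supported functions; $F^1=\{\omega\in F:\sum_{\sigma\succ\tau}m(\sigma)|\omega(\sigma)|<\infty\text{ for all }\tau\in\Sigma\}$. Coboundary operator: a linear map $\delta:F\to F$ with $\delta\delta=0$ such that $\theta(\tau,\sigma):=\delta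 1_\tau(\sigma)\in\{-1,0,1\}$, $\theta(\tau,\sigma)\neq0$ iff $\tau\prec\sigma$, and $\delta\omega(\sigma)=\sum_{\tau\prec\sigma}\omega(\tau)\theta(\tau,\sigma)$. Boundary operator: $\partial:F^1\to F$, $\partial\omega(\rho)=\frac1{m(\rho)}\sum_{\tau\succ\rho}m(\tau)\omega(\tau)\theta(\rho,\tau)$. Forms and Laplacians: $\|\omega\|^2=\sum_\Sigma m\omega^2$, $\ell^2=\ell^2(\Sigma,m)=\{\omega\in F:\|\omega\|<\infty\}$. Put $\mathcal Q^+(\omega)=\|\delta\omega\|^2$ for $\omega\in F$, and $\mathcal Q^-(\omega)=\|\partial\omega\|^2$, $\mathcal Q^H(\omega)=\|\delta\omega+\partial\omega\|^2$ for $\omega\in F^1$. For $\circ\in\{+,-,H\}$, $Q^\circ_N$ is the restriction of $\mathcal Q^\circ$ to $D(Q^\circ_N)=\{\omega\in\ell^2:\mathcal Q^\circ(\omega)<\infty\}$ (under local summability $\ell^2\subseteq F^1$), and $Q^\circ_D$ its restriction to the closure of $F^c$ in $D(Q_N^\circ)$ with respect to $(\mathcal Q^\circ(\cdot)+\|\cdot\|^2)^{1/2}$. Both are closed positive forms on $\ell^2$; $\Delta^\circ_N$ and $\Delta^\circ_D$ are the associated positive self-adjoint operators on $\ell^2$. *)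

theory Defs
  imports "HOL-Analysis.Analysis" "HOL-Library.Function_Algebras"
begin

instantiation "fun" :: (type, real_vector) real_vector
begin

definition scaleR_fun :: "real \<Rightarrow> ('a \<Rightarrow> 'b) \<Rightarrow> 'a \<Rightarrow> 'b" where
  "scaleR_fun c f = (\<lambda>x. c *\<^sub>R f x)"

instance
  by standard (auto simp: scaleR_fun_def plus_fun_def fun_eq_iff algebra_simps)

end


section \<open>Self-adjoint operators and the parts of their spectrum\<close>

text \<open>
  A real Hilbert space is given by a subspace \<open>H\<close> of an ambient real vector space and an inner
  product \<open>ip\<close>, of which only the values on \<open>H\<close> matter. An unbounded operator is given by its
  graph \<open>T \<subseteq> H \<times> H\<close>. The definitions below are meant for self-adjoint \<open>T\<close>; the spectrum of such
  an operator (i.e. of its complexification) is real and is the set of real numbers computed here.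
\<close>

type_synonym 'v inner_prod = "'v \<Rightarrow> 'v \<Rightarrow> real"
type_synonym 'v graph = "('v \<times> 'v) set"

definition resolvent_set :: "'v::real_vector set \<Rightarrow> 'v inner_prod \<Rightarrow> 'v graph \<Rightarrow> real set" where
  "resolvent_set H ip T = {z.
     (\<forall>g\<in>H. \<exists>!f. (f, g + z *\<^sub>R f) \<in> T) \<and>
     (\<exists>C. \<forall>(f, h)\<in>T. sqrt (ip f f) \<le> C * sqrt (ip (h - z *\<^sub>R f) (h - z *\<^sub>R f)))}"

definition spectrum :: "'v::real_vector set \<Rightarrow> 'v inner_prod \<Rightarrow> 'v graph \<Rightarrow> real set" where
  "spectrum H ip T = - resolvent_set H ip T"

definition eigenspace :: "'v::real_vector graph \<Rightarrow> real \<Rightarrow> 'v set" where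
  "eigenspace T z = {f. (f, z *\<^sub>R f) \<in> T}"

text \<open>Isolated points of the spectrum that are eigenvalues of finite multiplicity.\<close>

definition discrete_spectrum :: "'v::real_vector set \<Rightarrow> 'v inner_prod \<Rightarrow> 'v graph \<Rightarrow> real set" where
  "discrete_spectrum H ip T = {z. z isolated_in spectrum H ip T \<and>
     (\<exists>f\<in>eigenspace T z. f \<noteq> 0) \<and> (\<exists>B. finite B \<and> eigenspace T z \<subseteq> span B)}"

definition essential_spectrum :: "'v::real_vector set \<Rightarrow> 'v inner_prod \<Rightarrow> 'v graph \<Rightarrow> real set" where
  "essential_spectrum H ip T = spectrum H ip T - discrete_spectrum H ip T"

definition orthogonal_projection :: "'v::real_vector set \<Rightarrow> 'v inner_prod \<Rightarrow> ('v \<Rightarrow> 'v) \<Rightarrow> bool" where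
  "orthogonal_projection H ip P \<longleftrightarrow>
     (\<forall>f\<in>H. P f \<in> H) \<and>
     (\<forall>f\<in>H. \<forall>g\<in>H. P (f + g) = P f + P g) \<and> (\<forall>c. \<forall>f\<in>H. P (c *\<^sub>R f) = c *\<^sub>R P f) \<and>
     (\<forall>f\<in>H. P (P f) = P f) \<and>
     (\<forall>f\<in>H. \<forall>g\<in>H. ip (P f) g = ip f (P g))"

definition projection_valued_measure ::
    "'v::real_vector set \<Rightarrow> 'v inner_prod \<Rightarrow> (real set \<Rightarrow> 'v \<Rightarrow> 'v) \<Rightarrow> bool" where
  "projection_valued_measure H ip E \<longleftrightarrow>
     (\<forall>B\<in>sets borel. orthogonal_projection H ip (E B)) \<and>
     (\<forall>f\<in>H. E UNIV f = f) \<and>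
     (\<forall>f\<in>H. \<forall>B. range B \<subseteq> sets borel \<longrightarrow> disjoint_family B \<longrightarrow>
        (\<lambda>i::nat. ip (E (B i) f) f) sums ip (E (\<Union>i. B i) f) f)"

definition scalar_measure :: "'v inner_prod \<Rightarrow> (real set \<Rightarrow> 'v \<Rightarrow> 'v) \<Rightarrow> 'v \<Rightarrow> real measure" where
  "scalar_measure ip E f = measure_of UNIV (sets borel) (\<lambda>B. ennreal (ip (E B f) f))"

definition spectral_dom ::
    "'v set \<Rightarrow> 'v inner_prod \<Rightarrow> (real set \<Rightarrow> 'v \<Rightarrow> 'v) \<Rightarrow> 'v set" where
  "spectral_dom H ip E = {f\<in>H. integrable (scalar_measure ip E f) (\<lambda>x. x\<^sup>2)}"

text \<open>
  \<open>spectral_measure_of H ip T E\<close> says that \<open>T = \<integral> x dE(x)\<close>. The last clause is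
  \<open>ip h g = \<integral> x d(ip (E x f) g)\<close>, where the signed measure is written through the positive measures
  \<open>scalar_measure ip E (f \<plusminus> g)\<close> by polarization.
\<close>

definition spectral_measure_of ::
    "'v::real_vector set \<Rightarrow> 'v inner_prod \<Rightarrow> 'v graph \<Rightarrow> (real set \<Rightarrow> 'v \<Rightarrow> 'v) \<Rightarrow> bool" where
  "spectral_measure_of H ip T E \<longleftrightarrow> projection_valued_measure H ip E \<and>
     T = {(f, h). f \<in> spectral_dom H ip E \<and> h \<in> H \<and>
       (\<forall>g\<in>spectral_dom H ip E. ip h g =
          ((\<integral>x. x \<partial>scalar_measure ip E (f + g)) - (\<integral>x. x \<partial>scalar_measure ip E (f - g))) / 4)}"

definition pp_subspace where
  "pp_subspace H ip E = {f\<in>H. \<exists>S. countable S \<and> emeasure (scalar_measure ip E f) (- S) = 0}"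

definition ac_subspace where
  "ac_subspace H ip E = {f\<in>H. absolutely_continuous lborel (scalar_measure ip E f)}"

definition sc_subspace where
  "sc_subspace H ip E = {f\<in>H.
     (\<forall>x. emeasure (scalar_measure ip E f) {x} = 0) \<and>
     (\<exists>N. N \<in> null_sets lborel \<and> emeasure (scalar_measure ip E f) (- N) = 0)}"

text \<open>
  By the spectral theorem a self-adjoint operator has exactly one spectral measure (as far as the
  values \<open>E B f\<close> for Borel sets \<open>B\<close> and \<open>f \<in> H\<close> are concerned), so the quantifier over \<open>E\<close> merely
  names it. Each of the three spectra is the spectrum of the part of \<open>T\<close> in the respective subspace.
\<close>

definition pure_point_spectrum :: "'v::real_vector set \<Rightarrow> 'v inner_prod \<Rightarrow> 'v graph \<Rightarrow> real set" where
  "pure_point_spectrum H ip T = {z. \<exists>E. spectral_measure_of H ip T E \<and>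
     z \<in> spectrum (pp_subspace H ip E) ip (T \<inter> pp_subspace H ip E \<times> pp_subspace H ip E)}"

definition ac_spectrum :: "'v::real_vector set \<Rightarrow> 'v inner_prod \<Rightarrow> 'v graph \<Rightarrow> real set" where
  "ac_spectrum H ip T = {z. \<exists>E. spectral_measure_of H ip T E \<and>
     z \<in> spectrum (ac_subspace H ip E) ip (T \<inter> ac_subspace H ip E \<times> ac_subspace H ip E)}"

definition sc_spectrum :: "'v::real_vector set \<Rightarrow> 'v inner_prod \<Rightarrow> 'v graph \<Rightarrow> real set" where
  "sc_spectrum H ip T = {z. \<exists>E. spectral_measure_of H ip T E \<and>
     z \<in> spectrum (sc_subspace H ip E) ip (T \<inter> sc_subspace H ip E \<times> sc_subspace H ip E)}"

text \<open>
  The operator associated with a closed form with form domain \<open>D\<close>, where the form is given by its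
  quadratic form \<open>Q\<close>, finite on \<open>D\<close>, and recovered on pairs by polarization.
\<close>

definition form_operator ::
    "'v::real_vector set \<Rightarrow> 'v inner_prod \<Rightarrow> 'v set \<Rightarrow> ('v \<Rightarrow> ennreal) \<Rightarrow> 'v graph" where
  "form_operator H ip D Q = {(f, g). f \<in> D \<and> g \<in> H \<and>
     (\<forall>h\<in>D. (enn2real (Q (f + h)) - enn2real (Q (f - h))) / 4 = ip g h)}"


section \<open>Weighted simplicial complexes\<close>

definition abstract_simplicial_complex :: "'a set \<Rightarrow> 'a set set \<Rightarrow> bool" where
  "abstract_simplicial_complex V S \<longleftrightarrow> countable V \<and>
     (\<forall>\<tau>\<in>S. finite \<tau> \<and> \<tau> \<subseteq> V) \<and> (\<forall>\<tau>\<in>S. \<forall>\<rho>. \<rho> \<subseteq> \<tau> \<longrightarrow> \<rho> \<in> S)"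

definition weight :: "'a set set \<Rightarrow> ('a set \<Rightarrow> real) \<Rightarrow> bool" where
  "weight S m \<longleftrightarrow> (\<forall>\<tau>\<in>S. 0 < m \<tau>)"

text \<open>The passage from \<open>\<Sigma>\<close>-hat (\<open>S\<close>) to \<open>\<Sigma>\<close>; the vertices are the simplices of cardinality 1.\<close>

definition complex_of :: "'a set set \<Rightarrow> ('a set \<Rightarrow> real) \<Rightarrow> 'a set set" where
  "complex_of S m = (if m summable_on {\<tau>\<in>S. card \<tau> = 1} then S else S - {{}})"

definition facet :: "'a set \<Rightarrow> 'a set \<Rightarrow> bool" where
  "facet \<tau> \<sigma> \<longleftrightarrow> \<tau> \<subset> \<sigma> \<and> card (\<sigma> - \<tau>) = 1"

definition locally_summable :: "'a set set \<Rightarrow> ('a set \<Rightarrow> real) \<Rightarrow> bool" where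
  "locally_summable X m \<longleftrightarrow> (\<forall>\<tau>\<in>X. m summable_on {\<sigma>\<in>X. facet \<tau> \<sigma>})"

text \<open>Functions on \<open>X\<close> are functions on the whole type that vanish outside \<open>X\<close>.\<close>

definition Fun :: "'a set set \<Rightarrow> ('a set \<Rightarrow> real) set" where
  "Fun X = {\<omega>. \<forall>\<sigma>. \<sigma> \<notin> X \<longrightarrow> \<omega> \<sigma> = 0}"

definition Fun_c :: "'a set set \<Rightarrow> ('a set \<Rightarrow> real) set" where
  "Fun_c X = {\<omega>\<in>Fun X. finite {\<sigma>. \<omega> \<sigma> \<noteq> 0}}"

definition Fun_1 :: "'a set set \<Rightarrow> ('a set \<Rightarrow> real) \<Rightarrow> ('a set \<Rightarrow> real) set" where
  "Fun_1 X m = {\<omega>\<in>Fun X. \<forall>\<tau>\<in>X. (\<lambda>\<sigma>. m \<sigma> * \<bar>\<omega> \<sigma>\<bar>) summable_on {\<sigma>\<in>X. facet \<tau> \<sigma>}}"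

definition incidence ::
    "(('a set \<Rightarrow> real) \<Rightarrow> 'a set \<Rightarrow> real) \<Rightarrow> 'a set \<Rightarrow> 'a set \<Rightarrow> real" where
  "incidence \<delta> \<tau> \<sigma> = \<delta> (indicator {\<tau>}) \<sigma>"

definition coboundary_operator ::
    "'a set set \<Rightarrow> (('a set \<Rightarrow> real) \<Rightarrow> 'a set \<Rightarrow> real) \<Rightarrow> bool" where
  "coboundary_operator X \<delta> \<longleftrightarrow>
     (\<forall>\<omega>\<in>Fun X. \<delta> \<omega> \<in> Fun X) \<and>
     (\<forall>\<omega>\<in>Fun X. \<forall>\<eta>\<in>Fun X. \<delta> (\<omega> + \<eta>) = \<delta> \<omega> + \<delta> \<eta>) \<and>
     (\<forall>c. \<forall>\<omega>\<in>Fun X. \<delta> (c *\<^sub>R \<omega>) = c *\<^sub>R \<delta> \<omega>) \<and>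
     (\<forall>\<omega>\<in>Fun X. \<delta> (\<delta> \<omega>) = 0) \<and>
     (\<forall>\<tau>\<in>X. \<forall>\<sigma>\<in>X. incidence \<delta> \<tau> \<sigma> \<in> {-1, 0, 1}) \<and>
     (\<forall>\<tau>\<in>X. \<forall>\<sigma>\<in>X. incidence \<delta> \<tau> \<sigma> \<noteq> 0 \<longleftrightarrow> facet \<tau> \<sigma>) \<and>
     (\<forall>\<omega>\<in>Fun X. \<forall>\<sigma>\<in>X. \<delta> \<omega> \<sigma> = (\<Sum>\<tau> | \<tau> \<in> X \<and> facet \<tau> \<sigma>. \<omega> \<tau> * incidence \<delta> \<tau> \<sigma>))"

text \<open>Meaningful for \<open>\<omega> \<in> Fun_1 X m\<close>.\<close>

definition boundary :: "'a set set \<Rightarrow> ('a set \<Rightarrow> real) \<Rightarrow>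
    (('a set \<Rightarrow> real) \<Rightarrow> 'a set \<Rightarrow> real) \<Rightarrow> ('a set \<Rightarrow> real) \<Rightarrow> 'a set \<Rightarrow> real" where
  "boundary X m \<delta> \<omega> = (\<lambda>\<rho>. if \<rho> \<in> X
     then 1 / m \<rho> * (\<Sum>\<^sub>\<infinity>\<tau>\<in>{\<tau>\<in>X. facet \<rho> \<tau>}. m \<tau> * \<omega> \<tau> * incidence \<delta> \<rho> \<tau>) else 0)"

definition norm_sq :: "'a set set \<Rightarrow> ('a set \<Rightarrow> real) \<Rightarrow> ('a set \<Rightarrow> real) \<Rightarrow> ennreal" where
  "norm_sq X m \<omega> = (\<Sum>\<^sub>\<infinity>\<sigma>\<in>X. ennreal (m \<sigma> * (\<omega> \<sigma>)\<^sup>2))"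

definition ell2 :: "'a set set \<Rightarrow> ('a set \<Rightarrow> real) \<Rightarrow> ('a set \<Rightarrow> real) set" where
  "ell2 X m = {\<omega>\<in>Fun X. norm_sq X m \<omega> < \<infinity>}"

definition ell2_inner :: "'a set set \<Rightarrow> ('a set \<Rightarrow> real) \<Rightarrow> ('a set \<Rightarrow> real) inner_prod" where
  "ell2_inner X m \<omega> \<eta> = (\<Sum>\<^sub>\<infinity>\<sigma>\<in>X. m \<sigma> * \<omega> \<sigma> * \<eta> \<sigma>)"

text \<open>The forms take the value \<open>\<infinity>\<close> outside the space on which they are defined.\<close>

definition Q_plus where
  "Q_plus X m \<delta> \<omega> = (if \<omega> \<in> Fun X then norm_sq X m (\<delta> \<omega>) else \<infinity>)"

definition Q_minus where
  "Q_minus X m \<delta> \<omega> = (if \<omega> \<in> Fun_1 X m then norm_sq X m (boundary X m \<delta> \<omega>) else \<infinity>)"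

definition Q_Hodge where
  "Q_Hodge X m \<delta> \<omega> =
     (if \<omega> \<in> Fun_1 X m then norm_sq X m (\<delta> \<omega> + boundary X m \<delta> \<omega>) else \<infinity>)"

definition dom_N :: "'a set set \<Rightarrow> ('a set \<Rightarrow> real) \<Rightarrow>
    (('a set \<Rightarrow> real) \<Rightarrow> ennreal) \<Rightarrow> ('a set \<Rightarrow> real) set" where
  "dom_N X m Q = {\<omega>\<in>ell2 X m. Q \<omega> < \<infinity>}"

text \<open>The closure of \<open>Fun_c X\<close> in \<open>dom_N X m Q\<close> with respect to the form norm.\<close>

definition dom_D :: "'a set set \<Rightarrow> ('a set \<Rightarrow> real) \<Rightarrow>
    (('a set \<Rightarrow> real) \<Rightarrow> ennreal) \<Rightarrow> ('a set \<Rightarrow> real) set" where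
  "dom_D X m Q = {\<omega>\<in>dom_N X m Q. \<forall>e>0. \<exists>\<phi>\<in>Fun_c X.
     Q (\<omega> - \<phi>) + norm_sq X m (\<omega> - \<phi>) < ennreal (e\<^sup>2)}"

definition Laplacian_N where
  "Laplacian_N X m Q = form_operator (ell2 X m) (ell2_inner X m) (dom_N X m Q) Q"

definition Laplacian_D where
  "Laplacian_D X m Q = form_operator (ell2 X m) (ell2_inner X m) (dom_D X m Q) Q"

end

theory Submission
  imports Defs
begin

text \<open>
  Each of the three pairs of Laplacians has the form \<open>A\<^sup>* A\<close>, \<open>A A\<^sup>*\<close>. By local summability, summation by parts
  holds between finitely supported and square summable functions, so that the maximal operator
  defined by \<open>\<partial>\<close> (by \<open>\<delta>\<close>, by \<open>\<delta> + \<partial>\<close>) is the adjoint \<open>B\<close> of the closure \<open>A\<close> of \<open>\<delta>\<close> (of \<open>\<partial>\<close>, of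
  \<open>\<delta> + \<partial>\<close>) restricted to finitely supported functions. For \<open>z \<noteq> 0\<close>, a resolvent of \<open>A B\<close> at \<open>z\<close> gives one
  of \<open>B A\<close> by
  \[ (B A - z)^{-1} = -\frac 1 z (1 + B A)^{-1} + \Big(1 + \frac 1 z\Big) B (A B - z)^{-1} A (1 + B A)^{-1}, \]
  which only uses that \<open>1 + B A\<close> is onto (von Neumann). The formula respects parts of the operators in
  subspaces that \<open>A\<close> and \<open>B\<close> map into each other. A spectral measure \<open>E\<close> of \<open>B A\<close> is transported to a
  spectral measure \<open>E'\<close> of \<open>A B\<close> by \<open>E' C (A u) = A (E C u)\<close>, without polar decomposition, and then
  \<open>A\<close> and \<open>B\<close> intertwine \<open>E\<close> and \<open>E'\<close>. Hence they map null sets to null sets, and with them the pure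
  point, absolutely continuous and singular continuous subspaces into each other.
\<close>

section \<open>Hilbert spaces on a carrier set\<close>

text \<open>The resolvent formula has two sources. The naive
  \<open>(B A - z)^{-1} = -(1/z) (1 - B (A B - z)^{-1} A)\<close> makes sense on the domain of
  \<open>A\<close> only. It is inserted into the resolvent identity \<open>(B A - z)^{-1} = (1 + B
  A)^{-1} + (1 + z) (B A - z)^{-1} (1 + B A)^{-1}\<close>, whose smoothing factor first moves every
  vector into that domain. The finer spectra quantify over spectral measures, so the transported
  \<open>E'\<close> must be shown to represent \<open>A B\<close>, and this is done without
  functional calculus. The key is that the scalar measure of \<open>A u\<close> under
  \<open>E'\<close> is x times that of \<open>u\<close> under \<open>E\<close>, with a mirror image
  for \<open>B\<close>. On an interval (a,b] this amounts to bounding \<open>|A u|^2\<close> below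
  by \<open>a |u|^2\<close> and above by \<open>b |u|^2\<close>, a statement about first moments;
  bisection turns such bounds into a density. Then the first moment of \<open>E'\<close> is the form
  \<open>|B f|^2\<close> and its second moment is \<open>|A B y|^2\<close>, which is what the
  definition of a spectral measure asks for. Domains are controlled by testing against the domain of
  \<open>B A\<close> alone: it is dense, a core for \<open>A\<close>, and invariant under
  \<open>E\<close>.\<close>

definition hnorm :: "'v inner_prod \<Rightarrow> 'v \<Rightarrow> real" where
  "hnorm ip x = sqrt (ip x x)"

text \<open>The Hilbert spaces met here, \<open>ell2 X m\<close> and its square, are subsets of
  ambient vector spaces of functions and pairs, so all axioms are relativized to the carrier
  \<open>H\<close>.\<close>

locale hilbert =
  fixes H :: "'v::real_vector set" and ip :: "'v inner_prod"
  assumes subspace_H: "subspace H"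
    and ip_commute: "x \<in> H \<Longrightarrow> y \<in> H \<Longrightarrow> ip x y = ip y x"
    and ip_add_left: "x \<in> H \<Longrightarrow> y \<in> H \<Longrightarrow> z \<in> H \<Longrightarrow> ip (x + y) z = ip x z + ip y z"
    and ip_scale_left: "x \<in> H \<Longrightarrow> y \<in> H \<Longrightarrow> ip (c *\<^sub>R x) y = c * ip x y"
    and ip_pos: "x \<in> H \<Longrightarrow> x \<noteq> 0 \<Longrightarrow> 0 < ip x x"
    and complete: "(\<And>n::nat. X n \<in> H) \<Longrightarrow>
      (\<And>e. e > 0 \<Longrightarrow> \<exists>N. \<forall>m\<ge>N. \<forall>n\<ge>N. hnorm ip (X m - X n) < e) \<Longrightarrow>
      \<exists>l\<in>H. (\<lambda>n. hnorm ip (X n - l)) \<longlonglongrightarrow> 0"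
begin

abbreviation nrm where "nrm \<equiv> hnorm ip"

lemma zero_mem [simp]: "0 \<in> H"
  using subspace_H by (rule subspace_0)
lemma add_mem [simp]: "x \<in> H \<Longrightarrow> y \<in> H \<Longrightarrow> x + y \<in> H"
  using subspace_H by (rule subspace_add)
lemma diff_mem [simp]: "x \<in> H \<Longrightarrow> y \<in> H \<Longrightarrow> x - y \<in> H"
  using subspace_H by (rule subspace_diff)
lemma scale_mem [simp]: "x \<in> H \<Longrightarrow> c *\<^sub>R x \<in> H"
  using subspace_H by (rule subspace_scale)
lemma minus_mem [simp]: "x \<in> H \<Longrightarrow> - x \<in> H"
  using subspace_H by (rule subspace_neg)

lemma ip_add_right: "x \<in> H \<Longrightarrow> y \<in> H \<Longrightarrow> z \<in> H \<Longrightarrow> ip z (x + y) = ip z x + ip z y"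
  by (metis ip_add_left ip_commute add_mem)
lemma ip_scale_right: "x \<in> H \<Longrightarrow> y \<in> H \<Longrightarrow> ip y (c *\<^sub>R x) = c * ip y x"
  by (metis ip_scale_left ip_commute scale_mem)
lemma ip_minus_left: "x \<in> H \<Longrightarrow> y \<in> H \<Longrightarrow> ip (- x) y = - ip x y"
  using ip_scale_left[of x y "-1"] by simp
lemma ip_minus_right: "x \<in> H \<Longrightarrow> y \<in> H \<Longrightarrow> ip x (- y) = - ip x y"
  using ip_scale_right[of y x "-1"] by simp
lemma ip_diff_left: "x \<in> H \<Longrightarrow> y \<in> H \<Longrightarrow> z \<in> H \<Longrightarrow> ip (x - y) z = ip x z - ip y z"
  using ip_add_left[of x "-y" z] by (simp add: ip_minus_left)
lemma ip_diff_right: "x \<in> H \<Longrightarrow> y \<in> H \<Longrightarrow> z \<in> H \<Longrightarrow> ip z (x - y) = ip z x - ip z y"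
  using ip_add_right[of x "-y" z] by (simp add: ip_minus_right)
lemma ip_zero_left [simp]: "x \<in> H \<Longrightarrow> ip 0 x = 0"
  using ip_scale_left[of x x 0] by simp
lemma ip_zero_right [simp]: "x \<in> H \<Longrightarrow> ip x 0 = 0"
  using ip_scale_right[of x x 0] by simp

lemmas ip_simps = ip_add_left ip_add_right ip_scale_left ip_scale_right ip_minus_left
  ip_minus_right ip_diff_left ip_diff_right

lemma ip_nonneg [simp]: "x \<in> H \<Longrightarrow> 0 \<le> ip x x"
  by (cases "x = 0") (auto dest: ip_pos)
lemma ip_self_eq_0 [simp]: "x \<in> H \<Longrightarrow> ip x x = 0 \<longleftrightarrow> x = 0"
  by (metis ip_pos ip_zero_left less_irrefl)
lemma ip_le_0: "x \<in> H \<Longrightarrow> ip x x \<le> 0 \<Longrightarrow> x = 0"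
  using ip_nonneg ip_self_eq_0 by (metis order_antisym)

lemma nrm_sq: "x \<in> H \<Longrightarrow> (nrm x)\<^sup>2 = ip x x"
  by (simp add: hnorm_def)
lemma nrm_nonneg [simp]: "x \<in> H \<Longrightarrow> 0 \<le> nrm x"
  by (simp add: hnorm_def)
lemma nrm_eq_0 [simp]: "x \<in> H \<Longrightarrow> nrm x = 0 \<longleftrightarrow> x = 0"
  by (simp add: hnorm_def)
lemma nrm_zero [simp]: "nrm 0 = 0"
  by simp
lemma nrm_scale: "x \<in> H \<Longrightarrow> nrm (c *\<^sub>R x) = \<bar>c\<bar> * nrm x"
  by (simp add: hnorm_def ip_simps real_sqrt_mult flip: mult.assoc power2_eq_square)
lemma nrm_minus: "x \<in> H \<Longrightarrow> nrm (- x) = nrm x"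
  using nrm_scale[of x "-1"] by simp
lemma nrm_diff_commute: "x \<in> H \<Longrightarrow> y \<in> H \<Longrightarrow> nrm (x - y) = nrm (y - x)"
  using nrm_minus[of "x - y"] by simp

lemma cauchy_schwarz:
  assumes "x \<in> H" "y \<in> H" shows "\<bar>ip x y\<bar> \<le> nrm x * nrm y"
proof (cases "y = 0")
  case False
  then have y: "ip y y > 0" using assms ip_pos by auto
  have "0 \<le> ip (ip y y *\<^sub>R x - ip x y *\<^sub>R y) (ip y y *\<^sub>R x - ip x y *\<^sub>R y)"
    using assms by simp
  also have "\<dots> = ip y y * (ip x x * ip y y - (ip x y)\<^sup>2)"
    using assms ip_commute[of y x] by (simp add: ip_simps algebra_simps power2_eq_square)
  finally have "(ip x y)\<^sup>2 \<le> ip x x * ip y y"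
    using y by (simp add: zero_le_mult_iff)
  also have "\<dots> = (nrm x * nrm y)\<^sup>2"
    using assms by (simp add: power_mult_distrib nrm_sq)
  finally show ?thesis
    using assms by (metis nrm_nonneg abs_le_square_iff abs_of_nonneg mult_nonneg_nonneg)
qed (use assms in simp)

lemma ip_le_nrm: "x \<in> H \<Longrightarrow> y \<in> H \<Longrightarrow> ip x y \<le> nrm x * nrm y"
  using cauchy_schwarz by fastforce

lemma nrm_triangle:
  assumes "x \<in> H" "y \<in> H" shows "nrm (x + y) \<le> nrm x + nrm y"
proof (rule power2_le_imp_le)
  show "(nrm (x + y))\<^sup>2 \<le> (nrm x + nrm y)\<^sup>2"
    using assms ip_le_nrm[OF assms] ip_commute[of x y]
    by (simp add: nrm_sq ip_simps power2_sum)
qed (use assms in simp)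

lemma tendsto_ip:
  assumes "\<And>n. u n \<in> H" "p \<in> H" "x \<in> H" "(\<lambda>n. nrm (u n - p)) \<longlonglongrightarrow> 0"
  shows "(\<lambda>n. ip (u n) x) \<longlonglongrightarrow> ip p x"
proof -
  have "(\<lambda>n. ip (u n) x - ip p x) \<longlonglongrightarrow> 0"
  proof (rule Lim_null_comparison)
    show "\<forall>\<^sub>F n in sequentially. norm (ip (u n) x - ip p x) \<le> nrm (u n - p) * nrm x"
      using assms cauchy_schwarz[of "u _ - p" x] by (simp add: ip_simps)
    show "(\<lambda>n. nrm (u n - p) * nrm x) \<longlonglongrightarrow> 0"
      using tendsto_mult_right[OF assms(4), of "nrm x"] by simp
  qed
  then show ?thesis by (simp add: LIM_zero_iff)
qed

lemma tendsto_nrm: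
  assumes "\<And>n. u n \<in> H" "p \<in> H" "(\<lambda>n. nrm (u n - p)) \<longlonglongrightarrow> 0"
  shows "(\<lambda>n. nrm (u n)) \<longlonglongrightarrow> nrm p"
proof -
  have "(\<lambda>n. nrm (u n) - nrm p) \<longlonglongrightarrow> 0"
  proof (rule Lim_null_comparison)
    have "\<bar>nrm (u n) - nrm p\<bar> \<le> nrm (u n - p)" for n
      using assms nrm_triangle[of "u n - p" p] nrm_triangle[of "p - u n" "u n"]
        nrm_diff_commute[of p "u n"] by simp
    then show "\<forall>\<^sub>F n in sequentially. norm (nrm (u n) - nrm p) \<le> nrm (u n - p)"
      by simp
  qed (rule assms)
  then show ?thesis by (simp add: LIM_zero_iff)
qed

text \<open>The Riesz representation of a bounded functional on a not necessarily closed subspace; the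
  minimizing sequence is kept because it witnesses that the representing vector lies in the closure.\<close>

lemma riesz_subspace:
  assumes K: "subspace K" "K \<subseteq> H"
    and add: "\<And>x y. x \<in> K \<Longrightarrow> y \<in> K \<Longrightarrow> \<phi> (x + y) = \<phi> x + \<phi> y"
    and scale: "\<And>c x. x \<in> K \<Longrightarrow> \<phi> (c *\<^sub>R x) = c * \<phi> x"
    and bound: "\<And>x. x \<in> K \<Longrightarrow> \<phi> x \<le> C * nrm x"
  obtains u :: "nat \<Rightarrow> 'v" and p where "\<And>n. u n \<in> K" "p \<in> H" "(\<lambda>n. nrm (u n - p)) \<longlonglongrightarrow> 0"
    "\<And>k. k \<in> K \<Longrightarrow> \<phi> k = ip p k"
proof -
  have KH: "x \<in> H" if "x \<in> K" for x using K that by auto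
  \<comment> \<open>The energy whose minimizer over the closure of \<open>K\<close> represents
    \<open>\<phi>\<close>. As \<open>K\<close> need not be closed, a minimizing sequence inside
    \<open>K\<close> takes its place.\<close>
  define J where "J x = ip x x - 2 * \<phi> x" for x
  define d where "d = Inf (J ` K)"
  have low: "J x \<ge> - C\<^sup>2" if "x \<in> K" for x
  proof -
    have "0 \<le> (nrm x - C)\<^sup>2" by simp
    then show ?thesis
      using bound[OF that] nrm_sq[OF KH[OF that]]
      by (simp add: J_def power2_diff mult.commute)
  qed
  then have bdd: "bdd_below (J ` K)" by (auto intro!: bdd_belowI2)
  have d_le: "d \<le> J x" if "x \<in> K" for x
    unfolding d_def using bdd that by (auto intro: cInf_lower)
  have "\<exists>u\<in>K. J u < d + 1 / real (Suc n)" for n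
  proof -
    have "J ` K \<noteq> {}" using subspace_0[OF K(1)] by auto
    then show ?thesis
      using cInf_lessD[of "J ` K" "d + 1 / real (Suc n)"] by (auto simp: d_def)
  qed
  then obtain u where u: "\<And>n. u n \<in> K" "\<And>n. J (u n) < d + 1 / real (Suc n)" by metis
  have uH: "u n \<in> H" for n using u KH by auto
  \<comment> \<open>Parallelogram law: \<open>J\<close> is at least \<open>d\<close> at the midpoint
    and at most 1 / (n + 1) above \<open>d\<close> at \<open>u n\<close>, so the sequence is
    Cauchy.\<close>
  have par: "(nrm (u m - u n))\<^sup>2 \<le> 2 / real (Suc m) + 2 / real (Suc n)" for m n
  proof -
    have mid: "(1/2) *\<^sub>R (u m + u n) \<in> K"
      using K(1) u by (simp add: subspace_add subspace_scale)
    have "\<phi> ((1/2) *\<^sub>R (u m + u n)) = (\<phi> (u m) + \<phi> (u n)) / 2"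
      using K(1) u by (simp add: scale add subspace_add)
    then have "(nrm (u m - u n))\<^sup>2 = 2 * J (u m) + 2 * J (u n) - 4 * J ((1/2) *\<^sub>R (u m + u n))"
      using uH by (simp add: nrm_sq J_def ip_simps algebra_simps)
    then show ?thesis using d_le[OF mid] u(2)[of m] u(2)[of n] by simp
  qed
  have "\<exists>N. \<forall>m\<ge>N. \<forall>n\<ge>N. nrm (u m - u n) < e" if "e > 0" for e
  proof -
    obtain N :: nat where N: "4 / e\<^sup>2 < real (Suc N)"
      by (metis reals_Archimedean2 less_trans lessI of_nat_less_iff)
    have "nrm (u m - u n) < e" if "m \<ge> N" "n \<ge> N" for m n
    proof (rule power2_less_imp_less)
      have "2 / real (Suc m) \<le> 2 / real (Suc N)" "2 / real (Suc n) \<le> 2 / real (Suc N)"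
        using that by (auto intro!: divide_left_mono)
      then have "(nrm (u m - u n))\<^sup>2 \<le> 4 / real (Suc N)" using par[of m n] by simp
      also have "\<dots> < e\<^sup>2" using N \<open>e > 0\<close> by (simp add: field_simps)
      finally show "(nrm (u m - u n))\<^sup>2 < e\<^sup>2" .
    qed (use \<open>e > 0\<close> in simp)
    then show ?thesis by blast
  qed
  then obtain p where p: "p \<in> H" "(\<lambda>n. nrm (u n - p)) \<longlonglongrightarrow> 0"
    using complete[of u] uH by blast
  have "\<phi> k = ip p k" if k: "k \<in> K" for k
  proof -
    have kH: "k \<in> H" using KH k by simp
    have ineq: "(\<phi> k - ip (u n) k)\<^sup>2 \<le> ip k k / real (Suc n)" for n
    proof (cases "k = 0")
      case True
      then show ?thesis using scale[OF k, of 0] uH by simp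
    next
      case False
      define c where "c = \<phi> k - ip (u n) k"
      \<comment> \<open>The optimal step length in direction \<open>k\<close>; it turns
        near-minimality of \<open>u n\<close> into a bound on the defect \<open>c\<close>.\<close>
      define t where "t = c / ip k k"
      have pos: "ip k k > 0" using ip_pos kH False by simp
      have "d \<le> J (u n + t *\<^sub>R k)"
        using K(1) u k by (auto intro!: d_le subspace_add subspace_scale)
      also have "\<dots> = J (u n) + t\<^sup>2 * ip k k - 2 * t * c"
        using u k K(1) uH kH ip_commute[OF uH kH, of n]
        by (simp add: J_def ip_simps add scale subspace_scale c_def algebra_simps power2_eq_square)
      also have "\<dots> = J (u n) - c\<^sup>2 / ip k k"
        using pos by (simp add: t_def power2_eq_square field_simps)
      finally have "c\<^sup>2 / ip k k \<le> 1 / real (Suc n)" using u(2)[of n] by simp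
      then show ?thesis using pos by (simp add: c_def field_simps)
    qed
    have "(\<lambda>n. (\<phi> k - ip (u n) k)\<^sup>2) \<longlonglongrightarrow> (\<phi> k - ip p k)\<^sup>2"
      by (intro tendsto_intros tendsto_ip uH p kH)
    moreover have "(\<lambda>n. ip k k / real (Suc n)) \<longlonglongrightarrow> 0"
      using LIMSEQ_Suc[OF lim_const_over_n[of "ip k k"]] by simp
    ultimately have "(\<phi> k - ip p k)\<^sup>2 \<le> 0"
      using ineq by (intro LIMSEQ_le) auto
    then show ?thesis by simp
  qed
  then show ?thesis using that u(1) p by blast
qed

text \<open>The Riesz vector \<open>p\<close> of \<open>ip q\<close> on \<open>K\<close> is a limit
  of elements of \<open>K\<close>, and \<open>q - p\<close> is orthogonal to \<open>K\<close>, hence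
  to \<open>p\<close> by continuity and to \<open>q\<close> by hypothesis; so \<open>q = p\<close>.
  Closures and density enter the later arguments in this form.\<close>

lemma approximating_sequence:
  assumes K: "subspace K" "K \<subseteq> H" and q: "q \<in> H"
    and perp: "\<And>x. x \<in> H \<Longrightarrow> (\<And>k. k \<in> K \<Longrightarrow> ip x k = 0) \<Longrightarrow> ip x q = 0"
  obtains u :: "nat \<Rightarrow> 'v" where "\<And>n. u n \<in> K" "(\<lambda>n. nrm (u n - q)) \<longlonglongrightarrow> 0"
proof -
  have KH: "x \<in> H" if "x \<in> K" for x using K that by auto
  obtain u p where up: "\<And>n. u n \<in> K" "p \<in> H" "(\<lambda>n. nrm (u n - p)) \<longlonglongrightarrow> 0"
    "\<And>k. k \<in> K \<Longrightarrow> ip q k = ip p k"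
    by (rule riesz_subspace[of K "ip q" "nrm q"])
      (use K KH q in \<open>auto simp: ip_simps ip_le_nrm\<close>)
  have 1: "ip (q - p) k = 0" if "k \<in> K" for k
    using up that KH q by (simp add: ip_simps)
  then have "ip (q - p) q = 0" using perp q up by simp
  moreover have "ip (q - p) p = 0"
  proof -
    have "(\<lambda>n. ip (u n) (q - p)) \<longlonglongrightarrow> ip p (q - p)"
      using up q KH by (intro tendsto_ip) auto
    moreover have "ip (u n) (q - p) = 0" for n
      using 1[OF up(1)] ip_commute up q KH by simp
    ultimately show ?thesis
      using ip_commute up q by (simp add: LIMSEQ_const_iff)
  qed
  ultimately have "ip (q - p) (q - p) = 0" using q up by (simp add: ip_diff_right)
  then have "q = p" using q up by simp
  then show ?thesis using that up by blast
qed

text \<open>Testing \<open>q\<close> against its own approximants from \<open>K\<close> gives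
  \<open>(nrm q)^2 <= C * nrm q\<close> in the limit.\<close>

lemma nrm_le_of_ip_le:
  assumes K: "subspace K" "K \<subseteq> H" and q: "q \<in> H"
    and perp: "\<And>x. x \<in> H \<Longrightarrow> (\<And>k. k \<in> K \<Longrightarrow> ip x k = 0) \<Longrightarrow> ip x q = 0"
    and le: "\<And>k. k \<in> K \<Longrightarrow> ip q k \<le> C * nrm k" and C: "0 \<le> C"
  shows "nrm q \<le> C"
proof -
  obtain u where u: "\<And>n. u n \<in> K" "(\<lambda>n. nrm (u n - q)) \<longlonglongrightarrow> 0"
    using approximating_sequence[OF K q perp] by blast
  have uH: "u n \<in> H" for n using u K by auto
  have "(\<lambda>n. ip (u n) q) \<longlonglongrightarrow> ip q q" "(\<lambda>n. C * nrm (u n)) \<longlonglongrightarrow> C * nrm q"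
    using u uH q by (auto intro!: tendsto_ip tendsto_mult_left tendsto_nrm)
  moreover have "ip (u n) q \<le> C * nrm (u n)" for n
    using le[OF u(1)] ip_commute uH q by metis
  ultimately have "ip q q \<le> C * nrm q" by (intro LIMSEQ_le) auto
  then have "nrm q * nrm q \<le> C * nrm q" using nrm_sq[OF q] by (simp add: power2_eq_square)
  then show ?thesis using q C by (cases "nrm q = 0") (auto simp: less_le)
qed

section \<open>Orthogonal complements and projections onto closed spans\<close>

definition orth :: "'v set \<Rightarrow> 'v set" where
  "orth M = {x\<in>H. \<forall>k\<in>M. ip x k = 0}"

lemma subspace_orth: "M \<subseteq> H \<Longrightarrow> subspace (orth M)"
  by (auto simp: orth_def subspace_def ip_simps subset_iff)

text \<open>Riesz on \<open>orth M\<close> yields the component in \<open>orth M\<close>, which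
  stays there because orthogonality to \<open>M\<close> survives limits; the remainder is the
  projection.\<close>

lemma ex_proj:
  assumes M: "M \<subseteq> H" and x: "x \<in> H"
  shows "\<exists>p. p \<in> orth (orth M) \<and> x - p \<in> orth M"
proof -
  have sub: "subspace (orth M)" "orth M \<subseteq> H"
    using M by (simp_all add: subspace_orth) (auto simp: orth_def)
  obtain u p where up: "\<And>n. u n \<in> orth M" "p \<in> H" "(\<lambda>n. nrm (u n - p)) \<longlonglongrightarrow> 0"
    "\<And>k. k \<in> orth M \<Longrightarrow> ip x k = ip p k"
    by (rule riesz_subspace[of "orth M" "ip x" "nrm x"])
      (use sub x in \<open>auto simp: ip_simps subset_iff ip_le_nrm\<close>)
  have "ip p k = 0" if "k \<in> M" for k
  proof -
    have "(\<lambda>n. ip (u n) k) \<longlonglongrightarrow> ip p k"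
      using up sub M that by (intro tendsto_ip) auto
    moreover have "ip (u n) k = 0" for n using up(1)[of n] that by (simp add: orth_def)
    ultimately show ?thesis by (simp add: LIMSEQ_const_iff)
  qed
  then have "p \<in> orth M" using up by (simp add: orth_def)
  moreover have "x - p \<in> orth (orth M)"
    using up x sub by (auto simp: orth_def ip_simps)
  ultimately show ?thesis by (intro exI[of _ "x - p"]) simp
qed

text \<open>The projection onto the closed linear span of \<open>M\<close>, encoded as
  \<open>orth (orth M)\<close> so that \<open>M\<close> may be any set of generators.\<close>

definition proj :: "'v set \<Rightarrow> 'v \<Rightarrow> 'v" where
  "proj M x = (SOME p. p \<in> orth (orth M) \<and> x - p \<in> orth M)"

lemma proj:
  assumes "M \<subseteq> H" "x \<in> H"
  shows "proj M x \<in> orth (orth M)" "x - proj M x \<in> orth M" "proj M x \<in> H"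
  using someI_ex[OF ex_proj[OF assms]] by (auto simp: proj_def orth_def)

lemma orth_orthD: "x \<in> orth (orth M) \<Longrightarrow> y \<in> orth M \<Longrightarrow> ip x y = 0"
  by (auto simp: orth_def)

lemma orth_subset: "orth M \<subseteq> H"
  by (auto simp: orth_def)

lemma projI:
  assumes M: "M \<subseteq> H" and p: "p \<in> orth (orth M)" "x - p \<in> orth M" and x: "x \<in> H"
  shows "proj M x = p"
proof -
  have pH: "p \<in> H" "proj M x \<in> H" using p proj[OF M x] by (auto simp: orth_def)
  have "proj M x - p \<in> orth (orth M)"
    using subspace_diff[OF subspace_orth[OF orth_subset]] proj[OF M x] p by blast
  moreover have "(x - p) - (x - proj M x) \<in> orth M"
    using subspace_diff[OF subspace_orth[OF M]] proj[OF M x] p by blast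
  ultimately have "ip (proj M x - p) (proj M x - p) = 0"
    using orth_orthD by simp
  then show ?thesis using pH by simp
qed

lemma orthogonal_projection_proj:
  assumes M: "M \<subseteq> H"
  shows "orthogonal_projection H ip (proj M)"
  unfolding orthogonal_projection_def
proof (intro conjI ballI allI)
  note sub = subspace_orth[OF M] subspace_orth[OF orth_subset[of M]]
  fix f g c assume f: "f \<in> H" and g: "g \<in> H"
  show "proj M f \<in> H" using proj M f by simp
  show "proj M (f + g) = proj M f + proj M g"
    using proj[OF M f] proj[OF M g] f g sub
      subspace_add[OF sub(1), of "f - proj M f" "g - proj M g"]
    by (intro projI M subspace_add[OF sub(2)]) (auto simp: algebra_simps)
  show "proj M (c *\<^sub>R f) = c *\<^sub>R proj M f"
    using proj[OF M f] f sub subspace_scale[OF sub(1), of "f - proj M f" c]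
    by (intro projI M subspace_scale[OF sub(2)]) (auto simp: algebra_simps)
  show "proj M (proj M f) = proj M f"
    using proj[OF M f] sub by (intro projI M) (auto simp: subspace_0)
  have "ip (proj M f) (g - proj M g) = 0" "ip (proj M g) (f - proj M f) = 0"
    using proj[OF M f] proj[OF M g] orth_orthD by auto
  then show "ip (proj M f) g = ip f (proj M g)"
    using proj[OF M f] proj[OF M g] f g
    by (simp add: ip_simps) (metis ip_commute)
qed

end

text \<open>In the direct sum the graph of an unbounded operator becomes a subspace, to which
  orthogonal complements and closures apply.\<close>

lemma hilbert_prod:
  assumes "hilbert H ip"
  shows "hilbert (H \<times> H) (\<lambda>x y. ip (fst x) (fst y) + ip (snd x) (snd y))" (is "hilbert _ ?ip")
proof -
  interpret hilbert H ip by fact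
  show ?thesis
  proof
    fix X :: "nat \<Rightarrow> 'a \<times> 'a"
    assume X: "\<And>n. X n \<in> H \<times> H"
      and Cau: "\<And>e. e > 0 \<Longrightarrow> \<exists>N. \<forall>m\<ge>N. \<forall>n\<ge>N. hnorm ?ip (X m - X n) < e"
    have mem: "fst (X n) \<in> H" "snd (X n) \<in> H" for n
      using X[of n] by (auto simp: mem_Times_iff)
    have le: "nrm (fst x) \<le> hnorm ?ip x" "nrm (snd x) \<le> hnorm ?ip x" if "x \<in> H \<times> H" for x
      using that by (auto simp: hnorm_def)
    have mem2: "X m - X n \<in> H \<times> H" for m n
      using mem by (simp add: mem_Times_iff)
    have "\<exists>N. \<forall>m\<ge>N. \<forall>n\<ge>N. nrm (fst (X m) - fst (X n)) < e" if "e > 0" for e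
      using Cau[OF that] le_less_trans[OF le(1)[OF mem2]] unfolding fst_diff by blast
    then obtain l where l: "l \<in> H" "(\<lambda>n. nrm (fst (X n) - l)) \<longlonglongrightarrow> 0"
      using complete[of "\<lambda>n. fst (X n)"] mem by auto
    have "\<exists>N. \<forall>m\<ge>N. \<forall>n\<ge>N. nrm (snd (X m) - snd (X n)) < e" if "e > 0" for e
      using Cau[OF that] le_less_trans[OF le(2)[OF mem2]] unfolding snd_diff by blast
    then obtain k where k: "k \<in> H" "(\<lambda>n. nrm (snd (X n) - k)) \<longlonglongrightarrow> 0"
      using complete[of "\<lambda>n. snd (X n)"] mem by auto
    have "(\<lambda>n. sqrt ((nrm (fst (X n) - l))\<^sup>2 + (nrm (snd (X n) - k))\<^sup>2)) \<longlonglongrightarrow> sqrt (0\<^sup>2 + 0\<^sup>2)"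
      by (intro tendsto_intros l k)
    then have "(\<lambda>n. hnorm ?ip (X n - (l, k))) \<longlonglongrightarrow> 0"
      using mem l k by (simp add: hnorm_def)
    then show "\<exists>l\<in>H \<times> H. (\<lambda>n. hnorm ?ip (X n - l)) \<longlonglongrightarrow> 0"
      using l k by (intro bexI[of _ "(l, k)"]) auto
  next
    fix x :: "'a \<times> 'a" assume "x \<in> H \<times> H" "x \<noteq> 0"
    then show "0 < ?ip x x"
      using ip_pos[of "fst x"] ip_pos[of "snd x"] ip_nonneg[of "fst x"] ip_nonneg[of "snd x"]
      by (cases x) (auto simp: zero_prod_def add_pos_nonneg add_nonneg_pos)
  qed (auto simp: subspace_def ip_simps algebra_simps ip_commute zero_prod_def)
qed

section \<open>Pairs of mutually adjoint operators\<close>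

definition comp_graph :: "'v set \<Rightarrow> ('v \<Rightarrow> 'v) \<Rightarrow> 'v set \<Rightarrow> ('v \<Rightarrow> 'v) \<Rightarrow> 'v graph" where
  "comp_graph DA A DB B = {(f, B (A f)) |f. f \<in> DA \<and> A f \<in> DB}"

text \<open>The two equivalences say that \<open>B\<close> is the full adjoint of \<open>A\<close>
  and \<open>A\<close> that of \<open>B\<close>, domains included. Linearity and the density of the
  domain of \<open>B A\<close> follow from them, and the two roles can be swapped.\<close>

locale adjoint_pair = hilbert H ip
  for H :: "'v::real_vector set" and ip :: "'v inner_prod" +
  fixes DA :: "'v set" and A :: "'v \<Rightarrow> 'v" and DB :: "'v set" and B :: "'v \<Rightarrow> 'v"
  assumes DA_subset: "DA \<subseteq> H" and A_mem [simp]: "u \<in> DA \<Longrightarrow> A u \<in> H"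
    and DB_subset: "DB \<subseteq> H" and B_mem [simp]: "v \<in> DB \<Longrightarrow> B v \<in> H"
    and adj1: "f \<in> H \<Longrightarrow> g \<in> H \<Longrightarrow> (\<forall>u\<in>DA. ip (A u) f = ip u g) \<longleftrightarrow> f \<in> DB \<and> B f = g"
    and adj2: "f \<in> H \<Longrightarrow> g \<in> H \<Longrightarrow> (\<forall>v\<in>DB. ip (B v) f = ip v g) \<longleftrightarrow> f \<in> DA \<and> A f = g"
begin

lemma dual: "adjoint_pair H ip DB B DA A"
  by unfold_locales (use DA_subset DB_subset adj1 adj2 in auto)

lemma DA_mem [simp]: "u \<in> DA \<Longrightarrow> u \<in> H" and DB_mem [simp]: "v \<in> DB \<Longrightarrow> v \<in> H"
  using DA_subset DB_subset by auto

lemma adj: "u \<in> DA \<Longrightarrow> v \<in> DB \<Longrightarrow> ip (A u) v = ip u (B v)"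
  using adj1[of v "B v"] by simp
lemma adj': "u \<in> DA \<Longrightarrow> v \<in> DB \<Longrightarrow> ip (B v) u = ip v (A u)"
  using adj2[of u "A u"] by simp

lemma A_add: assumes "f \<in> DA" "g \<in> DA" shows "f + g \<in> DA \<and> A (f + g) = A f + A g"
  using assms by (subst adj2[symmetric]) (auto simp: ip_simps adj')
lemma A_scale: assumes "f \<in> DA" shows "c *\<^sub>R f \<in> DA \<and> A (c *\<^sub>R f) = c *\<^sub>R A f"
  using assms by (subst adj2[symmetric]) (auto simp: ip_simps adj')
lemma A_diff: assumes "f \<in> DA" "g \<in> DA" shows "f - g \<in> DA \<and> A (f - g) = A f - A g"
  using assms by (subst adj2[symmetric]) (auto simp: ip_simps adj')
lemma A_zero: "0 \<in> DA \<and> A 0 = 0"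
  by (subst adj2[symmetric]) auto

lemma B_add: "f \<in> DB \<Longrightarrow> g \<in> DB \<Longrightarrow> f + g \<in> DB \<and> B (f + g) = B f + B g"
  by (rule adjoint_pair.A_add[OF dual])
lemma B_scale: "f \<in> DB \<Longrightarrow> c *\<^sub>R f \<in> DB \<and> B (c *\<^sub>R f) = c *\<^sub>R B f"
  by (rule adjoint_pair.A_scale[OF dual])
lemma B_diff: "f \<in> DB \<Longrightarrow> g \<in> DB \<Longrightarrow> f - g \<in> DB \<and> B (f - g) = B f - B g"
  by (rule adjoint_pair.A_diff[OF dual])
lemma B_zero: "0 \<in> DB \<and> B 0 = 0"
  by (rule adjoint_pair.A_zero[OF dual])

lemmas linear_simps [simp] = A_add A_scale A_diff A_zero B_add B_scale B_diff B_zero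

definition domT :: "'v set" where
  "domT = {f\<in>DA. A f \<in> DB}"

abbreviation "T \<equiv> comp_graph DA A DB B"
abbreviation "T' \<equiv> comp_graph DB B DA A"

lemma T_iff: "(f, h) \<in> T \<longleftrightarrow> f \<in> domT \<and> h = B (A f)"
  by (auto simp: comp_graph_def domT_def)

lemma domTI: "f \<in> DA \<Longrightarrow> A f \<in> DB \<Longrightarrow> f \<in> domT"
  by (auto simp: domT_def)

lemma domTD [simp]: "f \<in> domT \<Longrightarrow> f \<in> DA" "f \<in> domT \<Longrightarrow> A f \<in> DB"
  by (auto simp: domT_def)

lemma subspace_domT: "subspace domT"
proof (rule subspaceI)
  show "0 \<in> domT" by (rule domTI) simp_all
  show "x + y \<in> domT" if "x \<in> domT" "y \<in> domT" for x y
    using that by (intro domTI) simp_all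
  show "c *\<^sub>R x \<in> domT" if "x \<in> domT" for c x
    using that by (intro domTI) simp_all
qed

lemma domT_subset: "domT \<subseteq> H"
  by auto

lemma ip_domT: "f \<in> domT \<Longrightarrow> g \<in> DA \<Longrightarrow> ip (B (A f)) g = ip (A f) (A g)"
  by (simp add: adj')

text \<open>The graph of \<open>A\<close> is the orthogonal complement of the rotated graph of
  \<open>B\<close>, so every pair \<open>(a, b)\<close> has an orthogonal projection
  \<open>(p, A p)\<close> onto it.\<close>

lemma graph_projection:
  assumes a: "a \<in> H" and b: "b \<in> H"
  obtains p where "p \<in> DA" "\<And>u. u \<in> DA \<Longrightarrow> ip (a - p) u + ip (b - A p) (A u) = 0"
proof -
  interpret P: hilbert "H \<times> H" "\<lambda>x y. ip (fst x) (fst y) + ip (snd x) (snd y)"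
    by (rule hilbert_prod) unfold_locales
  define M where "M = (\<lambda>v. (B v, - v)) ` DB"
  have M: "M \<subseteq> H \<times> H" by (auto simp: M_def)
  have graph: "(x, y) \<in> P.orth M \<longleftrightarrow> x \<in> DA \<and> A x = y" if "x \<in> H" "y \<in> H" for x y
  proof -
    have "(x, y) \<in> P.orth M \<longleftrightarrow> (\<forall>v\<in>DB. ip (B v) x = ip v y)"
      using that ip_commute[OF that(1)] ip_commute[OF that(2)]
      by (simp add: P.orth_def M_def ip_minus_right)
    then show ?thesis using adj2 that by simp
  qed
  obtain q where q: "q \<in> P.orth (P.orth M)" "(a, b) - q \<in> P.orth M"
    using P.ex_proj[OF M, of "(a, b)"] a b by auto
  have qH: "fst q \<in> H" "snd q \<in> H" using q by (auto simp: P.orth_def)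
  have "(a - fst q, b - snd q) \<in> P.orth M" using q by (simp add: minus_prod_def)
  then have p: "a - fst q \<in> DA" "A (a - fst q) = b - snd q"
    using graph[of "a - fst q" "b - snd q"] qH a b by auto
  have "ip (fst q) u + ip (snd q) (A u) = 0" if "u \<in> DA" for u
    using P.orth_orthD[OF q(1), of "(u, A u)"] graph[of u "A u"] that by simp
  then show ?thesis using that[OF p(1)] by (simp only: p(2)) simp
qed

text \<open>Projecting \<open>(g, 0)\<close> onto the graph of \<open>A\<close> gives
  \<open>w\<close> with \<open><A u, A w> = <u, g - w>\<close> for all \<open>u\<close>, which says
  that \<open>A w\<close> is in the domain of the adjoint with value \<open>g - w\<close>.\<close>

lemma von_neumann:
  assumes g: "g \<in> H" obtains w where "w \<in> domT" "w + B (A w) = g"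
proof -
  obtain w where w: "w \<in> DA" "\<And>u. u \<in> DA \<Longrightarrow> ip (g - w) u + ip (0 - A w) (A u) = 0"
    using graph_projection[OF g zero_mem] by blast
  have "ip (A u) (A w) = ip u (g - w)" if "u \<in> DA" for u
  proof -
    have "ip (g - w) u = ip (A w) (A u)" using w(2)[OF that] w(1) that by (simp add: ip_minus_left)
    then show ?thesis using w(1) that g ip_commute[of u "g - w"] ip_commute[of "A u" "A w"] by simp
  qed
  then have "A w \<in> DB \<and> B (A w) = g - w"
    using adj1[of "A w" "g - w"] w(1) g by simp
  then show ?thesis using that[of w] w by (simp add: domTI)
qed

text \<open>Both bounds come from
  \<open>(nrm w)^2 + (nrm (A w))^2 = ip (w + B (A w)) w\<close>.\<close>

lemma von_neumann_norm:
  assumes "w \<in> domT"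
  shows "nrm w \<le> nrm (w + B (A w))" "nrm (A w) \<le> nrm (w + B (A w))"
proof -
  let ?g = "w + B (A w)"
  have eq: "(nrm w)\<^sup>2 + (nrm (A w))\<^sup>2 = ip ?g w"
    using assms by (simp add: nrm_sq ip_simps ip_domT)
  also have "\<dots> \<le> nrm ?g * nrm w" using assms by (simp add: ip_le_nrm)
  finally have le: "(nrm w)\<^sup>2 + (nrm (A w))\<^sup>2 \<le> nrm ?g * nrm w" .
  have "(nrm w)\<^sup>2 \<le> nrm ?g * nrm w" using le zero_le_power2[of "nrm (A w)"] by linarith
  then show 1: "nrm w \<le> nrm ?g"
    using assms by (cases "nrm w = 0") (auto simp: power2_eq_square less_le)
  have "(nrm (A w))\<^sup>2 \<le> nrm ?g * nrm w" using le zero_le_power2[of "nrm w"] by linarith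
  also have "\<dots> \<le> (nrm ?g)\<^sup>2"
    using 1 assms by (simp add: power2_eq_square mult_left_mono)
  finally show "nrm (A w) \<le> nrm ?g" by (rule power2_le_imp_le) (use assms in simp)
qed

text \<open>The domain of \<open>B A\<close> is a core for \<open>A\<close>, expressed through the adjoint.\<close>

lemma adj_core:
  assumes f: "f \<in> H" and g: "g \<in> H" and eq: "\<And>u. u \<in> domT \<Longrightarrow> ip (A u) f = ip u g"
  shows "f \<in> DB" "B f = g"
proof -
  \<comment> \<open>The claim means that \<open>(g, - f)\<close> is orthogonal to the graph of
    \<open>A\<close>, i.e. that its projection \<open>(p, A p)\<close> vanishes. The hypothesis on
    the core makes \<open>p\<close> orthogonal to the range of \<open>1 + B A\<close>, which is all
    of \<open>H\<close>.\<close>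
  obtain p where p: "p \<in> DA" "\<And>u. u \<in> DA \<Longrightarrow> ip (g - p) u + ip (- f - A p) (A u) = 0"
    using graph_projection[OF g minus_mem[OF f]] by blast
  have eq': "ip g u - ip f (A u) = ip p u + ip (A p) (A u)" if "u \<in> DA" for u
    using p(2)[OF that] p(1) that f g by (simp add: ip_diff_left ip_minus_left)
  have "ip p (u + B (A u)) = 0" if u: "u \<in> domT" for u
  proof -
    have "ip p (u + B (A u)) = ip p u + ip (A p) (A u)"
      using p(1) u by (simp add: ip_add_right adj)
    also have "\<dots> = ip g u - ip f (A u)" using eq' u by simp
    also have "\<dots> = 0"
      using eq[OF u] ip_commute[of g u] ip_commute[of f "A u"] f g u by simp
    finally show ?thesis .
  qed
  then have "ip p p = 0" using p(1) von_neumann by (metis DA_mem)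
  then have "p = 0" using p(1) by simp
  then have "ip (A u) f = ip u g" if "u \<in> DA" for u
    using eq'[OF that] that f g ip_commute[of g u] ip_commute[of f "A u"] by simp
  then show "f \<in> DB" "B f = g" using adj1[of f g] f g by auto
qed

text \<open>Density of the domain of \<open>B A\<close>: for \<open>x = w + B (A w)\<close> one has
  \<open>ip x w = ip w w + ip (A w) (A w)\<close>, so \<open>w\<close> vanishes and \<open>x\<close>
  with it.\<close>

lemma domT_orth:
  assumes "x \<in> H" "\<And>u. u \<in> domT \<Longrightarrow> ip x u = 0" shows "x = 0"
proof -
  obtain w where w: "w \<in> domT" "w + B (A w) = x" using von_neumann assms by blast
  have "ip w w + ip (A w) (A w) = ip x w"
    using w(1) by (simp add: w(2)[symmetric] ip_add_left ip_domT)
  moreover have "0 \<le> ip (A w) (A w)" using w(1) by simp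
  ultimately have "ip w w \<le> 0" using assms(2)[OF w(1)] by linarith
  then show ?thesis using w ip_le_0[of w] by auto
qed

lemma nrm_le_domT:
  assumes "q \<in> H" "\<And>u. u \<in> domT \<Longrightarrow> ip q u \<le> C * nrm u" "0 \<le> C"
  shows "nrm q \<le> C"
  using nrm_le_of_ip_le[OF subspace_domT domT_subset, of q C] assms domT_orth by fastforce

text \<open>Riesz on the dense core produces the value of \<open>B f\<close>, and
  \<open>adj_core\<close> extends the identity from the core to all of \<open>DA\<close>.\<close>

lemma mem_DB_if_bounded:
  assumes f: "f \<in> H" and le: "\<And>u. u \<in> domT \<Longrightarrow> ip (A u) f \<le> C * nrm u"
  shows "f \<in> DB"
proof -
  obtain u p where "p \<in> H" "\<And>k. k \<in> domT \<Longrightarrow> ip (A k) f = ip p k"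
    by (rule riesz_subspace[OF subspace_domT domT_subset, of "\<lambda>u. ip (A u) f" C])
      (use f le in \<open>auto simp: ip_simps\<close>)
  then show ?thesis using adj_core[of f p] f ip_commute by (metis DA_mem domTD(1))
qed

text \<open>By \<open>adj_core\<close> the weak equation may be tested on the core. This turns the
  last clause of \<open>spectral_measure_of\<close> into membership in the graph.\<close>

lemma comp_graph_memI:
  assumes f: "f \<in> DA" and h: "h \<in> H"
    and eq: "\<And>g. g \<in> domT \<Longrightarrow> ip h g = ip (A f) (A g)"
  shows "(f, h) \<in> T"
proof -
  have "ip (A u) (A f) = ip u h" if "u \<in> domT" for u
    using eq[OF that] that f h ip_commute by (metis A_mem DA_mem domTD(1))
  then have "A f \<in> DB" "B (A f) = h" using adj_core[of "A f" h] f h by auto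
  then show ?thesis using f by (simp add: T_iff domTI)
qed

text \<open>\<open>H1\<close> and \<open>H2\<close> carry the parts of the operators. The hypothesis
  \<open>reg\<close> makes \<open>H1\<close> invariant under \<open>(1 + B A)^{-1}\<close>, the only
  ingredient of the resolvent formula besides \<open>A\<close>, \<open>B\<close> and the given
  resolvent.\<close>

lemma resolvent_transfer:
  assumes z: "z \<noteq> 0" and H1: "H1 \<subseteq> H" and H2: "H2 \<subseteq> H"
    and add: "\<And>f g. f \<in> H1 \<Longrightarrow> g \<in> H1 \<Longrightarrow> f + g \<in> H1"
    and scale: "\<And>c f. f \<in> H1 \<Longrightarrow> c *\<^sub>R f \<in> H1"
    and reg: "\<And>w. w \<in> domT \<Longrightarrow> w + B (A w) \<in> H1 \<Longrightarrow> w \<in> H1"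
    and Amap: "\<And>w. w \<in> DA \<Longrightarrow> w \<in> H1 \<Longrightarrow> A w \<in> H2"
    and Bmap: "\<And>y. y \<in> DB \<Longrightarrow> y \<in> H2 \<Longrightarrow> B y \<in> H1"
    and res: "z \<in> resolvent_set H2 ip (T' \<inter> H2 \<times> H2)"
  shows "z \<in> resolvent_set H1 ip (T \<inter> H1 \<times> H1)"
proof -
  interpret d: adjoint_pair H ip DB B DA A by (rule dual)
  obtain C0 where C0: "\<And>f h. (f, h) \<in> T' \<inter> H2 \<times> H2 \<Longrightarrow> nrm f \<le> C0 * nrm (h - z *\<^sub>R f)"
    using res unfolding resolvent_set_def hnorm_def by fast
  \<comment> \<open>Nothing in \<open>resolvent_set\<close> makes \<open>C0\<close> nonnegative, but
    the products estimated below require it.\<close>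
  define C where "C = \<bar>C0\<bar>"
  have C: "nrm f \<le> C * nrm (h - z *\<^sub>R f)" if "(f, h) \<in> T' \<inter> H2 \<times> H2" for f h
  proof -
    have "f \<in> H" "h \<in> H" using that H2 by auto
    then have "0 \<le> nrm (h - z *\<^sub>R f)" by simp
    then have "C0 * nrm (h - z *\<^sub>R f) \<le> C * nrm (h - z *\<^sub>R f)"
      by (intro mult_right_mono) (auto simp: C_def)
    then show ?thesis using C0[OF that] by linarith
  qed
  have ex1: "\<exists>!f. (f, g + z *\<^sub>R f) \<in> T' \<inter> H2 \<times> H2" if "g \<in> H2" for g
    using res that by (simp add: resolvent_set_def)
  \<comment> \<open>\<open>A d\<close> solves the eigenvalue equation of \<open>T'\<close> within
    \<open>H2\<close>, so it vanishes, and then \<open>z d = B (A d) = 0\<close>.\<close>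
  have unique: "d = 0" if dT: "(d, z *\<^sub>R d) \<in> T" and dH: "d \<in> H1" for d
  proof -
    have d: "d \<in> domT" "B (A d) = z *\<^sub>R d" using dT by (auto simp: T_iff)
    have A0: "0 \<in> H2" using Amap[of 0] scale[OF dH, of 0] by simp
    have Ad: "A d \<in> H2" using Amap[of d] d dH by simp
    have Add: "A d \<in> d.domT" using d by (intro d.domTI) auto
    have "(A d, 0 + z *\<^sub>R A d) \<in> T' \<inter> H2 \<times> H2"
      using d dH Ad Add Amap[of "z *\<^sub>R d"] scale[OF dH, of z] by (auto simp: d.T_iff)
    moreover have "(0, 0 + z *\<^sub>R 0) \<in> T' \<inter> H2 \<times> H2"
      using A0 by (auto simp: d.T_iff intro!: d.domTI)
    ultimately have "A d = 0" using ex1[OF A0] by blast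
    then show ?thesis using d z by auto
  qed
  \<comment> \<open>Read off from the formula for \<open>f\<close> below, with
    \<open>nrm w <= nrm g\<close> and
    \<open>(nrm (B y))^2 <= (C + |z| C^2) (nrm g)^2\<close>.\<close>
  define K where "K = \<bar>1 / z\<bar> + \<bar>1 + 1 / z\<bar> * sqrt (C + \<bar>z\<bar> * C\<^sup>2)"
  have sol: "\<exists>f. (f, g + z *\<^sub>R f) \<in> T \<inter> H1 \<times> H1 \<and> nrm f \<le> K * nrm g" if g: "g \<in> H1" for g
  proof -
    have gH: "g \<in> H" using g H1 by auto
    obtain w where w: "w \<in> domT" "w + B (A w) = g" using von_neumann gH by blast
    have w1: "w \<in> H1" using reg w g by simp
    have Aw: "A w \<in> H2" using Amap w w1 by simp
    obtain y where y: "(y, A w + z *\<^sub>R y) \<in> T' \<inter> H2 \<times> H2" using ex1[OF Aw] by blast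
    then have yd: "y \<in> d.domT" "y \<in> DB" "B y \<in> DA" "y \<in> H2" "A (B y) = A w + z *\<^sub>R y"
      by (auto simp: d.T_iff)
    have By: "B y \<in> H1" using Bmap yd by simp
    define f where "f = (- (1 / z)) *\<^sub>R w + (1 + 1 / z) *\<^sub>R B y"
    have f1: "f \<in> H1" unfolding f_def using w1 By by (intro add scale)
    have fd: "f \<in> domT"
      using w yd by (intro domTI) (simp_all add: f_def)
    have "B (A f) = (- (1 / z)) *\<^sub>R B (A w) + (1 + 1 / z) *\<^sub>R (B (A w) + z *\<^sub>R B y)"
      using w yd by (simp add: f_def)
    also have "\<dots> = g + z *\<^sub>R f"
      using z by (simp add: f_def w(2)[symmetric] algebra_simps)
    finally have eq: "B (A f) = g + z *\<^sub>R f" .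
    \<comment> \<open>The hypothesis controls only the norm of \<open>y\<close>; \<open>B y\<close>
      is reached through \<open><A B y, y>\<close>, where the equation for \<open>y\<close> gives
      \<open>A B y\<close>.\<close>
    have "(nrm (B y))\<^sup>2 = ip (A w + z *\<^sub>R y) y"
      using yd by (simp add: nrm_sq adj flip: yd(5))
    also have "\<dots> = ip (A w) y + z * ip y y" using w yd by (simp add: ip_simps)
    also have "\<dots> \<le> nrm (A w) * nrm y + \<bar>z\<bar> * (nrm y)\<^sup>2"
      using ip_le_nrm[of "A w" y] w yd by (simp add: nrm_sq add_mono mult_right_mono)
    also have "\<dots> \<le> nrm g * (C * nrm g) + \<bar>z\<bar> * (C * nrm g)\<^sup>2"
    proof -
      have 1: "nrm (A w) \<le> nrm g" using von_neumann_norm(2)[OF w(1)] w(2) by simp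
      have "nrm y \<le> C * nrm (A w)" using C[OF y] by simp
      also have "\<dots> \<le> C * nrm g" using 1 by (simp add: C_def mult_left_mono)
      finally show ?thesis
        using 1 w yd gH by (intro add_mono mult_mono power_mono mult_left_mono) auto
    qed
    also have "\<dots> = (C + \<bar>z\<bar> * C\<^sup>2) * (nrm g)\<^sup>2" by (simp add: power2_eq_square algebra_simps)
    finally have "nrm (B y) \<le> sqrt ((C + \<bar>z\<bar> * C\<^sup>2) * (nrm g)\<^sup>2)" by (rule real_le_rsqrt)
    also have "\<dots> = sqrt (C + \<bar>z\<bar> * C\<^sup>2) * nrm g" using gH by (simp add: real_sqrt_mult)
    finally have By_le: "nrm (B y) \<le> sqrt (C + \<bar>z\<bar> * C\<^sup>2) * nrm g" .
    have "nrm f \<le> \<bar>1 / z\<bar> * nrm w + \<bar>1 + 1 / z\<bar> * nrm (B y)"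
      using nrm_triangle[of "(- (1 / z)) *\<^sub>R w" "(1 + 1 / z) *\<^sub>R B y"] w yd
      by (simp add: f_def nrm_scale nrm_minus)
    also have "\<dots> \<le> \<bar>1 / z\<bar> * nrm g + \<bar>1 + 1 / z\<bar> * (sqrt (C + \<bar>z\<bar> * C\<^sup>2) * nrm g)"
      using von_neumann_norm(1)[OF w(1)] w(2) By_le by (intro add_mono mult_left_mono) auto
    also have "\<dots> = K * nrm g" by (simp add: K_def algebra_simps)
    finally have "nrm f \<le> K * nrm g" .
    moreover have "(f, g + z *\<^sub>R f) \<in> T \<inter> H1 \<times> H1"
      using fd f1 g eq by (auto simp: T_iff intro: add scale)
    ultimately show ?thesis by blast
  qed
  have uniq: "f = f'" if "(f, g + z *\<^sub>R f) \<in> T \<inter> H1 \<times> H1" "(f', g + z *\<^sub>R f') \<in> T \<inter> H1 \<times> H1" for f f' g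
  proof -
    have f: "f \<in> domT" "f' \<in> domT" "B (A f) = g + z *\<^sub>R f" "B (A f') = g + z *\<^sub>R f'"
      using that by (auto simp: T_iff)
    have "f - f' = 0"
    proof (rule unique)
      show "(f - f', z *\<^sub>R (f - f')) \<in> T"
        using f subspace_diff[OF subspace_domT] by (simp add: T_iff algebra_simps)
      show "f - f' \<in> H1" using add[of f "(-1) *\<^sub>R f'"] scale[of f' "-1"] that by auto
    qed
    then show ?thesis by simp
  qed
  show ?thesis
    unfolding resolvent_set_def
  proof (safe intro!: exI[of _ K])
    fix g assume "g \<in> H1"
    then show "\<exists>f. (f, g + z *\<^sub>R f) \<in> T \<inter> H1 \<times> H1" using sol by blast
  next
    fix g f f' assume "(f, g + z *\<^sub>R f) \<in> T" "(f', g + z *\<^sub>R f') \<in> T"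
      "f \<in> H1" "g + z *\<^sub>R f \<in> H1" "f' \<in> H1" "g + z *\<^sub>R f' \<in> H1"
    then show "f = f'" using uniq by blast
  next
    fix f h assume fh: "(f, h) \<in> T" "f \<in> H1" "h \<in> H1"
    then have "h - z *\<^sub>R f \<in> H1" using add[of h "(-z) *\<^sub>R f"] scale[of f "-z"] by auto
    then obtain f' where f': "(f', (h - z *\<^sub>R f) + z *\<^sub>R f') \<in> T \<inter> H1 \<times> H1"
      "nrm f' \<le> K * nrm (h - z *\<^sub>R f)" using sol by blast
    moreover have "f = f'" using uniq[OF _ f'(1)] fh by simp
    ultimately show "sqrt (ip f f) \<le> K * sqrt (ip (h - z *\<^sub>R f) (h - z *\<^sub>R f))"
      by (simp add: hnorm_def)
  qed
qed

lemma T_subset: "T \<subseteq> H \<times> H"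
  by (auto simp: comp_graph_def)

lemma spectrum_subset:
  assumes "z \<noteq> 0" "z \<in> spectrum H ip T" shows "z \<in> spectrum H ip T'"
proof -
  have "T \<inter> H \<times> H = T" "T' \<inter> H \<times> H = T'"
    using T_subset adjoint_pair.T_subset[OF dual] by auto
  then show ?thesis
    using resolvent_transfer[of z H H] assms by (auto simp: spectrum_def)
qed

section \<open>Eigenspaces and the essential spectrum\<close>

lemma eigenspace_iff: "f \<in> eigenspace T z \<longleftrightarrow> f \<in> domT \<and> B (A f) = z *\<^sub>R f"
  by (auto simp: eigenspace_def T_iff)

lemma A_eigenspace:
  assumes "f \<in> eigenspace T z" shows "A f \<in> eigenspace T' z"
  using assms by (auto simp: eigenspace_iff adjoint_pair.eigenspace_iff[OF dual]
    intro!: adjoint_pair.domTI[OF dual])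

lemma span_image_A:
  assumes B0: "B0 \<subseteq> DA" and x: "x \<in> span B0"
  shows "x \<in> DA \<and> A x \<in> span (A ` B0)"
  using x
proof (induction rule: span_induct_alt)
  case base
  show ?case by (simp add: span_zero)
next
  case (step c x y)
  then have "x \<in> DA" using B0 by auto
  then show ?case using step by (auto intro!: span_add span_scale intro: span_base)
qed

end

text \<open>Between the eigenspaces for \<open>z \<noteq> 0\<close>, \<open>A\<close> is a bijection
  with inverse \<open>(1/z) B\<close>, so it preserves nontriviality and finite dimension.\<close>

lemma (in adjoint_pair) eigenspace_transfer:
  assumes z: "z \<noteq> 0"
  shows "(\<exists>f\<in>eigenspace T z. f \<noteq> 0) \<Longrightarrow> (\<exists>f\<in>eigenspace T' z. f \<noteq> 0)"
    and "(\<exists>K. finite K \<and> eigenspace T z \<subseteq> span K) \<Longrightarrow> (\<exists>K. finite K \<and> eigenspace T' z \<subseteq> span K)"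
proof -
  interpret d: adjoint_pair H ip DB B DA A by (rule dual)
  show "(\<exists>f\<in>eigenspace T z. f \<noteq> 0) \<Longrightarrow> (\<exists>f\<in>eigenspace T' z. f \<noteq> 0)"
  proof (elim bexE)
    fix f assume f: "f \<in> eigenspace T z" "f \<noteq> 0"
    then have "A f \<noteq> 0" using z by (auto simp: eigenspace_iff)
    then show "\<exists>f\<in>eigenspace T' z. f \<noteq> 0" using A_eigenspace f by blast
  qed
  assume "\<exists>K. finite K \<and> eigenspace T z \<subseteq> span K"
  then obtain K where K: "finite K" "eigenspace T z \<subseteq> span K" by blast
  \<comment> \<open>The given \<open>K\<close> may leave \<open>DA\<close>, where nothing is known
    about \<open>A\<close>. An independent generating set inside the eigenspace avoids this; it is
    finite because it lies in the span of \<open>K\<close>.\<close>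
  obtain K0 where K0: "K0 \<subseteq> eigenspace T z" "independent K0" "eigenspace T z \<subseteq> span K0"
    using maximal_independent_subset by blast
  have fin: "finite K0" using independent_span_bound[OF K(1) K0(2)] K0 K by blast
  have K0A: "K0 \<subseteq> DA" using K0 by (auto simp: eigenspace_iff)
  have "eigenspace T' z \<subseteq> span (A ` K0)"
  proof
    fix y assume y: "y \<in> eigenspace T' z"
    then have "(1 / z) *\<^sub>R A (B y) = y" using z by (simp add: d.eigenspace_iff)
    moreover have "B y \<in> span K0" using d.A_eigenspace[OF y] K0 by blast
    ultimately show "y \<in> span (A ` K0)"
      using span_image_A[OF K0A, of "B y"] span_scale by metis
  qed
  then show "\<exists>K. finite K \<and> eigenspace T' z \<subseteq> span K" using fin by blast
qed

text \<open>Around a point other than 0 the isolating neighbourhood can be shrunk to miss 0, the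
  only place where the two sets may differ.\<close>

lemma isolated_in_minus_zero:
  fixes z :: real
  assumes "z isolated_in S" "S - {0} = S' - {0}" "z \<noteq> 0"
  shows "z isolated_in S'"
proof -
  obtain U where U: "open U" "U \<inter> S = {z}" "z \<in> S"
    using assms(1) by (auto simp: isolated_in_def)
  show ?thesis
    unfolding isolated_in_def
  proof (intro conjI exI[of _ "U - {0}"])
    show "open (U - {0})" using U by (simp add: open_delete)
    show "(U - {0}) \<inter> S' = {z}" using U(2) assms(2,3) by blast
    show "z \<in> S'" using U(3) assms(2,3) by blast
  qed
qed

context adjoint_pair begin

lemma spectrum_eq: "spectrum H ip T - {0} = spectrum H ip T' - {0}"
  using spectrum_subset adjoint_pair.spectrum_subset[OF dual] by auto

lemma essential_spectrum_eq: "essential_spectrum H ip T - {0} = essential_spectrum H ip T' - {0}"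
proof -
  have "z \<in> discrete_spectrum H ip T \<longleftrightarrow> z \<in> discrete_spectrum H ip T'" if z: "z \<noteq> 0" for z
    unfolding discrete_spectrum_def
    using isolated_in_minus_zero[OF _ spectrum_eq z]
      isolated_in_minus_zero[OF _ spectrum_eq[symmetric] z]
      eigenspace_transfer[OF z] adjoint_pair.eigenspace_transfer[OF dual z]
    by blast
  then show ?thesis using spectrum_eq by (auto simp: essential_spectrum_def)
qed

end

section \<open>Projection-valued measures\<close>

lemma integral_between:
  fixes \<mu> :: "real measure"
  assumes "finite_measure \<mu>" and sets: "sets \<mu> = sets borel" and AE: "AE x in \<mu>. x \<in> {a<..b}"
  shows "integrable \<mu> (\<lambda>x. x)" "a * measure \<mu> UNIV \<le> (\<integral>x. x \<partial>\<mu>)" "(\<integral>x. x \<partial>\<mu>) \<le> b * measure \<mu> UNIV"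
proof -
  interpret finite_measure \<mu> by fact
  have [measurable]: "(\<lambda>x. x) \<in> borel_measurable \<mu>" by (simp add: measurable_cong_sets[OF sets refl])
  have space: "space \<mu> = UNIV" using sets_eq_imp_space_eq[OF sets] by simp
  show int: "integrable \<mu> (\<lambda>x. x)"
    by (rule integrable_const_bound[of _ "max \<bar>a\<bar> \<bar>b\<bar>"]) (use AE in auto)
  have "(\<integral>x. a \<partial>\<mu>) \<le> (\<integral>x. x \<partial>\<mu>)"
    using AE by (intro integral_mono_AE int) auto
  then show "a * measure \<mu> UNIV \<le> (\<integral>x. x \<partial>\<mu>)" by (simp add: space mult.commute)
  have "(\<integral>x. x \<partial>\<mu>) \<le> (\<integral>x. b \<partial>\<mu>)"
    using AE by (intro integral_mono_AE int) auto
  then show "(\<integral>x. x \<partial>\<mu>) \<le> b * measure \<mu> UNIV" by (simp add: space mult.commute)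
qed

text \<open>Repeated bisection makes the error \<open>(b - a) \<mu>(a,b]\<close> in the hypothesis arbitrarily small.\<close>

lemma density_if_sandwich:
  fixes \<mu> \<nu> :: "real measure"
  assumes fin: "finite_measure \<mu>" "finite_measure \<nu>"
    and sets: "sets \<mu> = sets borel" "sets \<nu> = sets borel"
    and le: "\<And>a b. a < b \<Longrightarrow> a * measure \<mu> {a<..b} \<le> measure \<nu> {a<..b}"
      "\<And>a b. a < b \<Longrightarrow> measure \<nu> {a<..b} \<le> b * measure \<mu> {a<..b}"
  shows "AE x in \<mu>. 0 \<le> x" "\<nu> = density \<mu> (\<lambda>x. ennreal x)"
proof -
  interpret \<mu>: finite_measure \<mu> by fact
  interpret \<nu>: finite_measure \<nu> by fact
  have [measurable]: "(\<lambda>x. x) \<in> borel_measurable \<mu>" by (simp add: measurable_cong_sets[OF sets(1) refl])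
  have [measurable]: "{a<..b} \<in> sets \<mu>" for a b by (simp add: sets)
  \<comment> \<open>Intervals with a negative right end \<open>b\<close>: there
    \<open>0 <= \<nu> <= b \<mu>\<close> forces \<open>\<mu> = 0\<close>. They exhaust the negative
    half-line, and the shifted index in the right end keeps them nonempty, as \<open>le\<close>
    requires.\<close>
  define N where "N n = {- real (Suc n)<..- (1 / real (Suc (Suc n)))}" for n
  have N0: "N n \<in> null_sets \<mu>" for n
  proof -
    have "1 / real (Suc (Suc n)) < 1" "1 \<le> real (Suc n)" by simp_all
    then have "- real (Suc n) < - (1 / real (Suc (Suc n)))" by linarith
    then have "0 \<le> - (1 / real (Suc (Suc n))) * measure \<mu> (N n)"
      using le(2)[of "- real (Suc n)" "- (1 / real (Suc (Suc n)))"] measure_nonneg[of \<nu> "N n"]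
      unfolding N_def by linarith
    then have "measure \<mu> (N n) \<le> 0" by (auto simp: divide_le_0_iff)
    then have "measure \<mu> (N n) = 0" using measure_nonneg[of \<mu> "N n"] by linarith
    then show ?thesis
      by (intro null_setsI) (auto simp: \<mu>.emeasure_eq_measure N_def)
  qed
  have "{x \<in> space \<mu>. \<not> 0 \<le> x} \<subseteq> (\<Union>n. N n)"
  proof safe
    fix x :: real assume "\<not> 0 \<le> x"
    then have x: "0 < - x" by simp
    obtain n where n: "inverse (real (Suc n)) < - x" using reals_Archimedean[OF x] by blast
    obtain k where k: "- x < real k" using reals_Archimedean2 by blast
    have "inverse (real (Suc (Suc (n + k)))) \<le> inverse (real (Suc n))"
      by (intro le_imp_inverse_le) auto
    then have "x \<in> N (n + k)" using n k by (auto simp: N_def inverse_eq_divide)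
    then show "x \<in> (\<Union>n. N n)" by blast
  qed
  moreover have "(\<Union>n. N n) \<in> null_sets \<mu>" using N0 by blast
  ultimately show AE0: "AE x in \<mu>. 0 \<le> x" by (rule AE_I'[rotated])

  \<comment> \<open>The prospective value of the density measure on (a,b]. It obeys the same
    two-sided bounds and the same additivity as \<open>\<nu>\<close>, so bisection applies to the
    difference.\<close>
  define g where "g a b = (\<integral>x. indicator {a<..b} x * x \<partial>\<mu>)" for a b
  have int: "integrable \<mu> (\<lambda>x. indicator {a<..b} x * x)" for a b
    by (rule \<mu>.integrable_const_bound[of _ "max \<bar>a\<bar> \<bar>b\<bar>"]) (auto simp: indicator_def)
  have int_c: "integrable \<mu> (\<lambda>x. indicator {a<..b} x * c)" for a b c :: real
    by (rule \<mu>.integrable_const_bound[of _ "\<bar>c\<bar>"]) (auto simp: indicator_def)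
  have g_le: "a * measure \<mu> {a<..b} \<le> g a b" "g a b \<le> b * measure \<mu> {a<..b}" for a b
  proof -
    have "(\<integral>x. indicator {a<..b} x * a \<partial>\<mu>) \<le> g a b"
      unfolding g_def by (intro integral_mono int int_c) (auto simp: indicator_def)
    then show "a * measure \<mu> {a<..b} \<le> g a b" by (simp add: mult.commute)
    have "g a b \<le> (\<integral>x. indicator {a<..b} x * b \<partial>\<mu>)"
      unfolding g_def by (intro integral_mono int int_c) (auto simp: indicator_def)
    then show "g a b \<le> b * measure \<mu> {a<..b}" by (simp add: mult.commute)
  qed
  have split: "measure M {a<..b} = measure M {a<..c} + measure M {c<..b}"
    if "a < c" "c < b" "sets M = sets borel" "finite_measure M" for a b c :: real and M
  proof -
    interpret finite_measure M by fact
    have "{a<..b} = {a<..c} \<union> {c<..b}" using that by auto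
    then show ?thesis using that finite_measure_Union[of "{a<..c}" "{c<..b}"] by auto
  qed
  have g_split: "g a b = g a c + g c b" if "a < c" "c < b" for a b c
  proof -
    have "g a b = (\<integral>x. indicator {a<..c} x * x + indicator {c<..b} x * x \<partial>\<mu>)"
      unfolding g_def using that by (intro Bochner_Integration.integral_cong) (auto simp: indicator_def)
    then show ?thesis unfolding g_def by (simp add: Bochner_Integration.integral_add int)
  qed
  have bisect: "\<bar>measure \<nu> {a<..b} - g a b\<bar> \<le> (b - a) / 2 ^ k * measure \<mu> {a<..b}" if "a < b" for a b k
    using that
  proof (induction k arbitrary: a b)
    case 0
    then show ?case using le[of a b] g_le[of a b] by (simp add: algebra_simps abs_le_iff)
  next
    case (Suc k)
    define c where "c = (a + b) / 2"
    have c: "a < c" "c < b" using Suc by (auto simp: c_def)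
    have "\<bar>measure \<nu> {a<..b} - g a b\<bar>
        \<le> \<bar>measure \<nu> {a<..c} - g a c\<bar> + \<bar>measure \<nu> {c<..b} - g c b\<bar>"
      using split[OF c sets(2) fin(2)] g_split[OF c] by linarith
    also have "\<dots> \<le> (c - a) / 2 ^ k * measure \<mu> {a<..c} + (b - c) / 2 ^ k * measure \<mu> {c<..b}"
      using Suc.IH[OF c(1)] Suc.IH[OF c(2)] by linarith
    also have "\<dots> = (b - a) / 2 ^ Suc k * measure \<mu> {a<..b}"
      unfolding split[OF c sets(1) fin(1)] by (simp add: c_def field_simps)
    finally show ?case .
  qed
  have eq: "measure \<nu> {a<..b} = g a b" if "a < b" for a b
  proof -
    have "(\<lambda>k. (b - a) * measure \<mu> {a<..b} / 2 ^ k) \<longlonglongrightarrow> 0"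
      by (rule LIMSEQ_divide_realpow_zero) simp
    then have "\<bar>measure \<nu> {a<..b} - g a b\<bar> \<le> 0"
      using bisect[OF that] by (intro LIMSEQ_le_const) (auto simp: mult.commute)
    then show ?thesis by simp
  qed
  \<comment> \<open>Half-open intervals, the empty one included, are stable under intersection and
    generate the Borel sets.\<close>
  show "\<nu> = density \<mu> (\<lambda>x. ennreal x)"
  proof (rule measure_eqI_generator_eq[where E = "range (\<lambda>(a, b). {a<..b::real})"
        and A = "\<lambda>n. {- real n<..real n}" and \<Omega> = UNIV])
    show "Int_stable (range (\<lambda>(a, b). {a<..b::real}))"
    proof (rule Int_stableI, safe)
      fix a b c d :: real
      have "{a<..b} \<inter> {c<..d} = {max a c<..min b d}" by auto
      then show "{a<..b} \<inter> {c<..d} \<in> range (\<lambda>(a, b). {a<..b})"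
        by (metis (mono_tags) case_prod_conv rangeI)
    qed
    have "sets borel = sigma_sets UNIV (range (\<lambda>(a, b). {a<..b::real}))"
      by (subst borel_sigma_sets_Ioc) (rule sets_measure_of, simp)
    then show "sets \<nu> = sigma_sets UNIV (range (\<lambda>(a, b). {a<..b::real}))"
      "sets (density \<mu> (\<lambda>x. ennreal x)) = sigma_sets UNIV (range (\<lambda>(a, b). {a<..b::real}))"
      using sets by simp_all
    show "(\<Union>i. {- real i<..real i}) = UNIV"
    proof safe
      fix x :: real
      obtain n where "\<bar>x\<bar> < real n" using reals_Archimedean2 by blast
      then show "x \<in> (\<Union>i. {- real i<..real i})" by (intro UN_I[of n]) auto
    qed simp
    fix X assume "X \<in> range (\<lambda>(a, b). {a<..b::real})"
    then obtain a b where X: "X = {a<..b}" by auto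
    show "emeasure \<nu> X = emeasure (density \<mu> (\<lambda>x. ennreal x)) X"
    proof (cases "a < b")
      case True
      have "emeasure (density \<mu> (\<lambda>x. ennreal x)) X = (\<integral>\<^sup>+x. ennreal (indicator {a<..b} x * x) \<partial>\<mu>)"
        unfolding X by (subst emeasure_density) (auto intro!: nn_integral_cong simp: indicator_def)
      also have "\<dots> = ennreal (g a b)"
        unfolding g_def by (intro nn_integral_eq_integral int) (use AE0 in auto)
      finally show ?thesis
        unfolding X by (simp add: \<nu>.emeasure_eq_measure eq[OF True])
    qed (simp add: X)
  qed auto
qed


section \<open>Calculus of a projection-valued measure\<close>

locale pvm = hilbert H ip
  for H :: "'v::real_vector set" and ip :: "'v inner_prod" +
  fixes E :: "real set \<Rightarrow> 'v \<Rightarrow> 'v"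
  assumes pvm: "projection_valued_measure H ip E"
begin

lemma projection: "C \<in> sets borel \<Longrightarrow> orthogonal_projection H ip (E C)"
  using pvm by (simp add: projection_valued_measure_def)

lemma E_mem [simp]: "C \<in> sets borel \<Longrightarrow> f \<in> H \<Longrightarrow> E C f \<in> H"
  and E_add: "C \<in> sets borel \<Longrightarrow> f \<in> H \<Longrightarrow> g \<in> H \<Longrightarrow> E C (f + g) = E C f + E C g"
  and E_scale: "C \<in> sets borel \<Longrightarrow> f \<in> H \<Longrightarrow> E C (c *\<^sub>R f) = c *\<^sub>R E C f"
  and E_idem [simp]: "C \<in> sets borel \<Longrightarrow> f \<in> H \<Longrightarrow> E C (E C f) = E C f"
  and E_adj: "C \<in> sets borel \<Longrightarrow> f \<in> H \<Longrightarrow> g \<in> H \<Longrightarrow> ip (E C f) g = ip f (E C g)"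
  using projection[of C] by (auto simp: orthogonal_projection_def)

lemma E_UNIV [simp]: "f \<in> H \<Longrightarrow> E UNIV f = f"
  using pvm by (simp add: projection_valued_measure_def)

lemma E_zero [simp]: "C \<in> sets borel \<Longrightarrow> E C 0 = 0"
  using E_scale[of C 0 0] by simp
lemma E_minus: "C \<in> sets borel \<Longrightarrow> f \<in> H \<Longrightarrow> E C (- f) = - E C f"
  using E_scale[of C f "-1"] by simp
lemma E_diff: "C \<in> sets borel \<Longrightarrow> f \<in> H \<Longrightarrow> g \<in> H \<Longrightarrow> E C (f - g) = E C f - E C g"
  using E_add[of C f "-g"] by (simp add: E_minus)

lemmas E_simps = E_add E_scale E_minus E_diff

lemma E_ip: "C \<in> sets borel \<Longrightarrow> f \<in> H \<Longrightarrow> ip (E C f) f = ip (E C f) (E C f)"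
  using E_adj[of C f "E C f"] E_adj[of C "E C f" f] by simp

lemma E_sums:
  "f \<in> H \<Longrightarrow> range C \<subseteq> sets borel \<Longrightarrow> disjoint_family C \<Longrightarrow>
    (\<lambda>i::nat. ip (E (C i) f) f) sums ip (E (\<Union>i. C i) f) f"
  using pvm unfolding projection_valued_measure_def by blast

lemma E_empty [simp]: "f \<in> H \<Longrightarrow> E {} f = 0"
proof -
  assume f: "f \<in> H"
  have "(\<lambda>i::nat. ip (E {} f) f) sums ip (E {} f) f"
    using E_sums[OF f, of "\<lambda>_. {}"] by (simp add: disjoint_family_on_def)
  then have "ip (E {} f) f = 0"
    using summable_const_iff sums_summable by blast
  then show ?thesis using f by (simp add: E_ip)
qed

text \<open>The definition gives additivity of the quadratic forms. The defect \<open>P\<close> is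
  symmetric with vanishing quadratic form, and polarization at \<open>f\<close> and
  \<open>g = P f\<close> yields \<open>P f = 0\<close>.\<close>

lemma E_Un:
  assumes C: "C \<in> sets borel" "D \<in> sets borel" "C \<inter> D = {}" and f: "f \<in> H"
  shows "E (C \<union> D) f = E C f + E D f"
proof -
  have quad: "ip (E (C \<union> D) h) h = ip (E C h) h + ip (E D h) h" if h: "h \<in> H" for h
  proof -
    have first: "(\<lambda>n. ip (E (binaryset C D n) h) h) sums (ip (E C h) h + ip (E D h) h)"
      using binaryset_sums[of "\<lambda>C. ip (E C h) h" C D] h by simp
    have "disjoint_family (binaryset C D)"
      using C(3) by (auto simp: disjoint_family_on_def binaryset_def)
    then have second: "(\<lambda>n. ip (E (binaryset C D n) h) h) sums ip (E (C \<union> D) h) h"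
      using E_sums[OF h, of "binaryset C D"] C by (simp add: UN_binaryset_eq range_binaryset_eq)
    show ?thesis by (rule sums_unique2[OF second first])
  qed
  define P where "P h = E (C \<union> D) h - E C h - E D h" for h
  have CD: "C \<union> D \<in> sets borel" using C by blast
  have P: "P h \<in> H" "ip (P h) h = 0" if "h \<in> H" for h
    using quad[OF that] C CD that by (auto simp: P_def ip_diff_left)
  define g where "g = P f"
  have g: "g \<in> H" using P f by (simp add: g_def)
  have "P (f + g) = P f + P g" using C CD f g by (simp add: P_def E_add algebra_simps)
  then have "ip (P f) g + ip (P g) f = 0"
    using P(2)[of "f + g"] P f g by (simp add: ip_add_left ip_add_right)
  moreover have "ip (P g) f = ip g (P f)"
    using C CD f g by (simp add: P_def ip_diff_left ip_diff_right E_adj)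
  ultimately have "ip g g = 0" using ip_commute f g by (simp add: g_def)
  then show ?thesis using g by (simp add: g_def P_def algebra_simps)
qed

text \<open>For \<open>h = E D f\<close>, additivity gives
  \<open><E (C \<union> D) h, h> = |E C h|^2 + |h|^2\<close>, while a projection cannot exceed
  \<open>|h|^2\<close>; nothing is left for \<open>E C h\<close>.\<close>

lemma E_disjoint:
  assumes C: "C \<in> sets borel" "D \<in> sets borel" "C \<inter> D = {}" and f: "f \<in> H"
  shows "E C (E D f) = 0"
proof -
  have CD: "C \<union> D \<in> sets borel" using C by blast
  let ?h = "E D f"
  have h: "?h \<in> H" using C f by simp
  have "ip (E (C \<union> D) ?h) ?h = ip (E C ?h) ?h + ip ?h ?h"
    using E_Un[OF C h] C f by (simp add: ip_add_left)
  moreover have "ip (E (C \<union> D) ?h) ?h \<le> ip ?h ?h"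
  proof -
    let ?p = "E (C \<union> D) ?h"
    have "0 \<le> ip (?h - ?p) (?h - ?p)" using CD h by simp
    also have "\<dots> = ip ?h ?h - ip ?p ?h"
      using CD h E_ip[OF CD h] E_adj[OF CD h h] by (simp add: ip_diff_left ip_diff_right)
    finally show ?thesis by simp
  qed
  ultimately have "ip (E C ?h) (E C ?h) \<le> 0" using E_ip[OF C(1) h] by simp
  then show ?thesis using C(1) h ip_le_0 by simp
qed

lemma E_split: "C \<in> sets borel \<Longrightarrow> D \<in> sets borel \<Longrightarrow> f \<in> H \<Longrightarrow> E C f = E (C \<inter> D) f + E (C - D) f"
  using E_Un[of "C \<inter> D" "C - D" f] by (auto simp: Int_Diff_Un)

text \<open>When both sets are split along their intersection, the products of disjoint pieces
  vanish.\<close>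

lemma E_Int:
  assumes C: "C \<in> sets borel" "D \<in> sets borel" and f: "f \<in> H"
  shows "E C (E D f) = E (C \<inter> D) f"
proof -
  have sets: "C \<inter> D \<in> sets borel" "C - D \<in> sets borel" "D - C \<in> sets borel" using C by auto
  have "E C (E D f) = E (C \<inter> D) (E D f) + E (C - D) (E D f)"
    using E_split[of C D "E D f"] C f by simp
  also have "\<dots> = E (C \<inter> D) (E D f)" using E_disjoint[of "C - D" D f] C f sets by auto
  also have "\<dots> = E (C \<inter> D) (E (C \<inter> D) f + E (D - C) f)"
    using E_split[of D C f] C f by (simp add: Int_commute)
  also have "\<dots> = E (C \<inter> D) f + E (C \<inter> D) (E (D - C) f)"
    using sets f by (simp add: E_add)
  also have "\<dots> = E (C \<inter> D) f" using E_disjoint[of "C \<inter> D" "D - C" f] f sets by auto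
  finally show ?thesis .
qed

lemma E_compl: "C \<in> sets borel \<Longrightarrow> f \<in> H \<Longrightarrow> f = E C f + E (- C) f"
  using E_split[of UNIV C f] by (simp add: Compl_eq_Diff_UNIV)

lemma E_null_mono:
  assumes "C \<in> sets borel" "D \<in> sets borel" "C \<subseteq> D" "f \<in> H" "E D f = 0" shows "E C f = 0"
  using E_Int[of C D f] assms by (simp add: Int_absorb2)

lemma nrm_E_le: assumes C: "C \<in> sets borel" and f: "f \<in> H" shows "nrm (E C f) \<le> nrm f"
proof -
  have "(nrm (E C f))\<^sup>2 = ip (E C f) f" using assms by (simp add: nrm_sq E_ip)
  also have "\<dots> \<le> nrm (E C f) * nrm f" using assms by (simp add: ip_le_nrm)
  finally have le: "(nrm (E C f))\<^sup>2 \<le> nrm (E C f) * nrm f" .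
  have n: "0 \<le> nrm (E C f)" "0 \<le> nrm f" using assms by simp_all
  show ?thesis
  proof (cases "nrm (E C f) = 0")
    case False
    then show ?thesis using le n by (simp add: power2_eq_square)
  qed (use n in simp)
qed

abbreviation "\<mu> \<equiv> scalar_measure ip E"

lemma sets_\<mu> [simp, measurable_cong]: "sets (\<mu> f) = sets borel"
  using sets.sigma_sets_eq[of "borel :: real measure"] by (simp add: scalar_measure_def)
lemma space_\<mu> [simp]: "space (\<mu> f) = UNIV"
  by (simp add: scalar_measure_def)

lemma emeasure_\<mu>:
  assumes f: "f \<in> H" and C: "C \<in> sets borel"
  shows "emeasure (\<mu> f) C = ennreal (ip (E C f) f)"
  unfolding scalar_measure_def
proof (rule emeasure_measure_of_sigma)
  show "sigma_algebra UNIV (sets borel :: real set set)"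
    using sets.sigma_algebra_axioms[of borel] by simp
  show "positive (sets borel) (\<lambda>C. ennreal (ip (E C f) f))"
    using f by (simp add: positive_def)
  show "countably_additive (sets borel) (\<lambda>C. ennreal (ip (E C f) f))"
    unfolding countably_additive_def
  proof safe
    fix D :: "nat \<Rightarrow> real set"
    assume D: "range D \<subseteq> sets borel" "disjoint_family D"
    have "0 \<le> ip (E (D i) f) f" for i
    proof -
      have "D i \<in> sets borel" using D by auto
      then show ?thesis using f by (simp add: E_ip)
    qed
    then show "(\<Sum>i. ennreal (ip (E (D i) f) f)) = ennreal (ip (E (\<Union>i. D i) f) f)"
      using E_sums[OF f D] by (intro suminf_ennreal_eq)
  qed
qed (use C in simp)

lemma measure_\<mu>:
  assumes f: "f \<in> H" and C: "C \<in> sets borel"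
  shows "measure (\<mu> f) C = (nrm (E C f))\<^sup>2"
  using assms by (simp add: measure_def emeasure_\<mu> E_ip nrm_sq)

lemma finite_measure_\<mu>: "f \<in> H \<Longrightarrow> finite_measure (\<mu> f)"
  by (rule finite_measureI) (simp add: emeasure_\<mu>)

lemma emeasure_\<mu>_eq_0: "f \<in> H \<Longrightarrow> C \<in> sets borel \<Longrightarrow> emeasure (\<mu> f) C = 0 \<longleftrightarrow> E C f = 0"
  using ip_le_0[of "E C f"] by (auto simp: emeasure_\<mu> E_ip ennreal_eq_0_iff)

text \<open>The squared norm is the mass of \<open>C n\<close> under the finite measure
  \<open>\<mu> f\<close>, which is continuous from above.\<close>

lemma E_tendsto_0:
  assumes f: "f \<in> H" and C: "range C \<subseteq> sets borel" "decseq C" "(\<Inter>n. C n) = {}"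
  shows "(\<lambda>n. nrm (E (C n) f)) \<longlonglongrightarrow> 0"
proof -
  interpret M: finite_measure "\<mu> f" by (rule finite_measure_\<mu>[OF f])
  have Cn: "C n \<in> sets borel" for n using C by auto
  have "(\<lambda>n. measure (\<mu> f) (C n)) \<longlonglongrightarrow> 0"
    using M.finite_Lim_measure_decseq[of C] C by simp
  then have "(\<lambda>n. sqrt ((nrm (E (C n) f))\<^sup>2)) \<longlonglongrightarrow> sqrt 0"
    using f Cn by (intro tendsto_intros) (simp add: measure_\<mu>)
  then show ?thesis using f Cn by simp
qed

lemma E_truncation:
  assumes f: "f \<in> H" shows "(\<lambda>n. nrm (E {- real n<..real n} f - f)) \<longlonglongrightarrow> 0"
proof -
  have "(\<Inter>n. - {- real n<..real n}) = {}"
  proof safe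
    fix x :: real assume x: "x \<in> (\<Inter>n. - {- real n<..real n})"
    obtain n where "\<bar>x\<bar> < real n" using reals_Archimedean2 by blast
    then show "x \<in> {}" using x by (auto dest: spec[of _ n])
  qed
  then have "(\<lambda>n. nrm (E (- {- real n<..real n}) f)) \<longlonglongrightarrow> 0"
    by (intro E_tendsto_0 f) (auto simp: decseq_def)
  moreover have "nrm (E {- real n<..real n} f - f) = nrm (E (- {- real n<..real n}) f)" for n
  proof -
    have "E {- real n<..real n} f - f = - E (- {- real n<..real n}) f"
      using E_compl[of "{- real n<..real n}" f] f by (simp add: algebra_simps)
    then show ?thesis using f by (simp add: nrm_minus)
  qed
  ultimately show ?thesis by simp
qed

text \<open>Multiplicativity gives \<open><E D (E C f), E C f> = <E (D \<inter> C) f, f>\<close>.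
  Integrals for truncated vectors reduce to integrals against \<open>\<mu> f\<close> this
  way.\<close>

lemma \<mu>_E:
  assumes f: "f \<in> H" and C: "C \<in> sets borel"
  shows "\<mu> (E C f) = density (\<mu> f) (indicator C)"
proof (rule measure_eqI)
  fix D assume "D \<in> sets (\<mu> (E C f))"
  then have D: "D \<in> sets borel" by simp
  have CD: "D \<inter> C \<in> sets borel" using C D by auto
  have "emeasure (density (\<mu> f) (indicator C)) D = (\<integral>\<^sup>+x. indicator C x * indicator D x \<partial>\<mu> f)"
    using C D by (subst emeasure_density) simp_all
  also have "\<dots> = (\<integral>\<^sup>+x. indicator (D \<inter> C) x \<partial>\<mu> f)"
    by (intro nn_integral_cong) (simp split: split_indicator)
  also have "\<dots> = ennreal (ip (E (D \<inter> C) f) f)" using CD f by (simp add: emeasure_\<mu>)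
  also have "ip (E (D \<inter> C) f) f = ip (E D (E C f)) (E C f)"
    using C D CD f by (simp add: E_Int flip: E_adj) (simp add: E_Int Int_commute Int_left_commute)
  finally show "emeasure (\<mu> (E C f)) D = emeasure (density (\<mu> f) (indicator C)) D"
    using C D f by (simp add: emeasure_\<mu>)
qed simp

lemma \<mu>_minus: "f \<in> H \<Longrightarrow> \<mu> (- f) = \<mu> f"
  by (rule measure_eqI) (simp_all add: emeasure_\<mu> E_minus ip_minus_left ip_minus_right)

lemma AE_\<mu>: "f \<in> H \<Longrightarrow> C \<in> sets borel \<Longrightarrow> E C f = f \<Longrightarrow> AE x in \<mu> f. x \<in> C"
proof (rule AE_I')
  assume f: "f \<in> H" and C: "C \<in> sets borel" and eq: "E C f = f"
  have "E (- C) f = 0" using E_compl[OF C f] eq by simp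
  then show "- C \<in> null_sets (\<mu> f)" using C f by (auto simp: null_sets_def emeasure_\<mu>_eq_0)
qed auto

text \<open>Membership in each of the three subspaces depends on \<open>f\<close> only through the
  Borel sets \<open>C\<close> with \<open>E C f = 0\<close>. In this form an operator that
  intertwines two measures visibly respects them.\<close>

lemma pp_subspace_iff:
  "f \<in> pp_subspace H ip E \<longleftrightarrow> f \<in> H \<and> (\<exists>S. countable S \<and> E (- S) f = 0)"
proof -
  have "emeasure (\<mu> f) (- S) = 0 \<longleftrightarrow> E (- S) f = 0" if "countable S" "f \<in> H" for S
    using that countable_imp_null_set_lborel[of S] by (intro emeasure_\<mu>_eq_0) auto
  then show ?thesis unfolding pp_subspace_def by blast
qed

lemma ac_subspace_iff:
  "f \<in> ac_subspace H ip E \<longleftrightarrow> f \<in> H \<and> (\<forall>N\<in>null_sets lborel. E N f = 0)"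
proof -
  have "N \<in> null_sets (\<mu> f) \<longleftrightarrow> E N f = 0" if "N \<in> null_sets lborel" "f \<in> H" for N
    using that by (auto simp: null_sets_def emeasure_\<mu>_eq_0)
  then show ?thesis unfolding ac_subspace_def absolutely_continuous_def by blast
qed

lemma sc_subspace_iff:
  "f \<in> sc_subspace H ip E \<longleftrightarrow> f \<in> H \<and> (\<forall>x. E {x} f = 0) \<and> (\<exists>N\<in>null_sets lborel. E (- N) f = 0)"
proof -
  have "emeasure (\<mu> f) (- N) = 0 \<longleftrightarrow> E (- N) f = 0" if "N \<in> null_sets lborel" "f \<in> H" for N
    using that by (intro emeasure_\<mu>_eq_0) auto
  moreover have "emeasure (\<mu> f) {x} = 0 \<longleftrightarrow> E {x} f = 0" if "f \<in> H" for x
    using that by (intro emeasure_\<mu>_eq_0) auto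
  ultimately show ?thesis unfolding sc_subspace_def by auto
qed

end

section \<open>Spectral domain and polarized first moments\<close>

context pvm begin

abbreviation "sd \<equiv> spectral_dom H ip E"

text \<open>The candidate for \<open><T f, f>\<close>. The integral exists on \<open>sd\<close>;
  wherever it does not, it takes the default value 0.\<close>

definition mean :: "'v \<Rightarrow> real" where
  "mean f = (\<integral>x. x \<partial>\<mu> f)"

lemma measurable_\<mu> [simp]: "g \<in> borel_measurable (\<mu> f) \<longleftrightarrow> g \<in> borel_measurable borel"
  by (rule arg_cong2[of _ _ _ _ "(\<in>)"]) (auto intro!: measurable_cong_sets)

lemma sd_iff: "f \<in> sd \<longleftrightarrow> f \<in> H \<and> (\<integral>\<^sup>+x. ennreal (x\<^sup>2) \<partial>\<mu> f) < \<infinity>"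
  by (auto simp: spectral_dom_def integrable_iff_bounded)

lemma sdD: "f \<in> sd \<Longrightarrow> f \<in> H"
  by (simp add: spectral_dom_def)

text \<open>\<open>\<mu> (f + g)\<close> is not the sum of \<open>\<mu> f\<close> and
  \<open>\<mu> g\<close>, but \<open>|x + y|^2 <= 2 |x|^2 + 2 |y|^2\<close> dominates it on sets and
  hence on nonnegative functions. This makes \<open>sd\<close> closed under addition.\<close>

lemma nn_integral_\<mu>_add_le:
  assumes f: "f \<in> H" and g: "g \<in> H" and u: "u \<in> borel_measurable borel"
  shows "(\<integral>\<^sup>+x. u x \<partial>\<mu> (f + g)) \<le> 2 * (\<integral>\<^sup>+x. u x \<partial>\<mu> f) + 2 * (\<integral>\<^sup>+x. u x \<partial>\<mu> g)"
  using u
proof (induction rule: borel_measurable_induct)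
  case (cong u v)
  then have "u = v" by auto
  then show ?case using cong by simp
next
  case (set C)
  let ?f = "E C f" and ?g = "E C g"
  have fg: "?f \<in> H" "?g \<in> H" using f g set by simp_all
  have "0 \<le> ip (?f - ?g) (?f - ?g)" using fg by simp
  then have "ip (?f + ?g) (?f + ?g) \<le> 2 * ip ?f ?f + 2 * ip ?g ?g"
    using fg by (simp add: ip_add_left ip_add_right ip_diff_left ip_diff_right)
  then have "ennreal (ip (?f + ?g) (?f + ?g)) \<le> ennreal (2 * ip ?f ?f + 2 * ip ?g ?g)"
    by (rule ennreal_leI)
  also have "\<dots> = 2 * ennreal (ip ?f ?f) + 2 * ennreal (ip ?g ?g)"
    using fg by (simp add: ennreal_mult)
  finally show ?case
    using f g set E_ip[of C "f + g"] by (simp add: emeasure_\<mu> E_ip E_add)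
next
  case (mult u c)
  have "c * (\<integral>\<^sup>+x. u x \<partial>\<mu> (f + g)) \<le> c * (2 * (\<integral>\<^sup>+x. u x \<partial>\<mu> f) + 2 * (\<integral>\<^sup>+x. u x \<partial>\<mu> g))"
    by (intro mult_left_mono mult) simp
  then show ?case using mult by (simp add: nn_integral_cmult algebra_simps)
next
  case (add u v)
  then have "(\<integral>\<^sup>+x. u x \<partial>\<mu> (f + g)) + (\<integral>\<^sup>+x. v x \<partial>\<mu> (f + g))
      \<le> (2 * (\<integral>\<^sup>+x. u x \<partial>\<mu> f) + 2 * (\<integral>\<^sup>+x. u x \<partial>\<mu> g))
        + (2 * (\<integral>\<^sup>+x. v x \<partial>\<mu> f) + 2 * (\<integral>\<^sup>+x. v x \<partial>\<mu> g))"
    by (intro add_mono) auto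
  then show ?case using add by (simp add: nn_integral_add algebra_simps)
next
  case (seq U)
  have "(\<integral>\<^sup>+x. (SUP i. U i x) \<partial>\<mu> (f + g)) = (SUP i. \<integral>\<^sup>+x. U i x \<partial>\<mu> (f + g))"
    using seq by (intro nn_integral_monotone_convergence_SUP) auto
  also have "\<dots> \<le> 2 * (\<integral>\<^sup>+x. (SUP i. U i x) \<partial>\<mu> f) + 2 * (\<integral>\<^sup>+x. (SUP i. U i x) \<partial>\<mu> g)"
  proof (rule SUP_least)
    fix i
    have "(\<integral>\<^sup>+x. U i x \<partial>\<mu> (f + g)) \<le> 2 * (\<integral>\<^sup>+x. U i x \<partial>\<mu> f) + 2 * (\<integral>\<^sup>+x. U i x \<partial>\<mu> g)"
      using seq by simp
    also have "\<dots> \<le> 2 * (\<integral>\<^sup>+x. (SUP i. U i x) \<partial>\<mu> f) + 2 * (\<integral>\<^sup>+x. (SUP i. U i x) \<partial>\<mu> g)"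
      by (intro add_mono mult_left_mono nn_integral_mono SUP_upper) auto
    finally show "(\<integral>\<^sup>+x. U i x \<partial>\<mu> (f + g))
      \<le> 2 * (\<integral>\<^sup>+x. (SUP i. U i x) \<partial>\<mu> f) + 2 * (\<integral>\<^sup>+x. (SUP i. U i x) \<partial>\<mu> g)" .
  qed
  finally show ?case by (simp add: image_comp)
qed

lemma sd_add [simp]:
  assumes "f \<in> sd" "g \<in> sd" shows "f + g \<in> sd"
proof -
  have "(\<integral>\<^sup>+x. ennreal (x\<^sup>2) \<partial>\<mu> (f + g))
      \<le> 2 * (\<integral>\<^sup>+x. ennreal (x\<^sup>2) \<partial>\<mu> f) + 2 * (\<integral>\<^sup>+x. ennreal (x\<^sup>2) \<partial>\<mu> g)"
    using assms by (intro nn_integral_\<mu>_add_le) (simp_all add: sdD)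
  also have "\<dots> < \<infinity>" using assms by (simp add: sd_iff ennreal_mult_less_top)
  finally show ?thesis using assms by (simp add: sd_iff)
qed

lemma sd_minus [simp]: "f \<in> sd \<Longrightarrow> - f \<in> sd"
  by (simp add: sd_iff \<mu>_minus)

lemma sd_diff [simp]: "f \<in> sd \<Longrightarrow> g \<in> sd \<Longrightarrow> f - g \<in> sd"
  using sd_add[of f "- g"] by simp

lemma sd_E [simp]:
  assumes f: "f \<in> sd" and C: "C \<in> sets borel" shows "E C f \<in> sd"
proof -
  have "(\<integral>\<^sup>+x. ennreal (x\<^sup>2) \<partial>\<mu> (E C f)) = (\<integral>\<^sup>+x. indicator C x * ennreal (x\<^sup>2) \<partial>\<mu> f)"
    using sdD[OF f] C by (simp add: \<mu>_E nn_integral_density)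
  also have "\<dots> \<le> (\<integral>\<^sup>+x. ennreal (x\<^sup>2) \<partial>\<mu> f)"
    by (intro nn_integral_mono) (simp split: split_indicator)
  also have "\<dots> < \<infinity>" using f by (simp add: sd_iff)
  finally show ?thesis using f C by (simp add: sd_iff)
qed

lemma integrable_sd: "f \<in> sd \<Longrightarrow> integrable (\<mu> f) (\<lambda>x. x)"
proof -
  assume f: "f \<in> sd"
  interpret finite_measure "\<mu> f" using f by (intro finite_measure_\<mu> sdD)
  have "integrable (\<mu> f) (\<lambda>x. x\<^sup>2)" using f by (simp add: spectral_dom_def)
  then have "integrable (\<mu> f) (\<lambda>x. 1 + x\<^sup>2)" by simp
  then show ?thesis
  proof (rule Bochner_Integration.integrable_bound)
    have "\<bar>x\<bar> \<le> 1 + x\<^sup>2" for x :: real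
    proof -
      have "0 \<le> (\<bar>x\<bar> - 1)\<^sup>2" by simp
      then have "2 * \<bar>x\<bar> \<le> 1 + x\<^sup>2" by (simp add: power2_diff)
      then show ?thesis by linarith
    qed
    then show "AE x in \<mu> f. norm x \<le> norm (1 + x\<^sup>2)" by (auto intro!: AE_I2)
  qed simp
qed

declare sdD [simp]

lemma mean_E:
  assumes f: "f \<in> H" and C: "C \<in> sets borel"
  shows "mean (E C f) = (\<integral>x. indicator C x * x \<partial>\<mu> f)"
proof -
  have "mean (E C f) = (\<integral>x. x \<partial>density (\<mu> f) (\<lambda>x. ennreal (indicator C x)))"
    using f C by (simp add: mean_def \<mu>_E ennreal_indicator)
  also have "\<dots> = (\<integral>x. indicator C x *\<^sub>R x \<partial>\<mu> f)"
    using C by (intro integral_density) auto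
  finally show ?thesis by simp
qed

lemma mean_split:
  assumes f: "f \<in> sd" and C: "C \<in> sets borel"
  shows "mean f = mean (E C f) + mean (E (- C) f)"
proof -
  have int: "integrable (\<mu> f) (\<lambda>x. indicator D x * x)" if "D \<in> sets borel" for D :: "real set"
    using integrable_sd[OF f]
    by (rule Bochner_Integration.integrable_bound) (use that in \<open>auto split: split_indicator\<close>)
  have "mean f = (\<integral>x. indicator C x * x + indicator (- C) x * x \<partial>\<mu> f)"
    unfolding mean_def by (intro Bochner_Integration.integral_cong) (auto split: split_indicator)
  also have "\<dots> = mean (E C f) + mean (E (- C) f)"
    using f C by (subst Bochner_Integration.integral_add) (auto simp: mean_E intro!: int)
  finally show ?thesis .
qed

lemma mean_minus: "f \<in> H \<Longrightarrow> mean (- f) = mean f"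
  by (simp add: mean_def \<mu>_minus)

definition polar :: "'v \<Rightarrow> 'v \<Rightarrow> real" where
  "polar f g = (mean (f + g) - mean (f - g)) / 4"

lemma polar_commute:
  assumes "f \<in> H" "g \<in> H" shows "polar f g = polar g f"
  using mean_minus[of "f - g"] assms by (simp add: polar_def add.commute)

text \<open>After splitting both means at \<open>C\<close>, the parts outside \<open>C\<close>
  belong to \<open>E (- C) g\<close> and its negative; they have equal means and cancel.\<close>

lemma polar_E_left:
  assumes f: "f \<in> sd" and g: "g \<in> sd" and C: "C \<in> sets borel"
  shows "polar (E C f) g = (mean (E C (f + g)) - mean (E C (f - g))) / 4"
proof -
  have "E (- C) (E C f) = 0" using f C by (intro E_disjoint) auto
  then have "E (- C) (E C f + g) = E (- C) g" "E (- C) (E C f - g) = - E (- C) g"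
    using f g C by (simp_all add: E_simps)
  moreover have "E C (E C f + g) = E C (f + g)" "E C (E C f - g) = E C (f - g)"
    using f g C by (simp_all add: E_simps)
  ultimately show ?thesis
    using mean_split[of "E C f + g" C] mean_split[of "E C f - g" C] f g C
    by (simp add: polar_def mean_minus)
qed

text \<open>The expression in \<open>polar_E_left\<close> is symmetric in \<open>f\<close> and
  \<open>g\<close> because the mean is even. This is the weak form of \<open>E C\<close> commuting
  with the operator.\<close>

lemma polar_E:
  assumes f: "f \<in> sd" and g: "g \<in> sd" and C: "C \<in> sets borel"
  shows "polar (E C f) g = polar f (E C g)"
proof -
  have "polar f (E C g) = polar (E C g) f" using f g C by (simp add: polar_commute)
  also have "\<dots> = (mean (E C (g + f)) - mean (- E C (g - f))) / 4"
    using f g C by (simp add: polar_E_left mean_minus)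
  also have "- E C (g - f) = E C (f - g)" using f g C by (simp add: E_simps)
  finally show ?thesis using f g C by (simp add: polar_E_left add.commute)
qed

lemma spectral_measure_of_iff:
  "spectral_measure_of H ip T E \<longleftrightarrow>
     T = {(f, h). f \<in> sd \<and> h \<in> H \<and> (\<forall>g\<in>sd. ip h g = polar f g)}"
  by (simp add: spectral_measure_of_def pvm polar_def mean_def)

end

section \<open>Transport of spectral measures\<close>

locale spectral_pair = adjoint_pair H ip DA A DB B + pvm H ip E
  for H :: "'v::real_vector set" and ip :: "'v inner_prod" and DA A DB B E +
  assumes spectral: "spectral_measure_of H ip (comp_graph DA A DB B) E"
begin

lemma T_spectral: "(f, h) \<in> T \<longleftrightarrow> f \<in> sd \<and> h \<in> H \<and> (\<forall>g\<in>sd. ip h g = polar f g)"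
  using spectral by (simp add: spectral_measure_of_iff)

lemma domT_sd: "u \<in> domT \<Longrightarrow> u \<in> sd"
  using T_spectral[of u "B (A u)"] by (simp add: T_iff)

lemma ip_T: "u \<in> domT \<Longrightarrow> g \<in> sd \<Longrightarrow> ip (B (A u)) g = polar u g"
  using T_spectral[of u "B (A u)"] by (simp add: T_iff)

text \<open>\<open>polar_E\<close> moves \<open>E C\<close> across the weak equation that
  characterizes \<open>T\<close>.\<close>

lemma E_domT:
  assumes u: "u \<in> domT" and C: "C \<in> sets borel"
  shows "E C u \<in> domT" "B (A (E C u)) = E C (B (A u))"
proof -
  have "(E C u, E C (B (A u))) \<in> T"
    unfolding T_spectral
  proof (intro conjI ballI)
    fix g assume g: "g \<in> sd"
    have "ip (E C (B (A u))) g = ip (B (A u)) (E C g)" using u g C by (simp add: E_adj)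
    also have "\<dots> = polar u (E C g)" using u g C by (intro ip_T) auto
    also have "\<dots> = polar (E C u) g" using domT_sd[OF u] g C by (simp add: polar_E)
    finally show "ip (E C (B (A u))) g = polar (E C u) g" .
  qed (use u C domT_sd in auto)
  then show "E C u \<in> domT" "B (A (E C u)) = E C (B (A u))" by (auto simp: T_iff)
qed

text \<open>\<open>(nrm (A u))^2 = <B A u, u>\<close> is the first moment of \<open>\<mu> u\<close>,
  a measure concentrated on (a,b].\<close>

lemma sandwich_domT:
  assumes u: "u \<in> domT" and fix_u: "E {a<..b} u = u"
  shows "a * (nrm u)\<^sup>2 \<le> (nrm (A u))\<^sup>2" "(nrm (A u))\<^sup>2 \<le> b * (nrm u)\<^sup>2"
proof -
  let ?C = "{a<..b}"
  have between: "a * (nrm x)\<^sup>2 \<le> mean x" "mean x \<le> b * (nrm x)\<^sup>2" if "x \<in> H" "E ?C x = x" for x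
    using integral_between[of "\<mu> x" a b] finite_measure_\<mu> AE_\<mu>[of x ?C] that
    by (simp_all add: mean_def measure_\<mu>)
  have mean0: "mean 0 = 0" using between[of 0] by simp
  \<comment> \<open>\<open>polar u u\<close> is a quarter of the mean of \<open>u + u\<close>;
    bounding the mean of \<open>u + u\<close> directly replaces homogeneity of the mean.\<close>
  have uu: "u + u \<in> H" "E ?C (u + u) = u + u" using u fix_u by (simp_all add: E_simps)
  have "(nrm (A u))\<^sup>2 = ip (B (A u)) u" using u by (simp add: nrm_sq ip_domT)
  also have "\<dots> = polar u u" using u domT_sd by (intro ip_T) auto
  also have "\<dots> = mean (u + u) / 4" by (simp add: polar_def mean0)
  finally have eq: "(nrm (A u))\<^sup>2 = mean (u + u) / 4" .
  have "(nrm (u + u))\<^sup>2 = 4 * (nrm u)\<^sup>2" using u by (simp add: nrm_sq ip_add_left ip_add_right)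
  then show "a * (nrm u)\<^sup>2 \<le> (nrm (A u))\<^sup>2" "(nrm (A u))\<^sup>2 \<le> b * (nrm u)\<^sup>2"
    using between[OF uu] unfolding eq by simp_all
qed

section \<open>The transported projections and their additivity\<close>

definition kerB :: "'v set" where
  "kerB = {v\<in>DB. B v = 0}"

text \<open>The spectral measure \<open>E'\<close> of \<open>A B\<close> has to satisfy \<open>E' C (A u) = A (E C u)\<close> and, on the kernel of
  \<open>B\<close>, to be concentrated at 0. This determines the range of each projection.\<close>

definition E' :: "real set \<Rightarrow> 'v \<Rightarrow> 'v" where
  "E' C = proj ((\<lambda>u. A (E C u)) ` domT \<union> (if 0 \<in> C then kerB else {}))"

lemma kerBD: "v \<in> kerB \<Longrightarrow> v \<in> H" "v \<in> kerB \<Longrightarrow> v \<in> DB" "v \<in> kerB \<Longrightarrow> B v = 0"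
  by (auto simp: kerB_def)

lemma kerB_orth: "u \<in> DA \<Longrightarrow> v \<in> kerB \<Longrightarrow> ip (A u) v = 0"
  by (simp add: kerBD adj)

lemma ranges_subset:
  assumes "C \<in> sets borel"
  shows "(\<lambda>u. A (E C u)) ` domT \<union> (if 0 \<in> C then kerB else {}) \<subseteq> H" (is "?M \<subseteq> H")
  using assms E_domT by (auto simp: kerBD)

lemma E'_projection: "C \<in> sets borel \<Longrightarrow> orthogonal_projection H ip (E' C)"
  unfolding E'_def by (intro orthogonal_projection_proj ranges_subset)

lemma E'_mem [simp]: "C \<in> sets borel \<Longrightarrow> f \<in> H \<Longrightarrow> E' C f \<in> H"
  and E'_add: "C \<in> sets borel \<Longrightarrow> f \<in> H \<Longrightarrow> g \<in> H \<Longrightarrow> E' C (f + g) = E' C f + E' C g"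
  and E'_adj: "C \<in> sets borel \<Longrightarrow> f \<in> H \<Longrightarrow> g \<in> H \<Longrightarrow> ip (E' C f) g = ip f (E' C g)"
  using E'_projection[of C] by (auto simp: orthogonal_projection_def)

lemma mem_orth_orth: "M \<subseteq> H \<Longrightarrow> x \<in> M \<Longrightarrow> x \<in> orth (orth M)"
  by (auto simp: orth_def ip_commute subset_iff)

text \<open>The remainder is \<open>A (E (- C) u)\<close>. It is orthogonal to each
  \<open>A (E C w)\<close>, since moving \<open>A\<close> across brings \<open>E (- C)\<close> next
  to \<open>E C\<close>, and to \<open>kerB\<close>, as the whole range of \<open>A\<close>
  is.\<close>

lemma E'_A:
  assumes u: "u \<in> domT" and C: "C \<in> sets borel"
  shows "E' C (A u) = A (E C u)"
  unfolding E'_def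
proof (rule projI[OF ranges_subset[OF C]])
  let ?M = "(\<lambda>u. A (E C u)) ` domT \<union> (if 0 \<in> C then kerB else {})"
  show "A (E C u) \<in> orth (orth ?M)" using mem_orth_orth[OF ranges_subset[OF C]] u by auto
  show "A u \<in> H" using u by simp
  have C': "- C \<in> sets borel" using C by auto
  have dom: "E C u \<in> domT" "E (- C) u \<in> domT" using E_domT u C C' by auto
  have "A u = A (E C u) + A (E (- C) u)"
    using E_compl[OF C, of u] u dom A_add[of "E C u" "E (- C) u"] by simp
  then have eq: "A u - A (E C u) = A (E (- C) u)" by simp
  have "ip (A (E (- C) u)) (A (E C w)) = 0" if w: "w \<in> domT" for w
  proof -
    have w': "E C w \<in> domT" using E_domT w C by auto
    have "ip (A (E (- C) u)) (A (E C w)) = ip (E (- C) (B (A u))) (E C w)"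
      using dom w' ip_domT[of "E (- C) u" "E C w"] E_domT(2)[OF u C'] by simp
    also have "\<dots> = ip (B (A u)) (E (- C) (E C w))"
      using u w C C' by (intro E_adj) auto
    also have "E (- C) (E C w) = 0" using w C C' by (intro E_disjoint) auto
    finally show ?thesis using u by simp
  qed
  moreover have "ip (A (E (- C) u)) v = 0" if "v \<in> kerB" for v
    using that dom by (intro kerB_orth) auto
  ultimately show "A u - A (E C u) \<in> orth ?M"
    unfolding eq using dom by (auto simp: orth_def)
qed

lemma E'_kerB:
  assumes v: "v \<in> kerB" and C: "C \<in> sets borel"
  shows "E' C v = (if 0 \<in> C then v else 0)"
  unfolding E'_def
proof (rule projI[OF ranges_subset[OF C]])
  let ?M = "(\<lambda>u. A (E C u)) ` domT \<union> (if 0 \<in> C then kerB else {})"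
  show "(if 0 \<in> C then v else 0) \<in> orth (orth ?M)"
    using mem_orth_orth[OF ranges_subset[OF C], of v] v
      subspace_0[OF subspace_orth[OF orth_subset[of ?M]]] by auto
  show "v \<in> H" using v by (simp add: kerBD)
  have "ip v (A (E C u)) = 0" if "u \<in> domT" for u
  proof -
    have "E C u \<in> DA" using E_domT[OF that C] by simp
    then show ?thesis using kerB_orth[of "E C u" v] v ip_commute[of v "A (E C u)"] by (simp add: kerBD)
  qed
  then show "v - (if 0 \<in> C then v else 0) \<in> orth ?M"
    using v ranges_subset[OF C] by (auto simp: orth_def kerBD)
qed

text \<open>The vectors \<open>A u\<close> with \<open>u\<close> in \<open>domT\<close> and the
  kernel of \<open>B\<close> span a dense subspace: by \<open>adj_core\<close> whatever is
  orthogonal to the former lies in \<open>kerB\<close>, and is then orthogonal to itself.\<close>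

lemma total_eq:
  assumes x: "x \<in> H" and y: "y \<in> H" and "\<And>u. u \<in> domT \<Longrightarrow> ip x (A u) = ip y (A u)"
    and "\<And>v. v \<in> kerB \<Longrightarrow> ip x v = ip y v"
  shows "x = y"
proof -
  define d where "d = x - y"
  have d: "d \<in> H" using x y by (simp add: d_def)
  have "ip (A u) d = ip u 0" if "u \<in> domT" for u
    using assms that ip_commute[of "A u" d] d by (simp add: d_def ip_diff_left)
  then have "d \<in> kerB" using adj_core[OF d zero_mem] by (simp add: kerB_def)
  then have "ip d d = 0" using assms by (simp add: d_def ip_diff_left kerBD)
  then show ?thesis using d by (simp add: d_def)
qed

lemma E'_total:
  assumes C: "C \<in> sets borel" and f: "f \<in> H" and g: "g \<in> H"
    and "\<And>u. u \<in> domT \<Longrightarrow> ip f (A (E C u)) = ip g (A u)"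
    and "\<And>v. v \<in> kerB \<Longrightarrow> (if 0 \<in> C then ip f v else 0) = ip g v"
  shows "E' C f = g"
  using assms by (intro total_eq) (auto simp: E'_adj E'_A E'_kerB kerBD)

lemma E'_Un:
  assumes C: "C \<in> sets borel" "D \<in> sets borel" "C \<inter> D = {}" and f: "f \<in> H"
  shows "E' (C \<union> D) f = E' C f + E' D f"
proof (rule E'_total)
  show CD: "C \<union> D \<in> sets borel" using C by auto
  fix u assume u: "u \<in> domT"
  have dom: "E C u \<in> domT" "E D u \<in> domT" using E_domT u C by auto
  have "A (E (C \<union> D) u) = A (E C u) + A (E D u)"
    using E_Un[OF C, of u] u dom by simp
  then show "ip f (A (E (C \<union> D) u)) = ip (E' C f + E' D f) (A u)"
    using f u dom C by (simp add: ip_add_right ip_add_left E'_adj E'_A)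
next
  fix v assume "v \<in> kerB"
  moreover have "\<not> (0 \<in> C \<and> 0 \<in> D)" using C(3) by blast
  ultimately show "(if 0 \<in> C \<union> D then ip f v else 0) = ip (E' C f + E' D f) v"
    using f by (auto simp: ip_add_left E'_adj E'_kerB kerBD C)
qed (use C f in auto)

text \<open>The maps \<open>E' (U n)\<close> are contractions, so it suffices to treat the dense
  subspace of all \<open>A u + v\<close> with \<open>v\<close> in \<open>kerB\<close>, where
  \<open>E'\<close> is explicit.\<close>

lemma E'_tendsto_0:
  assumes f: "f \<in> H" and U: "\<And>n. U n \<in> sets borel" "decseq U" "(\<Inter>n. U n) = {}"
  shows "(\<lambda>n. ip (E' (U n) f) f) \<longlonglongrightarrow> 0"
proof -
  have nrm_le: "nrm (E' (U n) x) \<le> nrm x" if x: "x \<in> H" for x n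
  proof -
    have "ip (x - E' (U n) x) (E' (U n) x) = 0"
      using x U E'_adj[of "U n" x "E' (U n) x"] E'_projection[OF U(1), of n]
        ip_commute[of x "E' (U n) x"]
      by (simp add: ip_diff_left orthogonal_projection_def)
    then have "(nrm (E' (U n) x))\<^sup>2 = ip x (E' (U n) x)" using x U by (simp add: nrm_sq ip_diff_left)
    also have "\<dots> \<le> nrm x * nrm (E' (U n) x)" using x U by (simp add: ip_le_nrm)
    finally have "nrm (E' (U n) x) * nrm (E' (U n) x) \<le> nrm x * nrm (E' (U n) x)"
      by (simp add: power2_eq_square)
    then show ?thesis
      using x U by (cases "nrm (E' (U n) x) = 0") (auto simp: less_le)
  qed
  define K where "K = {A u + v |u v. u \<in> domT \<and> v \<in> kerB}"
  have KH: "K \<subseteq> H" by (auto simp: K_def kerBD)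
  have subK: "subspace K"
  proof (rule subspaceI)
    have "A 0 + 0 \<in> K" unfolding K_def kerB_def using subspace_0[OF subspace_domT] by force
    then show "0 \<in> K" by simp
  next
    fix x y assume "x \<in> K" "y \<in> K"
    then obtain u v u' v' where xy: "x = A u + v" "u \<in> domT" "v \<in> kerB"
      "y = A u' + v'" "u' \<in> domT" "v' \<in> kerB" by (auto simp: K_def)
    have "x + y = A (u + u') + (v + v')" using xy by simp
    moreover have "u + u' \<in> domT" "v + v' \<in> kerB"
      using xy subspace_add[OF subspace_domT] by (auto simp: kerB_def)
    ultimately show "x + y \<in> K" unfolding K_def by blast
  next
    fix c x assume "x \<in> K"
    then obtain u v where xy: "x = A u + v" "u \<in> domT" "v \<in> kerB" by (auto simp: K_def)
    have "c *\<^sub>R x = A (c *\<^sub>R u) + c *\<^sub>R v" using xy by (simp add: scaleR_add_right)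
    moreover have "c *\<^sub>R u \<in> domT" "c *\<^sub>R v \<in> kerB"
      using xy subspace_scale[OF subspace_domT] by (auto simp: kerB_def)
    ultimately show "c *\<^sub>R x \<in> K" unfolding K_def by blast
  qed
  have perpK: "ip x f = 0" if x: "x \<in> H" and perp: "\<And>k. k \<in> K \<Longrightarrow> ip x k = 0" for x
  proof -
    have "A u \<in> K" if "u \<in> domT" for u
    proof -
      have "A u + 0 \<in> K" unfolding K_def kerB_def using that by force
      then show ?thesis by simp
    qed
    moreover have "v \<in> K" if "v \<in> kerB" for v
    proof -
      have "A 0 + v \<in> K" unfolding K_def using that subspace_0[OF subspace_domT] by blast
      then show ?thesis by simp
    qed
    ultimately have "x = 0" using x perp kerBD by (intro total_eq) auto
    then show ?thesis using f by simp
  qed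
  obtain k :: "nat \<Rightarrow> 'v" where k: "\<And>m. k m \<in> K" "(\<lambda>m. nrm (k m - f)) \<longlonglongrightarrow> 0"
    using approximating_sequence[OF subK KH f perpK] by blast
  have tend_K: "(\<lambda>n. nrm (E' (U n) x)) \<longlonglongrightarrow> 0" if xK: "x \<in> K" for x
  proof -
    obtain u v where uv: "x = A u + v" "u \<in> domT" "v \<in> kerB" using xK by (auto simp: K_def)
    \<comment> \<open>From some index on the decreasing sets miss 0, and the kernel component drops
      out.\<close>
    obtain n0 where n0: "0 \<notin> U n0" using U(3) by blast
    \<comment> \<open>\<open>A\<close> need not be continuous; instead
      \<open>|A e|^2 = <B A u, e>\<close> for \<open>e = E (U n) u\<close>, which bounds
      \<open>|A e|\<close> by the square root of \<open>|B A u| |e|\<close>.\<close>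
    have "(\<lambda>n. sqrt (nrm (B (A u)) * nrm (E (U n) u))) \<longlonglongrightarrow> sqrt (nrm (B (A u)) * 0)"
      using uv U by (intro tendsto_intros E_tendsto_0) auto
    then have lim: "(\<lambda>n. sqrt (nrm (B (A u)) * nrm (E (U n) u))) \<longlonglongrightarrow> 0" by simp
    show ?thesis
    proof (rule Lim_null_comparison[OF _ lim])
      show "\<forall>\<^sub>F n in sequentially. norm (nrm (E' (U n) x)) \<le> sqrt (nrm (B (A u)) * nrm (E (U n) u))"
      proof (rule eventually_sequentiallyI[of n0])
        fix n assume "n0 \<le> n"
        then have "0 \<notin> U n" using n0 U(2) by (auto simp: decseq_def)
        then have eq: "E' (U n) x = A (E (U n) u)"
          using uv U by (simp add: E'_add E'_A E'_kerB kerBD)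
        have dom: "E (U n) u \<in> domT" using E_domT uv U by auto
        have "(nrm (A (E (U n) u)))\<^sup>2 = ip (E (U n) (B (A u))) (E (U n) u)"
          using dom ip_domT[of "E (U n) u" "E (U n) u"] E_domT(2)[OF uv(2) U(1)] by (simp add: nrm_sq)
        also have "\<dots> = ip (B (A u)) (E (U n) u)" using uv U by (simp add: E_adj)
        also have "\<dots> \<le> nrm (B (A u)) * nrm (E (U n) u)" using uv U by (intro ip_le_nrm) auto
        finally have "nrm (A (E (U n) u)) \<le> sqrt (nrm (B (A u)) * nrm (E (U n) u))"
          by (rule real_le_rsqrt)
        then show "norm (nrm (E' (U n) x)) \<le> sqrt (nrm (B (A u)) * nrm (E (U n) u))"
          using dom by (simp add: eq)
      qed
    qed
  qed
  have tend: "(\<lambda>n. nrm (E' (U n) f)) \<longlonglongrightarrow> 0"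
  proof (rule LIMSEQ_I)
    fix e :: real assume e: "0 < e"
    obtain m where "norm (nrm (k m - f) - 0) < e / 2"
      using LIMSEQ_D[OF k(2), of "e / 2"] e by (meson half_gt_zero order_refl)
    then have m: "nrm (k m - f) < e / 2" by simp
    obtain n0 where n0: "\<And>n. n \<ge> n0 \<Longrightarrow> norm (nrm (E' (U n) (k m))) < e / 2"
      using LIMSEQ_D[OF tend_K[OF k(1)], of "e / 2" m] e by auto
    have "norm (nrm (E' (U n) f) - 0) < e" if "n \<ge> n0" for n
    proof -
      have kH: "k m \<in> H" using k KH by auto
      have "E' (U n) f = E' (U n) (k m) + E' (U n) (f - k m)"
        using E'_add[OF U(1), of "k m" "f - k m" n] f kH by simp
      then have "nrm (E' (U n) f) \<le> nrm (E' (U n) (k m)) + nrm (E' (U n) (f - k m))"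
        using nrm_triangle f kH U by simp
      also have "\<dots> \<le> nrm (E' (U n) (k m)) + nrm (f - k m)"
        using nrm_le[of "f - k m" n] f kH by simp
      also have "nrm (f - k m) = nrm (k m - f)" using f kH by (intro nrm_diff_commute)
      finally show ?thesis using m n0[OF that] f kH U by simp
    qed
    then show "\<exists>n0. \<forall>n\<ge>n0. norm (nrm (E' (U n) f) - 0) < e" by blast
  qed
  then have "(\<lambda>n. nrm (E' (U n) f) * nrm f) \<longlonglongrightarrow> 0"
    using tendsto_mult_right[OF tend, of "nrm f"] by simp
  then show ?thesis
    by (rule Lim_null_comparison[rotated])
      (use f U cauchy_schwarz in \<open>auto intro!: always_eventually\<close>)
qed

text \<open>Countable additivity is finite additivity along the tails \<open>U n\<close>, whose
  contribution tends to 0; the partial sums telescope.\<close>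

lemma pvm_E': "projection_valued_measure H ip E'"
  unfolding projection_valued_measure_def
proof (intro conjI ballI allI impI)
  show "orthogonal_projection H ip (E' C)" if "C \<in> sets borel" for C
    using that by (rule E'_projection)
  show "E' UNIV f = f" if "f \<in> H" for f
    using that by (intro E'_total) auto
  fix f and C :: "nat \<Rightarrow> real set"
  assume f: "f \<in> H" and C: "range C \<subseteq> sets borel" "disjoint_family C"
  define U where "U n = (\<Union>i\<in>{n..}. C i)" for n
  have Cn: "C n \<in> sets borel" for n using C by auto
  have U: "U n \<in> sets borel" for n using Cn by (auto simp: U_def)
  have U_Suc: "U n = C n \<union> U (Suc n)" "C n \<inter> U (Suc n) = {}" for n
  proof -
    have "{n..} = insert n {Suc n..}" by auto
    then show "U n = C n \<union> U (Suc n)" unfolding U_def by (metis UN_insert)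
    have "C n \<inter> C i = {}" if "Suc n \<le> i" for i
      using C(2) that by (intro disjoint_family_onD[of C UNIV]) auto
    then show "C n \<inter> U (Suc n) = {}" unfolding U_def by blast
  qed
  have "decseq U" unfolding decseq_Suc_iff using U_Suc(1) by blast
  moreover have "(\<Inter>n. U n) = {}"
  proof safe
    fix x assume x: "x \<in> (\<Inter>n. U n)"
    then have "x \<in> U 0" by blast
    then obtain i where i: "x \<in> C i" by (auto simp: U_def)
    have "x \<in> U (Suc i)" using x by blast
    then show "x \<in> {}" using i U_Suc(2)[of i] by blast
  qed
  ultimately have lim: "(\<lambda>n. ip (E' (U n) f) f) \<longlonglongrightarrow> 0" using f U by (intro E'_tendsto_0)
  have partial: "(\<Sum>i<n. ip (E' (C i) f) f) = ip (E' (U 0) f) f - ip (E' (U n) f) f" for n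
  proof (induction n)
    case (Suc n)
    have "E' (U n) f = E' (C n) f + E' (U (Suc n)) f"
      using E'_Un[OF Cn U U_Suc(2) f] U_Suc(1) by metis
    then show ?case using Suc f Cn U by (simp add: ip_add_left)
  qed simp
  have "(\<lambda>n. \<Sum>i<n. ip (E' (C i) f) f) \<longlonglongrightarrow> ip (E' (U 0) f) f - 0"
    unfolding partial by (intro tendsto_intros lim)
  moreover have "U 0 = (\<Union>i. C i)" by (simp add: U_def)
  ultimately show "(\<lambda>i. ip (E' (C i) f) f) sums ip (E' (\<Union>i. C i) f) f"
    by (simp add: sums_def)
qed

end

section \<open>Intertwining relations, domains and densities\<close>

context spectral_pair begin

interpretation d: adjoint_pair H ip DB B DA A
  by (rule dual)

interpretation E': pvm H ip E'
  by unfold_locales (rule pvm_E')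

text \<open>On the core, \<open>E' C\<close> passes through \<open>A u\<close> as
  \<open>A (E C u)\<close>; \<open>adj_core\<close> turns the resulting identity into membership and
  value.\<close>

lemma B_E':
  assumes w: "w \<in> DB" and C: "C \<in> sets borel"
  shows "E' C w \<in> DB" "B (E' C w) = E C (B w)"
proof -
  have "ip (A u) (E' C w) = ip u (E C (B w))" if u: "u \<in> domT" for u
  proof -
    have "ip (A u) (E' C w) = ip (E' C (A u)) w" using u w C by (simp add: E'_adj)
    also have "\<dots> = ip (E C u) (B w)" using u w C E_domT(1)[OF u C] by (simp add: E'_A adj)
    also have "\<dots> = ip u (E C (B w))" using u w C by (simp add: E_adj)
    finally show ?thesis .
  qed
  then show "E' C w \<in> DB" "B (E' C w) = E C (B w)"
    using adj_core[of "E' C w" "E C (B w)"] w C by auto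
qed

text \<open>\<open>E'_A\<close> gives the relation on \<open>domT\<close>; testing against all of
  \<open>DB\<close>, where \<open>B_E'\<close> applies, extends it to \<open>DA\<close>.\<close>

lemma A_E:
  assumes u: "u \<in> DA" and C: "C \<in> sets borel"
  shows "E C u \<in> DA" "A (E C u) = E' C (A u)"
proof -
  have "ip (B v) (E C u) = ip v (E' C (A u))" if v: "v \<in> DB" for v
  proof -
    have "ip (B v) (E C u) = ip (B (E' C v)) u" using u v C B_E' by (simp add: E_adj)
    also have "\<dots> = ip (E' C v) (A u)" using B_E'(1)[OF v C] u by (simp add: adj')
    also have "\<dots> = ip v (E' C (A u))" using u v C by (simp add: E'_adj)
    finally show ?thesis .
  qed
  then show "E C u \<in> DA" "A (E C u) = E' C (A u)"
    using adj2[of "E C u" "E' C (A u)"] u C by auto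
qed

lemma nrm_A_E_le:
  assumes u: "u \<in> domT"
  shows "(nrm (A (E {a<..b} u)))\<^sup>2 \<le> b * (nrm (E {a<..b} u))\<^sup>2"
  using sandwich_domT(2)[of "E {a<..b} u" a b] E_domT(1)[OF u, of "{a<..b}"] u by simp

text \<open>The maximum covers \<open>b < 0\<close>, where the left side vanishes and
  \<open>sqrt b\<close> would be negative.\<close>

lemma nrm_A_E_le':
  assumes u: "u \<in> domT"
  shows "nrm (A (E {a<..b} u)) \<le> sqrt (max b 0) * nrm u"
proof -
  have "(nrm (A (E {a<..b} u)))\<^sup>2 \<le> max b 0 * (nrm (E {a<..b} u))\<^sup>2"
    using nrm_A_E_le[OF u, of a b] mult_right_mono[of b "max b 0" "(nrm (E {a<..b} u))\<^sup>2"] by simp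
  then have "nrm (A (E {a<..b} u)) \<le> sqrt (max b 0 * (nrm (E {a<..b} u))\<^sup>2)"
    by (rule real_le_rsqrt)
  also have "\<dots> = sqrt (max b 0) * nrm (E {a<..b} u)" using u by (simp add: real_sqrt_mult)
  also have "\<dots> \<le> sqrt (max b 0) * nrm u" using u by (intro mult_left_mono nrm_E_le) auto
  finally show ?thesis .
qed

text \<open>With \<open>b < 0\<close> the bound forces \<open>A (E {a<..b} u) = 0\<close>, and the
  interval misses 0, so the projection kills both \<open>A u\<close> for \<open>u\<close> in
  \<open>domT\<close> and \<open>kerB\<close>.\<close>

lemma E'_neg:
  assumes b: "b < 0" and f: "f \<in> H" shows "E' {a<..b} f = 0"
proof (rule E'_total)
  fix u assume u: "u \<in> domT"
  have dom: "E {a<..b} u \<in> domT" using E_domT(1)[OF u, of "{a<..b}"] by simp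
  have "nrm (A (E {a<..b} u)) \<le> 0" using nrm_A_E_le'[OF u, of a b] b by simp
  moreover have "0 \<le> nrm (A (E {a<..b} u))" using dom by simp
  ultimately have "A (E {a<..b} u) = 0" using dom by (metis A_mem domTD(1) nrm_eq_0 order_antisym)
  then show "ip f (A (E {a<..b} u)) = ip 0 (A u)" using f u by simp
qed (use b f in \<open>auto simp: kerBD\<close>)

text \<open>The bound on \<open>A\<close> carries over to its adjoint \<open>B\<close> by duality,
  tested on the dense domain of \<open>B A\<close>.\<close>

lemma nrm_E_B_le':
  assumes f: "f \<in> DB"
  shows "nrm (E {a<..b} (B f)) \<le> sqrt (max b 0) * nrm (E' {a<..b} f)"
proof -
  let ?C = "{a<..b}" and ?q = "E {a<..b} (B f)" and ?p = "E' {a<..b} f"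
  have p: "?p \<in> DB" "B ?p = ?q" using B_E'[OF f, of ?C] by auto
  have q: "?q \<in> H" using f by simp
  show ?thesis
  proof (rule nrm_le_domT[OF q])
    fix u assume u: "u \<in> domT"
    have dom: "E ?C u \<in> domT" using E_domT(1)[OF u, of ?C] by simp
    have "ip ?q u = ip ?q (E ?C u)" using E_adj[of ?C ?q u] q u f by simp
    also have "\<dots> = ip ?p (A (E ?C u))" using dom p adj'[of "E ?C u" ?p] by simp
    also have "\<dots> \<le> nrm ?p * nrm (A (E ?C u))" using dom p by (intro ip_le_nrm) auto
    also have "\<dots> \<le> nrm ?p * (sqrt (max b 0) * nrm u)"
      using nrm_A_E_le'[OF u] p by (intro mult_left_mono) auto
    finally show "ip ?q u \<le> sqrt (max b 0) * nrm ?p * nrm u" by (simp add: ac_simps)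
  qed (use p in simp)
qed

lemma nrm_E_B_le:
  assumes f: "f \<in> DB"
  shows "(nrm (E {a<..b} (B f)))\<^sup>2 \<le> b * (nrm (E' {a<..b} f))\<^sup>2"
proof (cases "b < 0")
  case True
  then have "nrm (E {a<..b} (B f)) \<le> 0" using nrm_E_B_le'[OF f, of a b] by simp
  then have "nrm (E {a<..b} (B f)) = 0" using f by (simp add: order_antisym)
  then show ?thesis using E'_neg[OF True, of f a] f by simp
next
  case False
  have "(nrm (E {a<..b} (B f)))\<^sup>2 \<le> (sqrt (max b 0) * nrm (E' {a<..b} f))\<^sup>2"
    using nrm_E_B_le'[OF f] f by (intro power_mono) auto
  then show ?thesis using False by (simp add: power_mult_distrib)
qed

text \<open>Truncation to a bounded interval makes \<open>A\<close> and \<open>B\<close> bounded, so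
  the functionals that decide membership in the two adjoint domains are bounded, for an arbitrary
  \<open>v\<close> in \<open>H\<close>.\<close>

lemma E_Ioc_domT:
  assumes v: "v \<in> H" shows "E {a<..b} v \<in> domT"
proof (rule domTI)
  let ?C = "{a<..b}"
  show DA: "E ?C v \<in> DA"
  proof (rule d.mem_DB_if_bounded)
    fix y assume y: "y \<in> d.domT"
    have "ip (B y) (E ?C v) = ip (E ?C (B y)) v" using y v by (simp add: E_adj)
    also have "\<dots> \<le> nrm (E ?C (B y)) * nrm v" using y v by (intro ip_le_nrm) auto
    also have "\<dots> \<le> (sqrt (max b 0) * nrm (E' ?C y)) * nrm v"
      using y v by (intro mult_right_mono nrm_E_B_le') auto
    also have "\<dots> \<le> (sqrt (max b 0) * nrm y) * nrm v"
      using y v by (intro mult_right_mono mult_left_mono E'.nrm_E_le) auto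
    finally show "ip (B y) (E ?C v) \<le> (sqrt (max b 0) * nrm v) * nrm y" by (simp add: ac_simps)
  qed (use v in simp)
  show "A (E ?C v) \<in> DB"
  proof (rule mem_DB_if_bounded)
    fix u assume u: "u \<in> domT"
    have fix_A: "A (E ?C v) = E' ?C (A (E ?C v))" using A_E[OF DA, of ?C] v by simp
    have dom: "E ?C u \<in> domT" using E_domT(1)[OF u, of ?C] by simp
    have "ip (A u) (A (E ?C v)) = ip (E' ?C (A u)) (A (E ?C v))"
      using E'_adj[of ?C "A u" "A (E ?C v)"] fix_A u DA by simp
    also have "\<dots> = ip (A (E ?C u)) (A (E ?C v))" using u by (simp add: E'_A)
    also have "\<dots> \<le> nrm (A (E ?C u)) * nrm (A (E ?C v))" using dom DA by (intro ip_le_nrm) auto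
    also have "\<dots> \<le> (sqrt (max b 0) * nrm u) * nrm (A (E ?C v))"
      using nrm_A_E_le'[OF u] DA by (intro mult_right_mono) auto
    finally show "ip (A u) (A (E ?C v)) \<le> (sqrt (max b 0) * nrm (A (E ?C v))) * nrm u"
      by (simp add: ac_simps)
  qed (use DA in simp)
qed

text \<open>For \<open>a > 0\<close>, \<open>E' {a<..b} f\<close> lies in the closure of the vectors
  \<open>A x\<close> with \<open>x\<close> in \<open>domT\<close> fixed by \<open>E {a<..b}\<close>.
  There \<open>nrm x <= nrm (A x) / sqrt a\<close>, so testing against \<open>A x\<close> bounds the
  projection by its image under \<open>B\<close>.\<close>

lemma nrm_E_B_ge:
  assumes f: "f \<in> DB"
  shows "a * (nrm (E' {a<..b} f))\<^sup>2 \<le> (nrm (E {a<..b} (B f)))\<^sup>2"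
proof (cases "a \<le> 0")
  case True
  then have "a * (nrm (E' {a<..b} f))\<^sup>2 \<le> 0" by (simp add: mult_nonpos_nonneg)
  then show ?thesis by (rule order_trans) simp
next
  case False
  then have a: "0 < a" by simp
  let ?C = "{a<..b}"
  let ?p = "E' ?C f"
  have p: "?p \<in> DB" "B ?p = E ?C (B f)" using B_E'[OF f, of ?C] by auto
  have pH: "?p \<in> H" using p by simp
  define K where "K = A ` {x \<in> domT. E ?C x = x}"
  have KH: "K \<subseteq> H" by (auto simp: K_def)
  have subK: "subspace K"
  proof -
    have "subspace {x \<in> domT. E ?C x = x}"
      using subspace_domT by (auto simp: subspace_def E_simps)
    moreover have "subspace (A ` W)" if W: "subspace W" "W \<subseteq> domT" for W
    proof (rule subspaceI)
      show "0 \<in> A ` W" using subspace_0[OF W(1)] by (intro image_eqI[of _ _ 0]) auto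
      show "x + y \<in> A ` W" if xy: "x \<in> A ` W" "y \<in> A ` W" for x y
      proof -
        obtain u w where "x = A u" "u \<in> W" "y = A w" "w \<in> W" using xy by auto
        moreover have "u \<in> DA" "w \<in> DA" using calculation W(2) by auto
        ultimately show ?thesis
          using subspace_add[OF W(1), of u w] by (intro image_eqI[of _ _ "u + w"]) auto
      qed
      show "c *\<^sub>R x \<in> A ` W" if x: "x \<in> A ` W" for c x
      proof -
        obtain u where "x = A u" "u \<in> W" using x by auto
        moreover have "u \<in> DA" using calculation W(2) by auto
        ultimately show ?thesis
          using subspace_scale[OF W(1), of u c] by (intro image_eqI[of _ _ "c *\<^sub>R u"]) auto
      qed
    qed
    ultimately show ?thesis unfolding K_def by blast
  qed
  have perp: "ip x ?p = 0" if x: "x \<in> H" and xK: "\<And>k. k \<in> K \<Longrightarrow> ip x k = 0" for x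
  proof -
    \<comment> \<open>As \<open>a > 0\<close>, the interval misses 0 and \<open>kerB\<close> is no
      part of the range of this projection.\<close>
    have "E' ?C x = 0"
    proof (rule E'_total)
      fix u assume u: "u \<in> domT"
      have "E ?C u \<in> domT" using E_domT(1)[OF u, of ?C] by simp
      then have "A (E ?C u) \<in> K" using u by (auto simp: K_def)
      then show "ip x (A (E ?C u)) = ip 0 (A u)" using xK u by simp
    qed (use x a in \<open>auto simp: kerBD\<close>)
    then show ?thesis using E'_adj[of ?C x f] x f by simp
  qed
  have "nrm ?p \<le> nrm (B ?p) / sqrt a"
  proof (rule nrm_le_of_ip_le[OF subK KH pH perp])
    fix k assume "k \<in> K"
    then obtain x where x: "k = A x" "x \<in> domT" "E ?C x = x" by (auto simp: K_def)
    have "a * (nrm x)\<^sup>2 \<le> (nrm (A x))\<^sup>2" using sandwich_domT(1)[OF x(2,3)] .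
    then have "sqrt (a * (nrm x)\<^sup>2) \<le> nrm (A x)" using x by (intro real_le_lsqrt) auto
    then have "nrm x \<le> nrm (A x) / sqrt a"
      using a x by (simp add: real_sqrt_mult field_simps)
    have "ip ?p k = ip (B ?p) x" using x(1,2) p(1) adj'[of x ?p] by simp
    also have "\<dots> \<le> nrm (B ?p) * nrm x" using x p(1) by (intro ip_le_nrm) auto
    also have "\<dots> \<le> nrm (B ?p) * (nrm (A x) / sqrt a)"
      using \<open>nrm x \<le> nrm (A x) / sqrt a\<close> p(1) by (intro mult_left_mono) auto
    finally show "ip ?p k \<le> nrm (B ?p) / sqrt a * nrm k" by (simp add: x)
  next
    show "0 \<le> nrm (B ?p) / sqrt a"
      using a by (intro divide_nonneg_nonneg nrm_nonneg B_mem p(1)) simp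
  qed
  then have "sqrt a * nrm ?p \<le> nrm (B ?p)" using a by (simp add: field_simps)
  then have "(sqrt a * nrm ?p)\<^sup>2 \<le> (nrm (B ?p))\<^sup>2" using a pH by (intro power_mono) auto
  then show ?thesis using a p by (simp add: power_mult_distrib)
qed

text \<open>The estimates on all intervals are the hypotheses of \<open>density_if_sandwich\<close>:
  \<open>B\<close> multiplies the scalar measure by x.\<close>

lemma density_B:
  assumes f: "f \<in> DB"
  shows "AE x in E'.\<mu> f. 0 \<le> x" "\<mu> (B f) = density (E'.\<mu> f) (\<lambda>x. ennreal x)"
proof -
  have "a * measure (E'.\<mu> f) {a<..b} \<le> measure (\<mu> (B f)) {a<..b}"
    "measure (\<mu> (B f)) {a<..b} \<le> b * measure (E'.\<mu> f) {a<..b}" for a b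
    using nrm_E_B_le[OF f, of a b] nrm_E_B_ge[OF f, of a b] f
    by (simp_all add: measure_\<mu> E'.measure_\<mu>)
  then show "AE x in E'.\<mu> f. 0 \<le> x" "\<mu> (B f) = density (E'.\<mu> f) (\<lambda>x. ennreal x)"
    using density_if_sandwich[OF E'.finite_measure_\<mu> finite_measure_\<mu>, of f "B f"] f by auto
qed

text \<open>Mirror image of \<open>density_B\<close>; truncation puts \<open>u\<close> into
  \<open>domT\<close>, where the interval estimates are available.\<close>

lemma density_A:
  assumes u: "u \<in> DA"
  shows "AE x in \<mu> u. 0 \<le> x" "E'.\<mu> (A u) = density (\<mu> u) (\<lambda>x. ennreal x)"
proof -
  have "a * measure (\<mu> u) {a<..b} \<le> measure (E'.\<mu> (A u)) {a<..b}"
    "measure (E'.\<mu> (A u)) {a<..b} \<le> b * measure (\<mu> u) {a<..b}" for a b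
    using sandwich_domT[of "E {a<..b} u" a b] E_Ioc_domT[of u a b] u A_E(2)[OF u, of "{a<..b}"]
    by (simp_all add: measure_\<mu> E'.measure_\<mu>)
  then show "AE x in \<mu> u. 0 \<le> x" "E'.\<mu> (A u) = density (\<mu> u) (\<lambda>x. ennreal x)"
    using density_if_sandwich[OF finite_measure_\<mu> E'.finite_measure_\<mu>, of u "A u"] u by auto
qed

lemma nn_integral_B:
  assumes f: "f \<in> DB" shows "(\<integral>\<^sup>+x. ennreal x \<partial>E'.\<mu> f) = ennreal ((nrm (B f))\<^sup>2)"
proof -
  have "ennreal ((nrm (B f))\<^sup>2) = emeasure (\<mu> (B f)) UNIV"
    using f by (simp add: emeasure_\<mu> nrm_sq)
  also have "\<dots> = (\<integral>\<^sup>+x. ennreal x \<partial>E'.\<mu> f)"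
    unfolding density_B(2)[OF f] by (subst emeasure_density) auto
  finally show ?thesis ..
qed

text \<open>By \<open>density_B\<close> the first moment is the total mass of
  \<open>\<mu> (B f)\<close>. Hence the first moment of \<open>E'\<close> reproduces the form of
  \<open>A B\<close>.\<close>

lemma mean_B:
  assumes f: "f \<in> DB" shows "E'.mean f = ip (B f) (B f)"
proof -
  have "E'.mean f = enn2real (\<integral>\<^sup>+x. ennreal x \<partial>E'.\<mu> f)"
    unfolding E'.mean_def using density_B(1)[OF f] by (intro integral_eq_nn_integral) auto
  then show ?thesis using f by (simp add: nn_integral_B nrm_sq)
qed

lemma polar_B:
  assumes "f \<in> DB" "g \<in> DB" shows "E'.polar f g = ip (B f) (B g)"
  using assms ip_commute[of "B f" "B g"]
  by (simp add: E'.polar_def mean_B ip_add_left ip_add_right ip_diff_left ip_diff_right)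

text \<open>A finite first moment bounds \<open>B\<close> uniformly on the truncations of
  \<open>g\<close>, and the resulting bound on \<open><A u, g>\<close> survives the limit.\<close>

lemma sd_E'_subset_DB: "E'.sd \<subseteq> DB"
proof
  fix g assume g: "g \<in> E'.sd"
  have gH: "g \<in> H" using g by simp
  define M where "M = (\<integral>\<^sup>+x. ennreal x \<partial>E'.\<mu> g)"
  have "M \<le> (\<integral>\<^sup>+x. ennreal \<bar>x\<bar> \<partial>E'.\<mu> g)"
    unfolding M_def by (intro nn_integral_mono ennreal_leI) auto
  also have "\<dots> < \<infinity>" using E'.integrable_sd[OF g] by (simp add: integrable_iff_bounded)
  finally have M: "M < \<infinity>" .
  define C where "C n = {- real n<..real n}" for n
  have C: "C n \<in> sets borel" for n by (simp add: C_def)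
  have mem: "E' (C n) g \<in> DB" for n
  proof (rule mem_DB_if_bounded)
    fix u assume u: "u \<in> domT"
    have dom: "E (C n) u \<in> domT" using E_domT(1)[OF u C] .
    have "ip (A u) (E' (C n) g) = ip (A (E (C n) u)) g"
      using u gH C E'_adj[OF C, of "A u" g n] by (simp add: E'_A)
    also have "\<dots> \<le> nrm (A (E (C n) u)) * nrm g" using dom gH by (intro ip_le_nrm) auto
    also have "\<dots> \<le> (sqrt (max (real n) 0) * nrm u) * nrm g"
      unfolding C_def using nrm_A_E_le'[OF u, of "- real n" "real n"] gH by (intro mult_right_mono) auto
    finally show "ip (A u) (E' (C n) g) \<le> (sqrt (max (real n) 0) * nrm g) * nrm u"
      by (simp add: ac_simps)
  qed (use gH C in simp)
  have bound: "nrm (B (E' (C n) g)) \<le> sqrt (enn2real M)" for n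
  proof -
    have "ennreal ((nrm (B (E' (C n) g)))\<^sup>2) = (\<integral>\<^sup>+x. ennreal x \<partial>E'.\<mu> (E' (C n) g))"
      using nn_integral_B[OF mem] ..
    also have "\<dots> = (\<integral>\<^sup>+x. indicator (C n) x * ennreal x \<partial>E'.\<mu> g)"
      using gH C by (simp add: E'.\<mu>_E nn_integral_density)
    also have "\<dots> \<le> M"
      unfolding M_def by (intro nn_integral_mono) (simp split: split_indicator)
    finally have "ennreal ((nrm (B (E' (C n) g)))\<^sup>2) \<le> ennreal (enn2real M)" using M by simp
    then show ?thesis by (intro real_le_rsqrt) simp
  qed
  show "g \<in> DB"
  proof (rule mem_DB_if_bounded[OF gH])
    fix u assume u: "u \<in> domT"
    have "(\<lambda>n. ip (E' (C n) g) (A u)) \<longlonglongrightarrow> ip g (A u)"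
      using E'.E_truncation[OF gH] gH u C unfolding C_def by (intro tendsto_ip) auto
    moreover have "ip (E' (C n) g) (A u) \<le> sqrt (enn2real M) * nrm u" for n
    proof -
      have "ip (E' (C n) g) (A u) = ip (B (E' (C n) g)) u" using mem u adj' by simp
      also have "\<dots> \<le> nrm (B (E' (C n) g)) * nrm u" using mem u by (intro ip_le_nrm) auto
      also have "\<dots> \<le> sqrt (enn2real M) * nrm u" using bound u by (intro mult_right_mono) auto
      finally show ?thesis .
    qed
    ultimately have "ip g (A u) \<le> sqrt (enn2real M) * nrm u" by (intro LIMSEQ_le_const2) auto
    then show "ip (A u) g \<le> sqrt (enn2real M) * nrm u" using ip_commute[of "A u" g] u gH by simp
  qed
qed

text \<open>\<open>density_B\<close> and then \<open>density_A\<close> absorb one factor x each, so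
  the second moment of \<open>y\<close> is \<open>|A B y|^2\<close>.\<close>

lemma domT'_sd:
  assumes y: "y \<in> d.domT" shows "y \<in> E'.sd"
proof -
  have "(\<integral>\<^sup>+x. ennreal (x\<^sup>2) \<partial>E'.\<mu> y) = (\<integral>\<^sup>+x. ennreal x * ennreal x \<partial>E'.\<mu> y)"
    using density_B(1)[of y] y
    by (intro nn_integral_cong_AE) (auto simp: power2_eq_square ennreal_mult elim: eventually_mono)
  also have "\<dots> = (\<integral>\<^sup>+x. ennreal x \<partial>\<mu> (B y))"
    using density_B(2)[of y] y by (simp add: nn_integral_density)
  also have "\<dots> = emeasure (E'.\<mu> (A (B y))) UNIV"
    using density_A(2)[of "B y"] y by (simp add: emeasure_density)
  also have "\<dots> < \<infinity>" using y by (simp add: E'.emeasure_\<mu>)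
  finally show ?thesis using y by (simp add: E'.sd_iff)
qed

text \<open>Both descriptions are the weak equation for the form \<open><B f, B g>\<close>. The test
  spaces agree well enough because \<open>sd\<close> of \<open>E'\<close> lies in \<open>DB\<close>
  and contains the core of \<open>B\<close>.\<close>

lemma spectral_E': "spectral_measure_of H ip T' E'"
  unfolding E'.spectral_measure_of_iff
proof safe
  fix f h assume "(f, h) \<in> T'"
  then have f: "f \<in> d.domT" "h = A (B f)" by (auto simp: d.T_iff)
  show "f \<in> E'.sd" using f domT'_sd by simp
  show "h \<in> H" using f by simp
  fix g assume "g \<in> E'.sd"
  then have g: "g \<in> DB" using sd_E'_subset_DB by blast
  then show "ip h g = E'.polar f g" using f by (simp add: polar_B d.ip_domT)
next
  fix f h assume f: "f \<in> E'.sd" and h: "h \<in> H" and eq: "\<forall>g\<in>E'.sd. ip h g = E'.polar f g"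
  have fD: "f \<in> DB" using f sd_E'_subset_DB by blast
  show "(f, h) \<in> T'"
    by (rule d.comp_graph_memI[OF fD h]) (use eq fD domT'_sd in \<open>simp add: polar_B\<close>)
qed

text \<open>\<open>\<Phi>\<close> is a condition on the family of Borel sets that annihilate a
  vector. \<open>A\<close>, \<open>B\<close> and \<open>(1 + B A)^{-1}\<close> can only enlarge this
  family, so an upward closed \<open>\<Phi>\<close> fits \<open>resolvent_transfer\<close>;
  \<open>\<Phi>_Int\<close> takes care of sums.\<close>

lemma spectrum_part:
  assumes \<Phi>_mono: "\<And>\<N> \<M> :: real set set. \<Phi> \<N> \<Longrightarrow> \<N> \<subseteq> \<M> \<Longrightarrow> \<Phi> \<M>"
    and \<Phi>_Int: "\<And>f g. f \<in> H \<Longrightarrow> g \<in> H \<Longrightarrow> \<Phi> {C \<in> sets borel. E C f = 0} \<Longrightarrow>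
      \<Phi> {C \<in> sets borel. E C g = 0} \<Longrightarrow> \<Phi> {C \<in> sets borel. E C f = 0 \<and> E C g = 0}"
    and H1: "H1 = {f \<in> H. \<Phi> {C \<in> sets borel. E C f = 0}}"
    and H2: "H2 = {f \<in> H. \<Phi> {C \<in> sets borel. E' C f = 0}}"
    and z: "z \<noteq> 0" "z \<in> spectrum H1 ip (T \<inter> H1 \<times> H1)"
  shows "z \<in> spectrum H2 ip (T' \<inter> H2 \<times> H2)"
proof -
  have H1I: "g \<in> H1" if "f \<in> H1" "g \<in> H" "\<And>C. C \<in> sets borel \<Longrightarrow> E C f = 0 \<Longrightarrow> E C g = 0" for f g
    using that \<Phi>_mono[of "{C \<in> sets borel. E C f = 0}" "{C \<in> sets borel. E C g = 0}"]
    unfolding H1 by blast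
  have "z \<in> resolvent_set H1 ip (T \<inter> H1 \<times> H1)" if "z \<in> resolvent_set H2 ip (T' \<inter> H2 \<times> H2)"
  proof (rule resolvent_transfer[OF z(1) _ _ _ _ _ _ _ that])
    show "H1 \<subseteq> H" "H2 \<subseteq> H" using H1 H2 by auto
    fix f g assume fg: "f \<in> H1" "g \<in> H1"
    have H: "f \<in> H" "g \<in> H" using fg H1 by auto
    have "\<Phi> {C \<in> sets borel. E C f = 0 \<and> E C g = 0}" using fg H by (intro \<Phi>_Int) (auto simp: H1)
    then have "\<Phi> {C \<in> sets borel. E C (f + g) = 0}"
      by (rule \<Phi>_mono) (use H in \<open>auto simp: E_add\<close>)
    then show "f + g \<in> H1" using H H1 by simp
  next
    fix c f assume f: "f \<in> H1"
    then have "f \<in> H" using H1 by blast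
    then show "c *\<^sub>R f \<in> H1" by (intro H1I[OF f]) (simp_all add: E_scale)
  next
    fix w assume w: "w \<in> domT" and g: "w + B (A w) \<in> H1"
    show "w \<in> H1"
    proof (rule H1I[OF g])
      fix C :: "real set" assume C: "C \<in> sets borel" and zero: "E C (w + B (A w)) = 0"
      \<comment> \<open>\<open>E C w\<close> solves the homogeneous equation for
        \<open>1 + B A\<close>, which is injective by \<open>von_neumann_norm\<close>.\<close>
      have "E C w + B (A (E C w)) = 0" using zero w C E_domT(2)[OF w C] by (simp add: E_add)
      then have "nrm (E C w) \<le> 0" using von_neumann_norm(1)[OF E_domT(1)[OF w C]] by simp
      then show "E C w = 0" using w C by (metis DA_mem E_mem domTD(1) nrm_eq_0 nrm_nonneg order_antisym)
    qed (use w in simp)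
  next
    fix w assume w: "w \<in> DA" "w \<in> H1"
    have "\<Phi> {C \<in> sets borel. E' C (A w) = 0}"
    proof (rule \<Phi>_mono[of "{C \<in> sets borel. E C w = 0}"])
      show "\<Phi> {C \<in> sets borel. E C w = 0}" using w H1 by simp
      have "E' C (A w) = 0" if "C \<in> sets borel" "E C w = 0" for C
        using A_E(2)[OF w(1) that(1)] that by simp
      then show "{C \<in> sets borel. E C w = 0} \<subseteq> {C \<in> sets borel. E' C (A w) = 0}" by blast
    qed
    then show "A w \<in> H2" using w H2 by simp
  next
    fix y assume y: "y \<in> DB" "y \<in> H2"
    have "\<Phi> {C \<in> sets borel. E C (B y) = 0}"
    proof (rule \<Phi>_mono[of "{C \<in> sets borel. E' C y = 0}"])
      show "\<Phi> {C \<in> sets borel. E' C y = 0}" using y H2 by simp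
      have "E C (B y) = 0" if "C \<in> sets borel" "E' C y = 0" for C
        using B_E'(2)[OF y(1) that(1)] that by simp
      then show "{C \<in> sets borel. E' C y = 0} \<subseteq> {C \<in> sets borel. E C (B y) = 0}" by blast
    qed
    then show "B y \<in> H1" using y H1 by simp
  qed
  then show ?thesis using z by (auto simp: spectrum_def)
qed

lemma pure_point_part:
  assumes "z \<noteq> 0" "z \<in> spectrum (pp_subspace H ip E) ip (T \<inter> pp_subspace H ip E \<times> pp_subspace H ip E)"
  shows "z \<in> pure_point_spectrum H ip T'"
proof -
  let ?\<Phi> = "\<lambda>\<N>. \<exists>S. countable S \<and> - S \<in> \<N>"
  have borel: "- S \<in> sets borel" if "countable S" for S :: "real set"
    using countable_imp_null_set_lborel[OF that] by auto
  have "z \<in> spectrum (pp_subspace H ip E') ip (T' \<inter> pp_subspace H ip E' \<times> pp_subspace H ip E')"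
  proof (rule spectrum_part[of ?\<Phi>, OF _ _ _ _ assms])
    show "pp_subspace H ip E = {f \<in> H. ?\<Phi> {C \<in> sets borel. E C f = 0}}"
      using borel by (intro set_eqI, unfold pp_subspace_iff mem_Collect_eq) blast
    show "pp_subspace H ip E' = {f \<in> H. ?\<Phi> {C \<in> sets borel. E' C f = 0}}"
      using borel by (intro set_eqI, unfold E'.pp_subspace_iff mem_Collect_eq) blast
    fix f g assume H: "f \<in> H" "g \<in> H" and "?\<Phi> {C \<in> sets borel. E C f = 0}"
      "?\<Phi> {C \<in> sets borel. E C g = 0}"
    then obtain S S' where S: "countable S" "- S \<in> sets borel" "E (- S) f = 0"
      "countable S'" "- S' \<in> sets borel" "E (- S') g = 0" by blast
    have "countable (S \<union> S')" using S by simp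
    moreover have "E (- (S \<union> S')) f = 0" "E (- (S \<union> S')) g = 0"
      using S H borel[OF \<open>countable (S \<union> S')\<close>]
      by (auto intro: E_null_mono[of _ "- S"] E_null_mono[of _ "- S'"])
    ultimately show "?\<Phi> {C \<in> sets borel. E C f = 0 \<and> E C g = 0}" using borel by blast
  qed blast
  then show ?thesis using spectral_E' unfolding pure_point_spectrum_def by blast
qed

lemma ac_part:
  assumes "z \<noteq> 0" "z \<in> spectrum (ac_subspace H ip E) ip (T \<inter> ac_subspace H ip E \<times> ac_subspace H ip E)"
  shows "z \<in> ac_spectrum H ip T'"
proof -
  let ?\<Phi> = "\<lambda>\<N>. null_sets lborel \<subseteq> \<N>"
  have "z \<in> spectrum (ac_subspace H ip E') ip (T' \<inter> ac_subspace H ip E' \<times> ac_subspace H ip E')"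
    by (rule spectrum_part[of ?\<Phi>, OF _ _ _ _ assms])
      (auto simp: ac_subspace_iff E'.ac_subspace_iff)
  then show ?thesis using spectral_E' unfolding ac_spectrum_def by blast
qed

lemma sc_part:
  assumes "z \<noteq> 0" "z \<in> spectrum (sc_subspace H ip E) ip (T \<inter> sc_subspace H ip E \<times> sc_subspace H ip E)"
  shows "z \<in> sc_spectrum H ip T'"
proof -
  let ?\<Phi> = "\<lambda>\<N>. (\<forall>x. {x} \<in> \<N>) \<and> (\<exists>N\<in>null_sets lborel. - N \<in> \<N>)"
  have borel: "- N \<in> sets borel" if "N \<in> null_sets lborel" for N :: "real set"
    using that by auto
  have "z \<in> spectrum (sc_subspace H ip E') ip (T' \<inter> sc_subspace H ip E' \<times> sc_subspace H ip E')"
  proof (rule spectrum_part[of ?\<Phi>, OF _ _ _ _ assms])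
    have sets: "{x} \<in> sets borel" for x :: real by simp
    show "sc_subspace H ip E = {f \<in> H. ?\<Phi> {C \<in> sets borel. E C f = 0}}"
      by (intro set_eqI, unfold sc_subspace_iff mem_Collect_eq, intro conj_cong refl all_cong bex_cong)
        (simp_all only: sets borel simp_thms)
    show "sc_subspace H ip E' = {f \<in> H. ?\<Phi> {C \<in> sets borel. E' C f = 0}}"
      by (intro set_eqI, unfold E'.sc_subspace_iff mem_Collect_eq, intro conj_cong refl all_cong bex_cong)
        (simp_all only: sets borel simp_thms)
    fix f g assume H: "f \<in> H" "g \<in> H" and \<Phi>: "?\<Phi> {C \<in> sets borel. E C f = 0}"
      "?\<Phi> {C \<in> sets borel. E C g = 0}"
    then obtain N N' where N: "N \<in> null_sets lborel" "E (- N) f = 0"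
      "N' \<in> null_sets lborel" "E (- N') g = 0" by blast
    have U: "N \<union> N' \<in> null_sets lborel" using N by blast
    moreover have "E (- (N \<union> N')) f = 0" "E (- (N \<union> N')) g = 0"
      using N H borel[OF U] borel[OF N(1)] borel[OF N(3)]
      by (auto intro: E_null_mono[of _ "- N"] E_null_mono[of _ "- N'"])
    ultimately show "?\<Phi> {C \<in> sets borel. E C f = 0 \<and> E C g = 0}" using \<Phi> borel by blast
  qed blast
  then show ?thesis using spectral_E' unfolding sc_spectrum_def by blast
qed

end

section \<open>The five spectra of a pair by symmetry\<close>

context adjoint_pair begin

lemma spectral_pairI:
  assumes "spectral_measure_of H ip T E" shows "spectral_pair H ip DA A DB B E"
  by unfold_locales (use assms in \<open>auto simp: spectral_measure_of_def\<close>)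

lemma spectral_parts_subset:
  assumes z: "z \<noteq> 0"
  shows "z \<in> pure_point_spectrum H ip T \<Longrightarrow> z \<in> pure_point_spectrum H ip T'"
    and "z \<in> ac_spectrum H ip T \<Longrightarrow> z \<in> ac_spectrum H ip T'"
    and "z \<in> sc_spectrum H ip T \<Longrightarrow> z \<in> sc_spectrum H ip T'"
  using spectral_pair.pure_point_part[OF spectral_pairI z] spectral_pair.ac_part[OF spectral_pairI z]
    spectral_pair.sc_part[OF spectral_pairI z]
  by (auto simp: pure_point_spectrum_def[of H ip T] ac_spectrum_def[of H ip T] sc_spectrum_def[of H ip T])

theorem spectra_eq:
  assumes "spec \<in> {spectrum, essential_spectrum, pure_point_spectrum, ac_spectrum, sc_spectrum}"
  shows "spec H ip T - {0} = spec H ip T' - {0}"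
proof -
  note parts = spectral_parts_subset adjoint_pair.spectral_parts_subset[OF dual]
  have "pure_point_spectrum H ip T - {0} = pure_point_spectrum H ip T' - {0}"
    using parts(1,4) by blast
  moreover have "ac_spectrum H ip T - {0} = ac_spectrum H ip T' - {0}"
    using parts(2,5) by blast
  moreover have "sc_spectrum H ip T - {0} = sc_spectrum H ip T' - {0}"
    using parts(3,6) by blast
  ultimately show ?thesis
    using assms spectrum_eq essential_spectrum_eq by (elim insertE emptyE) simp_all
qed

end

section \<open>Square summable functions and formally adjoint operators\<close>

text \<open>The polarized form is \<open><A h, A f>\<close>, so the form operator asks for
  \<open>A f\<close> in the domain of the adjoint of \<open>A\<close>, with value \<open>g\<close>;
  that adjoint is \<open>B\<close>.\<close>

lemma (in adjoint_pair) form_operator_eq: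
  assumes Q: "\<And>f. f \<in> DA \<Longrightarrow> enn2real (Q f) = ip (A f) (A f)"
  shows "form_operator H ip DA Q = T"
proof -
  have polar: "(enn2real (Q (f + h)) - enn2real (Q (f - h))) / 4 = ip (A h) (A f)"
    if "f \<in> DA" "h \<in> DA" for f h
    using that ip_commute[of "A f" "A h"]
    by (simp add: Q ip_add_left ip_add_right ip_diff_left ip_diff_right)
  have "(f, g) \<in> form_operator H ip DA Q \<longleftrightarrow> (f, g) \<in> T" for f g
  proof -
    have "(f, g) \<in> form_operator H ip DA Q \<longleftrightarrow>
        f \<in> DA \<and> g \<in> H \<and> (\<forall>h\<in>DA. ip (A h) (A f) = ip h g)"
      using polar ip_commute[of g] by (auto simp: form_operator_def)
    also have "\<dots> \<longleftrightarrow> f \<in> DA \<and> g \<in> H \<and> A f \<in> DB \<and> B (A f) = g"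
      using adj1[of "A f" g] by auto
    also have "\<dots> \<longleftrightarrow> (f, g) \<in> T" by (auto simp: comp_graph_def)
    finally show ?thesis .
  qed
  then show ?thesis by auto
qed

lemma summable_on_real_comparison:
  fixes f g :: "'a \<Rightarrow> real"
  assumes "g summable_on A" "\<And>x. x \<in> A \<Longrightarrow> \<bar>f x\<bar> \<le> g x" shows "f summable_on A"
proof -
  have "(\<lambda>x. norm (g x)) summable_on A"
    using assms(1) by (subst (asm) summable_on_iff_abs_summable_on_real) simp
  then have "(\<lambda>x. norm (f x)) summable_on A"
    by (rule Infinite_Sum.abs_summable_on_comparison_test) (use assms(2) in fastforce)
  then show ?thesis by (rule abs_summable_summable)
qed

text \<open>A divergent real sum has the default value 0, while the \<open>ennreal\<close> sum is
  then \<open>\<infinity>\<close>; finiteness in \<open>ennreal\<close> therefore certifies real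
  summability.\<close>

lemma infsum_ennreal_eq:
  fixes f :: "'a \<Rightarrow> real"
  assumes nn: "\<And>x. x \<in> A \<Longrightarrow> 0 \<le> f x"
  shows "f summable_on A \<Longrightarrow> (\<Sum>\<^sub>\<infinity>x\<in>A. ennreal (f x)) = ennreal (\<Sum>\<^sub>\<infinity>x\<in>A. f x)"
    and "(\<Sum>\<^sub>\<infinity>x\<in>A. ennreal (f x)) < \<infinity> \<Longrightarrow> f summable_on A"
proof -
  have fin: "(\<Sum>x\<in>F. ennreal (f x)) = ennreal (sum f F)" if "F \<subseteq> A" for F
    using nn that by (intro sum_ennreal) auto
  show "(\<Sum>\<^sub>\<infinity>x\<in>A. ennreal (f x)) = ennreal (\<Sum>\<^sub>\<infinity>x\<in>A. f x)" if "f summable_on A"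
    using infsum_nonneg_is_SUPREMUM_ennreal[OF that nn] fin
    by (subst nonneg_infsum_complete) (auto intro!: SUP_cong)
  assume lt: "(\<Sum>\<^sub>\<infinity>x\<in>A. ennreal (f x)) < \<infinity>"
  show "f summable_on A"
  proof (rule nonneg_bdd_above_summable_on)
    show "bdd_above (sum f ` {F. F \<subseteq> A \<and> finite F})"
    proof (rule bdd_aboveI2)
      fix F assume F: "F \<in> {F. F \<subseteq> A \<and> finite F}"
      then have "ennreal (sum f F) \<le> (\<Sum>\<^sub>\<infinity>x\<in>A. ennreal (f x))"
        using fin by (subst nonneg_infsum_complete) (auto intro!: SUP_upper2[of F])
      also have "\<dots> = ennreal (enn2real (\<Sum>\<^sub>\<infinity>x\<in>A. ennreal (f x)))" using lt by simp
      finally show "sum f F \<le> enn2real (\<Sum>\<^sub>\<infinity>x\<in>A. ennreal (f x))"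
        by (subst (asm) ennreal_le_iff) auto
    qed
  qed (rule nn)
qed

locale weighted =
  fixes X :: "'a set set" and m :: "'a set \<Rightarrow> real"
  assumes m_pos: "\<sigma> \<in> X \<Longrightarrow> 0 < m \<sigma>"
begin

abbreviation "L2 \<equiv> ell2 X m"
abbreviation "ip \<equiv> ell2_inner X m"

lemma m_nonneg: "\<sigma> \<in> X \<Longrightarrow> 0 \<le> m \<sigma>"
  using m_pos less_imp_le by blast

lemma ell2_iff: "f \<in> L2 \<longleftrightarrow> f \<in> Fun X \<and> (\<lambda>\<sigma>. m \<sigma> * (f \<sigma>)\<^sup>2) summable_on X"
proof -
  have nn: "0 \<le> m \<sigma> * (f \<sigma>)\<^sup>2" if "\<sigma> \<in> X" for \<sigma> using m_nonneg[OF that] by simp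
  show ?thesis
    using infsum_ennreal_eq[of X "\<lambda>\<sigma>. m \<sigma> * (f \<sigma>)\<^sup>2", OF nn]
    by (auto simp: ell2_def norm_sq_def)
qed

lemma ip_self: "ip f f = (\<Sum>\<^sub>\<infinity>\<sigma>\<in>X. m \<sigma> * (f \<sigma>)\<^sup>2)"
  by (simp add: ell2_inner_def power2_eq_square mult.assoc)

lemma norm_sq_eq: "f \<in> L2 \<Longrightarrow> norm_sq X m f = ennreal (ip f f)"
  using infsum_ennreal_eq(1)[of X "\<lambda>\<sigma>. m \<sigma> * (f \<sigma>)\<^sup>2"] m_nonneg
  by (simp add: norm_sq_def ip_self ell2_iff)

lemma summable_product:
  assumes "f \<in> L2" "g \<in> L2" shows "(\<lambda>\<sigma>. m \<sigma> * f \<sigma> * g \<sigma>) summable_on X"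
proof (rule summable_on_real_comparison)
  show "(\<lambda>\<sigma>. m \<sigma> * (f \<sigma>)\<^sup>2 + m \<sigma> * (g \<sigma>)\<^sup>2) summable_on X"
    using assms by (intro summable_on_add) (auto simp: ell2_iff)
  fix \<sigma> assume "\<sigma> \<in> X"
  then have m: "0 \<le> m \<sigma>" by (rule m_nonneg)
  have "0 \<le> (\<bar>f \<sigma>\<bar> - \<bar>g \<sigma>\<bar>)\<^sup>2" by simp
  then have "2 * \<bar>f \<sigma> * g \<sigma>\<bar> \<le> (f \<sigma>)\<^sup>2 + (g \<sigma>)\<^sup>2" by (simp add: power2_diff abs_mult)
  then have "\<bar>f \<sigma> * g \<sigma>\<bar> \<le> (f \<sigma>)\<^sup>2 + (g \<sigma>)\<^sup>2" by linarith
  then have "m \<sigma> * \<bar>f \<sigma> * g \<sigma>\<bar> \<le> m \<sigma> * ((f \<sigma>)\<^sup>2 + (g \<sigma>)\<^sup>2)" by (rule mult_left_mono[OF _ m])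
  then show "\<bar>m \<sigma> * f \<sigma> * g \<sigma>\<bar> \<le> m \<sigma> * (f \<sigma>)\<^sup>2 + m \<sigma> * (g \<sigma>)\<^sup>2"
    using m by (simp add: abs_mult algebra_simps)
qed

lemma ell2_zero: "0 \<in> L2"
  by (simp add: ell2_iff Fun_def)

lemma ell2_scale: "f \<in> L2 \<Longrightarrow> c *\<^sub>R f \<in> L2"
  using summable_on_cmult_right[of "\<lambda>\<sigma>. m \<sigma> * (f \<sigma>)\<^sup>2" X "c\<^sup>2"]
  by (auto simp: ell2_iff Fun_def scaleR_fun_def power_mult_distrib mult.left_commute)

lemma ell2_add:
  assumes "f \<in> L2" "g \<in> L2" shows "f + g \<in> L2"
proof -
  have "(\<lambda>\<sigma>. m \<sigma> * (f \<sigma>)\<^sup>2 + m \<sigma> * (g \<sigma>)\<^sup>2 + 2 * (m \<sigma> * f \<sigma> * g \<sigma>)) summable_on X"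
    using assms
    by (intro summable_on_add summable_on_cmult_right summable_product) (auto simp: ell2_iff)
  then show ?thesis
    using assms by (auto simp: ell2_iff Fun_def power2_sum algebra_simps)
qed

lemma single_le:
  assumes "f \<in> L2" "\<sigma> \<in> X" shows "m \<sigma> * (f \<sigma>)\<^sup>2 \<le> ip f f"
  using finite_sum_le_infsum[of "\<lambda>\<sigma>. m \<sigma> * (f \<sigma>)\<^sup>2" X "{\<sigma>}"] assms m_nonneg
  by (simp add: ip_self ell2_iff)

text \<open>Positive weights make norm-Cauchy sequences converge at each simplex. The norm distance
  to the limit is controlled through finite partial sums, in which the second index can go to
  infinity.\<close>

lemma ell2_complete:
  fixes u :: "nat \<Rightarrow> 'a set \<Rightarrow> real"
  assumes u: "\<And>n. u n \<in> L2"
    and Cau: "\<And>e. e > 0 \<Longrightarrow> \<exists>N. \<forall>i\<ge>N. \<forall>j\<ge>N. hnorm ip (u i - u j) < e"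
  shows "\<exists>l\<in>L2. (\<lambda>n. hnorm ip (u n - l)) \<longlonglongrightarrow> 0"
proof -
  have diff: "f - g \<in> L2" if "f \<in> L2" "g \<in> L2" for f g
    using ell2_add[OF that(1) ell2_scale[OF that(2), of "-1"]] by simp
  have nn: "0 \<le> ip f f" for f
    unfolding ip_self by (intro infsum_nonneg) (simp add: m_nonneg)
  have conv: "convergent (\<lambda>n. u n \<sigma>)" if \<sigma>: "\<sigma> \<in> X" for \<sigma>
  proof (rule Cauchy_convergent, rule metric_CauchyI)
    fix e :: real assume e: "0 < e"
    \<comment> \<open>Scaled because evaluation at \<open>\<sigma>\<close> costs a factor
      \<open>1 / sqrt (m \<sigma>)\<close>.\<close>
    then have "0 < sqrt (m \<sigma>) * e" using m_pos[OF \<sigma>] by simp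
    then obtain N where N: "\<And>i j. i \<ge> N \<Longrightarrow> j \<ge> N \<Longrightarrow> hnorm ip (u i - u j) < sqrt (m \<sigma>) * e"
      using Cau by blast
    have "dist (u i \<sigma>) (u j \<sigma>) < e" if "i \<ge> N" "j \<ge> N" for i j
    proof -
      have "sqrt (m \<sigma> * (u i \<sigma> - u j \<sigma>)\<^sup>2) \<le> hnorm ip (u i - u j)"
        using single_le[OF diff[OF u u] \<sigma>, of i j] by (simp add: hnorm_def)
      also have "\<dots> < sqrt (m \<sigma>) * e" using N that by blast
      finally show ?thesis using m_pos[OF \<sigma>] by (simp add: real_sqrt_mult dist_real_def)
    qed
    then show "\<exists>N. \<forall>i\<ge>N. \<forall>j\<ge>N. dist (u i \<sigma>) (u j \<sigma>) < e" by blast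
  qed
  define l where "l \<sigma> = (if \<sigma> \<in> X then lim (\<lambda>n. u n \<sigma>) else 0)" for \<sigma>
  have lim: "(\<lambda>n. u n \<sigma>) \<longlonglongrightarrow> l \<sigma>" if "\<sigma> \<in> X" for \<sigma>
    using conv[OF that] that by (simp add: l_def convergent_LIMSEQ_iff)
  have close: "u n - l \<in> L2 \<and> hnorm ip (u n - l) \<le> e"
    if e: "0 < e" and N: "\<And>i j. i \<ge> N \<Longrightarrow> j \<ge> N \<Longrightarrow> hnorm ip (u i - u j) < e" and n: "n \<ge> N" for e N n
  proof -
    have fin: "(\<Sum>\<sigma>\<in>F. m \<sigma> * (u n \<sigma> - l \<sigma>)\<^sup>2) \<le> e\<^sup>2" if F: "finite F" "F \<subseteq> X" for F
    proof -
      have "(\<lambda>i. \<Sum>\<sigma>\<in>F. m \<sigma> * (u n \<sigma> - u i \<sigma>)\<^sup>2) \<longlonglongrightarrow> (\<Sum>\<sigma>\<in>F. m \<sigma> * (u n \<sigma> - l \<sigma>)\<^sup>2)"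
        using F by (intro tendsto_intros lim) auto
      moreover have "(\<Sum>\<sigma>\<in>F. m \<sigma> * (u n \<sigma> - u i \<sigma>)\<^sup>2) \<le> e\<^sup>2" if i: "i \<ge> N" for i
      proof -
        have "(\<Sum>\<sigma>\<in>F. m \<sigma> * (u n \<sigma> - u i \<sigma>)\<^sup>2) \<le> ip (u n - u i) (u n - u i)"
          unfolding ip_self using finite_sum_le_infsum[of "\<lambda>\<sigma>. m \<sigma> * ((u n - u i) \<sigma>)\<^sup>2" X F]
            diff[OF u u, of n i] F m_nonneg by (simp add: ell2_iff)
        also have "\<dots> = (hnorm ip (u n - u i))\<^sup>2" using nn by (simp add: hnorm_def)
        also have "\<dots> \<le> e\<^sup>2"
          using N[OF n i] nn by (intro power_mono) (auto simp: hnorm_def)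
        finally show ?thesis .
      qed
      ultimately show ?thesis by (intro LIMSEQ_le_const2) auto
    qed
    have sum: "(\<lambda>\<sigma>. m \<sigma> * (u n \<sigma> - l \<sigma>)\<^sup>2) summable_on X"
      by (rule nonneg_bdd_above_summable_on) (auto simp: m_nonneg intro!: bdd_aboveI2 fin)
    have "u n \<in> Fun X" using u[of n] by (simp add: ell2_iff)
    then have mem: "u n - l \<in> L2" using sum by (simp add: ell2_iff Fun_def l_def)
    have "ip (u n - l) (u n - l) \<le> e\<^sup>2"
      unfolding ip_self using sum fin by (intro infsum_le_finite_sums) auto
    then have "hnorm ip (u n - l) \<le> e" using e by (simp add: hnorm_def real_le_lsqrt)
    then show ?thesis using mem by simp
  qed
  have "l \<in> L2"
  proof -
    obtain N where N: "\<And>i j. i \<ge> N \<Longrightarrow> j \<ge> N \<Longrightarrow> hnorm ip (u i - u j) < 1"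
      using Cau[of 1] by auto
    have "u N - l \<in> L2" using close[OF _ N, of N] by simp
    then have "u N - (u N - l) \<in> L2" by (rule diff[OF u])
    then show ?thesis by simp
  qed
  moreover have "(\<lambda>n. hnorm ip (u n - l)) \<longlonglongrightarrow> 0"
  proof (rule LIMSEQ_I)
    fix e :: real assume e: "0 < e"
    then obtain N where N: "\<And>i j. i \<ge> N \<Longrightarrow> j \<ge> N \<Longrightarrow> hnorm ip (u i - u j) < e / 2"
      using Cau[of "e / 2"] by auto
    have "norm (hnorm ip (u n - l) - 0) < e" if "n \<ge> N" for n
    proof -
      have "hnorm ip (u n - l) \<le> e / 2" using close[OF _ N that] e by simp
      moreover have "0 \<le> hnorm ip (u n - l)" using nn by (simp add: hnorm_def)
      ultimately show ?thesis using e by simp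
    qed
    then show "\<exists>N. \<forall>n\<ge>N. norm (hnorm ip (u n - l) - 0) < e" by blast
  qed
  ultimately show ?thesis by blast
qed

sublocale hilbert L2 ip
proof
  show "subspace L2" by (simp add: subspace_def ell2_zero ell2_add ell2_scale)
  show "ip f g = ip g f" for f g by (simp add: ell2_inner_def mult.commute mult.left_commute)
  show "ip (f + g) h = ip f h + ip g h" if "f \<in> L2" "g \<in> L2" "h \<in> L2" for f g h
    using infsum_add[OF summable_product[OF that(1,3)] summable_product[OF that(2,3)]]
    by (simp add: ell2_inner_def algebra_simps)
  show "ip (c *\<^sub>R f) g = c * ip f g" for c f g
    by (simp add: ell2_inner_def scaleR_fun_def ac_simps flip: infsum_cmult_right')
  show "0 < ip f f" if f: "f \<in> L2" "f \<noteq> 0" for f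
  proof -
    obtain \<sigma> where "f \<sigma> \<noteq> 0" using f(2) by (auto simp: fun_eq_iff)
    moreover have "\<sigma> \<in> X" using calculation f(1) by (auto simp: ell2_iff Fun_def)
    ultimately show ?thesis
      using single_le[OF f(1), of \<sigma>] m_pos[of \<sigma>]
      by (metis less_le_trans mult_pos_pos zero_less_power2)
  qed
qed (rule ell2_complete)

lemma indicator_eq: "indicator {\<tau>} = (\<lambda>\<sigma>. if \<sigma> = \<tau> then 1 else (0::real))"
  by (auto simp: indicator_def)

lemma indicator_Fun_c: "\<tau> \<in> X \<Longrightarrow> indicator {\<tau>} \<in> Fun_c X"
  by (auto simp: Fun_c_def Fun_def indicator_eq)

lemma infsum_support:
  fixes h :: "'a set \<Rightarrow> real"
  assumes "F \<subseteq> X" "\<And>\<sigma>. \<sigma> \<in> X - F \<Longrightarrow> h \<sigma> = 0"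
  shows "infsum h X = infsum h F" "h summable_on F \<Longrightarrow> h summable_on X"
  using assms by (auto intro!: infsum_cong_neutral intro: summable_on_cong_neutral[THEN iffD1, rotated -1])

lemma Fun_c_subset: "Fun_c X \<subseteq> L2"
proof
  fix \<phi> assume \<phi>: "\<phi> \<in> Fun_c X"
  have "(\<lambda>\<sigma>. m \<sigma> * (\<phi> \<sigma>)\<^sup>2) summable_on X"
    by (rule infsum_support(2)[of "{\<sigma>. \<phi> \<sigma> \<noteq> 0}"]) (use \<phi> in \<open>auto simp: Fun_c_def Fun_def\<close>)
  then show "\<phi> \<in> L2" using \<phi> by (simp add: ell2_iff Fun_c_def)
qed

lemma indicator_L2 [simp]: "\<tau> \<in> X \<Longrightarrow> indicator {\<tau>} \<in> L2"
  using indicator_Fun_c Fun_c_subset by blast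

lemma ip_indicator: "\<tau> \<in> X \<Longrightarrow> ip (indicator {\<tau>}) f = m \<tau> * f \<tau>"
  unfolding ell2_inner_def by (subst infsum_support(1)[of "{\<tau>}"]) (auto simp: indicator_eq)

lemma Fun_eqI: "f \<in> Fun X \<Longrightarrow> g \<in> Fun X \<Longrightarrow> (\<And>\<sigma>. \<sigma> \<in> X \<Longrightarrow> m \<sigma> * f \<sigma> = m \<sigma> * g \<sigma>) \<Longrightarrow> f = g"
  using m_pos unfolding Fun_def fun_eq_iff
  by (metis (mono_tags, lifting) less_irrefl mem_Collect_eq mult_left_cancel)

lemma L2_Fun: "f \<in> L2 \<Longrightarrow> f \<in> Fun X"
  by (simp add: ell2_iff)

end

text \<open>Adjointness is stated against indicators of single simplices only. The operators act on
  all of \<open>L2\<close>, with values that may leave it.\<close>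

locale formal_adjoint = weighted X m
  for X :: "'a set set" and m +
  fixes a b :: "('a set \<Rightarrow> real) \<Rightarrow> 'a set \<Rightarrow> real" and Qa Qb :: "('a set \<Rightarrow> real) \<Rightarrow> ennreal"
  assumes a_Fun: "f \<in> L2 \<Longrightarrow> a f \<in> Fun X" and b_Fun: "f \<in> L2 \<Longrightarrow> b f \<in> Fun X"
    and a_add: "f \<in> L2 \<Longrightarrow> g \<in> L2 \<Longrightarrow> a (f + g) = a f + a g"
    and a_scale: "f \<in> L2 \<Longrightarrow> a (c *\<^sub>R f) = c *\<^sub>R a f"
    and b_add: "f \<in> L2 \<Longrightarrow> g \<in> L2 \<Longrightarrow> b (f + g) = b f + b g"
    and b_scale: "f \<in> L2 \<Longrightarrow> b (c *\<^sub>R f) = c *\<^sub>R b f"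
    and a_indicator: "\<tau> \<in> X \<Longrightarrow> a (indicator {\<tau>}) \<in> L2"
    and b_indicator: "\<tau> \<in> X \<Longrightarrow> b (indicator {\<tau>}) \<in> L2"
    and ip_a: "\<tau> \<in> X \<Longrightarrow> f \<in> L2 \<Longrightarrow> ip (a (indicator {\<tau>})) f = m \<tau> * b f \<tau>"
    and ip_b: "\<tau> \<in> X \<Longrightarrow> f \<in> L2 \<Longrightarrow> ip (b (indicator {\<tau>})) f = m \<tau> * a f \<tau>"
    and Qa: "f \<in> L2 \<Longrightarrow> Qa f = norm_sq X m (a f)"
    and Qb: "f \<in> L2 \<Longrightarrow> Qb f = norm_sq X m (b f)"
begin

lemma a_diff: "f \<in> L2 \<Longrightarrow> g \<in> L2 \<Longrightarrow> a (f - g) = a f - a g"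
  using a_add[of f "(-1) *\<^sub>R g"] a_scale[of g "-1"] by simp

text \<open>Induction on the support reduces the pairing to single simplices, where
  \<open>ip_a\<close> applies.\<close>

lemma a_Fun_c:
  assumes "\<phi> \<in> Fun_c X"
  shows "a \<phi> \<in> L2 \<and> (\<forall>f\<in>L2. b f \<in> L2 \<longrightarrow> ip (a \<phi>) f = ip \<phi> (b f))"
proof -
  have "a \<phi> \<in> L2 \<and> (\<forall>f\<in>L2. b f \<in> L2 \<longrightarrow> ip (a \<phi>) f = ip \<phi> (b f))"
    if "finite F" "F \<subseteq> X" "\<phi> \<in> Fun X" "{\<sigma>. \<phi> \<sigma> \<noteq> 0} \<subseteq> F" for F \<phi>
    using that
  proof (induction F arbitrary: \<phi>)
    case empty
    then have "\<phi> = 0" by (auto simp: fun_eq_iff)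
    moreover have "a 0 = 0" using a_scale[of 0 0] by simp
    ultimately have "\<phi> = 0" "a \<phi> = 0" by simp_all
    then show ?case by (metis ip_zero_left zero_mem)
  next
    case (insert \<tau> F)
    define \<psi> where "\<psi> = \<phi>(\<tau> := 0)"
    have \<tau>: "\<tau> \<in> X" using insert by simp
    have "\<psi> \<in> Fun X" "{\<sigma>. \<psi> \<sigma> \<noteq> 0} \<subseteq> F" using insert by (auto simp: \<psi>_def Fun_def)
    then have IH: "a \<psi> \<in> L2" "\<And>f. f \<in> L2 \<Longrightarrow> b f \<in> L2 \<Longrightarrow> ip (a \<psi>) f = ip \<psi> (b f)"
      using insert by auto
    have "\<psi> \<in> Fun_c X"
      using \<open>\<psi> \<in> Fun X\<close> \<open>{\<sigma>. \<psi> \<sigma> \<noteq> 0} \<subseteq> F\<close> insert(1) by (auto simp: Fun_c_def intro: finite_subset)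
    then have \<psi>: "\<psi> \<in> L2" using Fun_c_subset by blast
    have \<phi>: "\<phi> = \<psi> + \<phi> \<tau> *\<^sub>R indicator {\<tau>}"
      by (auto simp: \<psi>_def fun_eq_iff scaleR_fun_def indicator_eq)
    have a\<phi>: "a \<phi> = a \<psi> + \<phi> \<tau> *\<^sub>R a (indicator {\<tau>})"
      using \<psi> \<tau> by (subst \<phi>) (simp add: a_add a_scale)
    have "ip (a \<phi>) f = ip \<phi> (b f)" if f: "f \<in> L2" "b f \<in> L2" for f
    proof -
      have "ip (a \<phi>) f = ip \<psi> (b f) + \<phi> \<tau> * (m \<tau> * b f \<tau>)"
        unfolding a\<phi> using IH f \<tau> a_indicator[OF \<tau>]
        by (simp add: ip_add_left ip_scale_left ip_a)
      also have "\<dots> = ip (\<psi> + \<phi> \<tau> *\<^sub>R indicator {\<tau>}) (b f)"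
        using \<psi> f \<tau> by (simp add: ip_add_left ip_scale_left ip_indicator)
      finally show ?thesis using \<phi> by simp
    qed
    moreover have "a \<phi> \<in> L2" unfolding a\<phi> using IH(1) a_indicator[OF \<tau>] by simp
    ultimately show ?case by blast
  qed
  then show ?thesis using assms by (auto simp: Fun_c_def Fun_def subset_iff)
qed

lemma dom_N_b_iff: "f \<in> dom_N X m Qb \<longleftrightarrow> f \<in> L2 \<and> b f \<in> L2"
proof -
  have "b f \<in> L2 \<longleftrightarrow> norm_sq X m (b f) < \<infinity>" if "f \<in> L2"
    using b_Fun[OF that] by (simp add: ell2_def)
  then show ?thesis by (auto simp: dom_N_def Qb)
qed

lemma dom_N_a_iff: "f \<in> dom_N X m Qa \<longleftrightarrow> f \<in> L2 \<and> a f \<in> L2"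
proof -
  have "a f \<in> L2 \<longleftrightarrow> norm_sq X m (a f) < \<infinity>" if "f \<in> L2"
    using a_Fun[OF that] by (simp add: ell2_def)
  then show ?thesis by (auto simp: dom_N_def Qa)
qed

lemma dom_D_iff: "f \<in> dom_D X m Qa \<longleftrightarrow> f \<in> L2 \<and> a f \<in> L2 \<and>
    (\<forall>e>0. \<exists>\<phi>\<in>Fun_c X. ip (a f - a \<phi>) (a f - a \<phi>) + ip (f - \<phi>) (f - \<phi>) < e\<^sup>2)"
proof (cases "f \<in> L2 \<and> a f \<in> L2")
  case True
  have "Qa (f - \<phi>) + norm_sq X m (f - \<phi>) < ennreal (e\<^sup>2) \<longleftrightarrow>
      ip (a f - a \<phi>) (a f - a \<phi>) + ip (f - \<phi>) (f - \<phi>) < e\<^sup>2" if \<phi>: "\<phi> \<in> Fun_c X" for \<phi> e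
  proof -
    have mem: "\<phi> \<in> L2" "a \<phi> \<in> L2" using \<phi> Fun_c_subset a_Fun_c by auto
    then have eq: "Qa (f - \<phi>) + norm_sq X m (f - \<phi>)
        = ennreal (ip (a f - a \<phi>) (a f - a \<phi>) + ip (f - \<phi>) (f - \<phi>))"
      using True by (simp add: Qa a_diff norm_sq_eq)
    show ?thesis
      unfolding eq using True mem by (intro ennreal_less_iff add_nonneg_nonneg ip_nonneg) simp_all
  qed
  then show ?thesis using True by (simp add: dom_D_def dom_N_a_iff cong: bex_cong)
qed (auto simp: dom_D_def dom_N_a_iff)

lemma Fun_c_dom_D: "\<phi> \<in> Fun_c X \<Longrightarrow> \<phi> \<in> dom_D X m Qa"
  unfolding dom_D_iff using a_Fun_c[of \<phi>] Fun_c_subset by (auto intro!: bexI[of _ \<phi>])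

text \<open>Summation by parts holds on \<open>Fun_c\<close>, and both sides are continuous in
  \<open>u\<close> for the form norm in which \<open>dom_D\<close> is the closure.\<close>

lemma formal_adj:
  assumes u: "u \<in> dom_D X m Qa" and f: "f \<in> L2" "b f \<in> L2"
  shows "ip (a u) f = ip u (b f)"
proof -
  have uL: "u \<in> L2" "a u \<in> L2" using u by (auto simp: dom_D_iff)
  define K where "K = nrm f + nrm (b f)"
  have le: "\<bar>ip (a u) f - ip u (b f)\<bar> \<le> e * K" if e: "0 < e" for e
  proof -
    obtain \<phi> where \<phi>: "\<phi> \<in> Fun_c X" and lt: "ip (a u - a \<phi>) (a u - a \<phi>) + ip (u - \<phi>) (u - \<phi>) < e\<^sup>2"
      using u e by (auto simp: dom_D_iff)
    have mem: "\<phi> \<in> L2" "a \<phi> \<in> L2" using \<phi> Fun_c_subset a_Fun_c by auto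
    have mem': "a u - a \<phi> \<in> L2" "u - \<phi> \<in> L2" using mem uL by simp_all
    have "ip (a u - a \<phi>) (a u - a \<phi>) \<le> e\<^sup>2" "ip (u - \<phi>) (u - \<phi>) \<le> e\<^sup>2"
      using lt ip_nonneg[OF mem'(1)] ip_nonneg[OF mem'(2)] by linarith+
    then have small: "nrm (a u - a \<phi>) \<le> e" "nrm (u - \<phi>) \<le> e"
      using e by (auto simp: hnorm_def intro: real_le_lsqrt)
    have "ip (a u) f - ip u (b f) = ip (a u - a \<phi>) f - ip (u - \<phi>) (b f)"
      using a_Fun_c[OF \<phi>] f uL mem by (simp add: ip_diff_left)
    then have "\<bar>ip (a u) f - ip u (b f)\<bar> \<le> \<bar>ip (a u - a \<phi>) f\<bar> + \<bar>ip (u - \<phi>) (b f)\<bar>" by linarith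
    also have "\<dots> \<le> nrm (a u - a \<phi>) * nrm f + nrm (u - \<phi>) * nrm (b f)"
      using mem' f by (intro add_mono cauchy_schwarz)
    also have "\<dots> \<le> e * nrm f + e * nrm (b f)"
      using small f by (intro add_mono mult_right_mono) auto
    finally show ?thesis by (simp add: K_def distrib_left)
  qed
  have K: "0 \<le> K" using f by (simp add: K_def)
  have "\<bar>ip (a u) f - ip u (b f)\<bar> \<le> 0"
  proof (rule field_le_epsilon)
    fix e :: real assume e: "0 < e"
    \<comment> \<open>\<open>K + 1\<close> because \<open>K\<close> vanishes for
      \<open>f = 0\<close>.\<close>
    have "\<bar>ip (a u) f - ip u (b f)\<bar> \<le> e / (K + 1) * K" using e K by (intro le) simp
    also have "\<dots> \<le> e" using e K by (simp add: field_simps)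
    finally show "\<bar>ip (a u) f - ip u (b f)\<bar> \<le> 0 + e" by simp
  qed
  then show ?thesis by simp
qed

text \<open>A pair \<open>(p, q)\<close> orthogonal to the graph of \<open>a\<close> on
  \<open>Fun_c\<close> satisfies \<open>b q = - p\<close>, as indicators show. The hypothesis at
  \<open>v = q\<close> makes it orthogonal to \<open>(f, g)\<close>, so \<open>(f, g)\<close> lies
  in the closure of that graph.\<close>

lemma closure_eq_adjoint:
  assumes f: "f \<in> L2" and g: "g \<in> L2"
    and eq: "\<And>v. v \<in> L2 \<Longrightarrow> b v \<in> L2 \<Longrightarrow> ip (b v) f = ip v g"
  shows "f \<in> dom_D X m Qa" "a f = g"
proof -
  show af: "a f = g"
    using eq[of "indicator {_}"] f g b_indicator
    by (intro Fun_eqI a_Fun L2_Fun) (auto simp: ip_indicator simp flip: ip_b)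
  interpret P: hilbert "L2 \<times> L2" "\<lambda>x y. ip (fst x) (fst y) + ip (snd x) (snd y)"
    by (rule hilbert_prod) unfold_locales
  define K where "K = (\<lambda>\<phi>. (\<phi>, a \<phi>)) ` Fun_c X"
  have subFc: "subspace (Fun_c X)"
  proof (rule subspaceI)
    show "0 \<in> Fun_c X" by (simp add: Fun_c_def Fun_def)
    show "x + y \<in> Fun_c X" if "x \<in> Fun_c X" "y \<in> Fun_c X" for x y
    proof -
      have "finite ({\<sigma>. x \<sigma> \<noteq> 0} \<union> {\<sigma>. y \<sigma> \<noteq> 0})" using that by (simp add: Fun_c_def)
      then have "finite {\<sigma>. (x + y) \<sigma> \<noteq> 0}" by (rule finite_subset[rotated]) auto
      then show ?thesis using that by (auto simp: Fun_c_def Fun_def)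
    qed
    show "c *\<^sub>R x \<in> Fun_c X" if "x \<in> Fun_c X" for c x
      using that by (auto simp: Fun_c_def Fun_def scaleR_fun_def)
  qed
  have FcL: "\<phi> \<in> L2" "a \<phi> \<in> L2" if "\<phi> \<in> Fun_c X" for \<phi>
    using that Fun_c_subset a_Fun_c by auto
  have KH: "K \<subseteq> L2 \<times> L2" by (auto simp: K_def FcL)
  have subK: "subspace K"
  proof (rule subspaceI)
    have "a 0 = 0" using a_scale[of 0 0] by simp
    then show "0 \<in> K" using subspace_0[OF subFc] by (auto simp: K_def zero_prod_def)
    show "x + y \<in> K" if xy: "x \<in> K" "y \<in> K" for x y
    proof -
      obtain \<phi> \<psi> where "x = (\<phi>, a \<phi>)" "y = (\<psi>, a \<psi>)" "\<phi> \<in> Fun_c X" "\<psi> \<in> Fun_c X"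
        using xy by (auto simp: K_def)
      then show ?thesis
        using subspace_add[OF subFc, of \<phi> \<psi>]
        unfolding K_def by (intro image_eqI[of _ _ "\<phi> + \<psi>"]) (simp_all add: a_add FcL)
    qed
    show "c *\<^sub>R x \<in> K" if x: "x \<in> K" for c x
    proof -
      obtain \<phi> where "x = (\<phi>, a \<phi>)" "\<phi> \<in> Fun_c X" using x by (auto simp: K_def)
      then show ?thesis
        using subspace_scale[OF subFc, of \<phi> c]
        unfolding K_def by (intro image_eqI[of _ _ "c *\<^sub>R \<phi>"]) (simp_all add: a_scale FcL)
    qed
  qed
  have perp: "ip (fst x) (fst (f, g)) + ip (snd x) (snd (f, g)) = 0"
    if x: "x \<in> L2 \<times> L2" and xK: "\<And>k. k \<in> K \<Longrightarrow> ip (fst x) (fst k) + ip (snd x) (snd k) = 0" for x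
  proof -
    obtain p q where pq: "x = (p, q)" "p \<in> L2" "q \<in> L2" using x by auto
    have "m \<tau> * b q \<tau> = m \<tau> * (- p) \<tau>" if \<tau>: "\<tau> \<in> X" for \<tau>
    proof -
      have "(indicator {\<tau>}, a (indicator {\<tau>})) \<in> K" using indicator_Fun_c[OF \<tau>] by (simp add: K_def)
      then have "ip p (indicator {\<tau>}) + ip q (a (indicator {\<tau>})) = 0" using xK pq by fastforce
      then show ?thesis
        using ip_commute[of p "indicator {\<tau>}"] ip_commute[of q "a (indicator {\<tau>})"] pq \<tau> a_indicator
        by (simp add: ip_indicator ip_a)
    qed
    then have bq: "b q = - p" using pq by (intro Fun_eqI b_Fun L2_Fun) auto
    then have "ip (- p) f = ip q g" using eq[of q] pq by simp
    then show ?thesis using pq f by (simp add: ip_minus_left)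
  qed
  obtain k where k: "\<And>n. k n \<in> K" "(\<lambda>n::nat. P.nrm (k n - (f, g))) \<longlonglongrightarrow> 0"
    by (rule P.approximating_sequence[OF subK KH _ perp]) (use f g in auto)
  show "f \<in> dom_D X m Qa"
    unfolding dom_D_iff
  proof (intro conjI allI impI)
    fix e :: real assume e: "0 < e"
    obtain n where "norm (P.nrm (k n - (f, g)) - 0) < e"
      using LIMSEQ_D[OF k(2) e] by (meson order_refl)
    then have n: "P.nrm (k n - (f, g)) < e" by simp
    obtain \<phi> where \<phi>: "\<phi> \<in> Fun_c X" "k n = (\<phi>, a \<phi>)" using k(1)[of n] by (auto simp: K_def)
    have "(P.nrm (k n - (f, g)))\<^sup>2 < e\<^sup>2"
      using n k(1)[of n] KH f g by (intro power_strict_mono P.nrm_nonneg P.diff_mem) auto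
    moreover have "(P.nrm (k n - (f, g)))\<^sup>2 = ip (\<phi> - f) (\<phi> - f) + ip (a \<phi> - g) (a \<phi> - g)"
      using k(1)[of n] KH f g by (subst P.nrm_sq) (auto simp: \<phi>)
    moreover have "ip (\<phi> - f) (\<phi> - f) = ip (f - \<phi>) (f - \<phi>)" "ip (a \<phi> - g) (a \<phi> - g) = ip (g - a \<phi>) (g - a \<phi>)"
      using FcL[OF \<phi>(1)] f g by (simp_all add: ip_diff_left ip_diff_right)
    ultimately show "\<exists>\<phi>\<in>Fun_c X. ip (a f - a \<phi>) (a f - a \<phi>) + ip (f - \<phi>) (f - \<phi>) < e\<^sup>2"
      using \<phi>(1) by (intro bexI[of _ \<phi>]) (simp_all add: af)
  qed (use f g af in auto)
qed

text \<open>Minimal and maximal extension are adjoint to each other: membership in the adjoint of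
  the closed \<open>a\<close> is detected on indicators, and an adjoint vector of the maximal
  \<open>b\<close> lies in the closure by \<open>closure_eq_adjoint\<close>.\<close>

sublocale adjoint_pair L2 ip "dom_D X m Qa" a "dom_N X m Qb" b
proof unfold_locales
  fix f g assume f: "f \<in> L2" and g: "g \<in> L2"
  show "(\<forall>u\<in>dom_D X m Qa. ip (a u) f = ip u g) \<longleftrightarrow> f \<in> dom_N X m Qb \<and> b f = g"
  proof
    assume eq: "\<forall>u\<in>dom_D X m Qa. ip (a u) f = ip u g"
    have "b f = g"
      using eq indicator_Fun_c Fun_c_dom_D f g
      by (intro Fun_eqI b_Fun L2_Fun) (auto simp flip: ip_a simp: ip_indicator)
    then show "f \<in> dom_N X m Qb \<and> b f = g" using f g by (simp add: dom_N_b_iff)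
  qed (auto simp: dom_N_b_iff formal_adj)
  show "(\<forall>v\<in>dom_N X m Qb. ip (b v) f = ip v g) \<longleftrightarrow> f \<in> dom_D X m Qa \<and> a f = g"
  proof
    assume "\<forall>v\<in>dom_N X m Qb. ip (b v) f = ip v g"
    then show "f \<in> dom_D X m Qa \<and> a f = g"
      using closure_eq_adjoint[OF f g] by (simp add: dom_N_b_iff)
  next
    assume fg: "f \<in> dom_D X m Qa \<and> a f = g"
    show "\<forall>v\<in>dom_N X m Qb. ip (b v) f = ip v g"
    proof
      fix v assume v: "v \<in> dom_N X m Qb"
      then have vL: "v \<in> L2" "b v \<in> L2" by (auto simp: dom_N_b_iff)
      then show "ip (b v) f = ip v g"
        using formal_adj[of f v] fg f g ip_commute[of "b v" f] ip_commute[of v g] by simp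
    qed
  qed
qed (auto simp: dom_D_iff dom_N_b_iff)

lemma Laplacian_spectra_eq:
  assumes "spec \<in> {spectrum, essential_spectrum, pure_point_spectrum, ac_spectrum, sc_spectrum}"
  shows "spec L2 ip (Laplacian_D X m Qa) - {0} = spec L2 ip (Laplacian_N X m Qb) - {0}"
proof -
  have "Laplacian_D X m Qa = T"
    unfolding Laplacian_D_def
  proof (rule form_operator_eq)
    fix f assume "f \<in> dom_D X m Qa"
    then have "f \<in> L2" "a f \<in> L2" by (simp_all only: dom_D_iff)
    then show "enn2real (Qa f) = ip (a f) (a f)" by (simp add: Qa norm_sq_eq)
  qed
  moreover have "Laplacian_N X m Qb = T'"
    unfolding Laplacian_N_def
  proof (rule adjoint_pair.form_operator_eq[OF dual])
    fix f assume "f \<in> dom_N X m Qb"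
    then have "f \<in> L2" "b f \<in> L2" by (simp_all only: dom_N_b_iff)
    then show "enn2real (Qb f) = ip (b f) (b f)" by (simp add: Qb norm_sq_eq)
  qed
  ultimately show ?thesis using spectra_eq[OF assms] by simp
qed

end

section \<open>The Laplacians of a weighted complex\<close>

locale weighted_complex = weighted X m
  for X :: "'a set set" and m +
  fixes \<delta> :: "('a set \<Rightarrow> real) \<Rightarrow> 'a set \<Rightarrow> real"
  assumes finite_simplex: "\<sigma> \<in> X \<Longrightarrow> finite \<sigma>"
    and locally_summable: "locally_summable X m"
    and coboundary: "coboundary_operator X \<delta>"
begin

abbreviation "\<theta> \<equiv> incidence \<delta>"
abbreviation "bd \<equiv> boundary X m \<delta>"
abbreviation "cofaces \<tau> \<equiv> {\<sigma> \<in> X. facet \<tau> \<sigma>}"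
abbreviation "faces \<sigma> \<equiv> {\<tau> \<in> X. facet \<tau> \<sigma>}"

lemma \<delta>_Fun: "f \<in> Fun X \<Longrightarrow> \<delta> f \<in> Fun X"
  and \<delta>_add: "f \<in> Fun X \<Longrightarrow> g \<in> Fun X \<Longrightarrow> \<delta> (f + g) = \<delta> f + \<delta> g"
  and \<delta>_scale: "f \<in> Fun X \<Longrightarrow> \<delta> (c *\<^sub>R f) = c *\<^sub>R \<delta> f"
  and \<theta>_values: "\<tau> \<in> X \<Longrightarrow> \<sigma> \<in> X \<Longrightarrow> \<theta> \<tau> \<sigma> \<in> {-1, 0, 1}"
  and \<theta>_nonzero: "\<tau> \<in> X \<Longrightarrow> \<sigma> \<in> X \<Longrightarrow> \<theta> \<tau> \<sigma> \<noteq> 0 \<longleftrightarrow> facet \<tau> \<sigma>"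
  and \<delta>_eq: "f \<in> Fun X \<Longrightarrow> \<sigma> \<in> X \<Longrightarrow> \<delta> f \<sigma> = (\<Sum>\<tau>\<in>faces \<sigma>. f \<tau> * \<theta> \<tau> \<sigma>)"
  using coboundary unfolding coboundary_operator_def by blast+

lemma abs_\<theta>_le: "\<tau> \<in> X \<Longrightarrow> \<sigma> \<in> X \<Longrightarrow> \<bar>\<theta> \<tau> \<sigma>\<bar> \<le> 1"
  using \<theta>_values[of \<tau> \<sigma>] by auto

lemma summable_cofaces: "\<tau> \<in> X \<Longrightarrow> m summable_on cofaces \<tau>"
  using locally_summable by (simp add: locally_summable_def)

lemma finite_faces: "\<sigma> \<in> X \<Longrightarrow> finite (faces \<sigma>)"
  by (rule finite_subset[of _ "Pow \<sigma>"]) (auto simp: facet_def finite_simplex)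

lemma \<delta>_indicator: "\<delta> (indicator {\<tau>}) = \<theta> \<tau>"
  by (simp add: incidence_def fun_eq_iff)

text \<open>Local summability enters: the coboundary of one simplex is supported on its possibly
  infinitely many cofaces, with squared entries at most 1.\<close>

lemma \<delta>_indicator_L2:
  assumes \<tau>: "\<tau> \<in> X" shows "\<delta> (indicator {\<tau>}) \<in> L2"
proof -
  have "(\<lambda>\<sigma>. m \<sigma> * (\<theta> \<tau> \<sigma>)\<^sup>2) summable_on cofaces \<tau>"
  proof (rule summable_on_real_comparison[OF summable_cofaces[OF \<tau>]])
    fix \<sigma> assume "\<sigma> \<in> cofaces \<tau>"
    then have \<sigma>: "\<sigma> \<in> X" by simp
    have "(\<theta> \<tau> \<sigma>)\<^sup>2 \<le> 1" using \<theta>_values[OF \<tau> \<sigma>] by auto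
    then have "m \<sigma> * (\<theta> \<tau> \<sigma>)\<^sup>2 \<le> m \<sigma>" using m_nonneg[OF \<sigma>] by (simp add: mult_left_le)
    then show "\<bar>m \<sigma> * (\<theta> \<tau> \<sigma>)\<^sup>2\<bar> \<le> m \<sigma>" using m_nonneg[OF \<sigma>] by simp
  qed
  then have "(\<lambda>\<sigma>. m \<sigma> * (\<theta> \<tau> \<sigma>)\<^sup>2) summable_on X"
    by (rule infsum_support(2)[rotated 2]) (use \<theta>_nonzero[OF \<tau>] in auto)
  moreover have "\<theta> \<tau> \<in> Fun X"
    using \<delta>_Fun[OF L2_Fun[OF indicator_L2[OF \<tau>]]] by (simp add: \<delta>_indicator)
  ultimately show ?thesis by (simp add: ell2_iff \<delta>_indicator)
qed

text \<open>\<open>|f| <= 1 + f^2\<close>, where \<open>m\<close> is summable over the cofaces by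
  local summability. Hence \<open>L2\<close> lies in \<open>Fun_1\<close> and \<open>bd\<close> is
  given by convergent sums there.\<close>

lemma summable_cofaces_mult:
  assumes f: "f \<in> L2" and \<tau>: "\<tau> \<in> X"
  shows "(\<lambda>\<sigma>. m \<sigma> * \<bar>f \<sigma>\<bar>) summable_on cofaces \<tau>" "(\<lambda>\<sigma>. m \<sigma> * f \<sigma> * \<theta> \<tau> \<sigma>) summable_on cofaces \<tau>"
proof -
  have "(\<lambda>\<sigma>. m \<sigma> * (f \<sigma>)\<^sup>2) summable_on cofaces \<tau>"
    by (rule summable_on_subset_banach[of _ X]) (use f in \<open>auto simp: ell2_iff\<close>)
  then have "(\<lambda>\<sigma>. m \<sigma> + m \<sigma> * (f \<sigma>)\<^sup>2) summable_on cofaces \<tau>"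
    by (intro summable_on_add summable_cofaces \<tau>)
  then show 1: "(\<lambda>\<sigma>. m \<sigma> * \<bar>f \<sigma>\<bar>) summable_on cofaces \<tau>"
  proof (rule summable_on_real_comparison)
    fix \<sigma> assume "\<sigma> \<in> cofaces \<tau>"
    then have m: "0 \<le> m \<sigma>" using m_nonneg by simp
    have "0 \<le> (\<bar>f \<sigma>\<bar> - 1)\<^sup>2" by simp
    then have "2 * \<bar>f \<sigma>\<bar> \<le> 1 + (f \<sigma>)\<^sup>2" by (simp add: power2_diff)
    then have "\<bar>f \<sigma>\<bar> \<le> 1 + (f \<sigma>)\<^sup>2" by linarith
    then have "m \<sigma> * \<bar>f \<sigma>\<bar> \<le> m \<sigma> * (1 + (f \<sigma>)\<^sup>2)" using m by (rule mult_left_mono)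
    then show "\<bar>m \<sigma> * \<bar>f \<sigma>\<bar>\<bar> \<le> m \<sigma> + m \<sigma> * (f \<sigma>)\<^sup>2"
      using m by (simp add: abs_mult distrib_left)
  qed
  show "(\<lambda>\<sigma>. m \<sigma> * f \<sigma> * \<theta> \<tau> \<sigma>) summable_on cofaces \<tau>"
  proof (rule summable_on_real_comparison[OF 1])
    fix \<sigma> assume "\<sigma> \<in> cofaces \<tau>"
    then have \<sigma>: "\<sigma> \<in> X" by simp
    show "\<bar>m \<sigma> * f \<sigma> * \<theta> \<tau> \<sigma>\<bar> \<le> m \<sigma> * \<bar>f \<sigma>\<bar>"
      using abs_\<theta>_le[OF \<tau> \<sigma>] m_nonneg[OF \<sigma>] by (simp add: abs_mult mult_left_le)
  qed
qed

lemma L2_Fun_1: "f \<in> L2 \<Longrightarrow> f \<in> Fun_1 X m"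
  using summable_cofaces_mult(1) L2_Fun by (simp add: Fun_1_def)

lemma bd_Fun: "bd f \<in> Fun X"
  by (simp add: boundary_def Fun_def)

lemma bd_add: "f \<in> L2 \<Longrightarrow> g \<in> L2 \<Longrightarrow> bd (f + g) = bd f + bd g"
proof
  fix \<rho> assume f: "f \<in> L2" and g: "g \<in> L2"
  show "bd (f + g) \<rho> = (bd f + bd g) \<rho>"
    using infsum_add[OF summable_cofaces_mult(2)[OF f, of \<rho>] summable_cofaces_mult(2)[OF g, of \<rho>]]
    by (simp add: boundary_def algebra_simps add_divide_distrib)
qed

lemma bd_scale: "bd (c *\<^sub>R f) = c *\<^sub>R bd f"
proof
  fix \<rho>
  have "(\<Sum>\<^sub>\<infinity>\<tau>\<in>cofaces \<rho>. m \<tau> * (c *\<^sub>R f) \<tau> * \<theta> \<rho> \<tau>) = (\<Sum>\<^sub>\<infinity>\<tau>\<in>cofaces \<rho>. c * (m \<tau> * f \<tau> * \<theta> \<rho> \<tau>))"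
    by (simp add: scaleR_fun_def mult.left_commute mult.assoc)
  then show "bd (c *\<^sub>R f) \<rho> = (c *\<^sub>R bd f) \<rho>"
    by (simp add: boundary_def scaleR_fun_def infsum_cmult_right')
qed

lemma ip_\<delta>_indicator:
  assumes \<tau>: "\<tau> \<in> X" shows "ip (\<delta> (indicator {\<tau>})) f = m \<tau> * bd f \<tau>"
proof -
  have "ip (\<delta> (indicator {\<tau>})) f = (\<Sum>\<^sub>\<infinity>\<sigma>\<in>cofaces \<tau>. m \<sigma> * \<theta> \<tau> \<sigma> * f \<sigma>)"
    unfolding ell2_inner_def \<delta>_indicator
    by (rule infsum_support(1)) (use \<theta>_nonzero[OF \<tau>] in auto)
  also have "\<dots> = (\<Sum>\<^sub>\<infinity>\<sigma>\<in>cofaces \<tau>. m \<sigma> * f \<sigma> * \<theta> \<tau> \<sigma>)"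
    by (rule infsum_cong) simp
  also have "\<dots> = m \<tau> * bd f \<tau>" using \<tau> m_pos[OF \<tau>] by (simp add: boundary_def)
  finally show ?thesis .
qed

lemma bd_indicator:
  assumes \<tau>: "\<tau> \<in> X" and \<rho>: "\<rho> \<in> X" shows "bd (indicator {\<tau>}) \<rho> = m \<tau> * \<theta> \<rho> \<tau> / m \<rho>"
proof (cases "facet \<rho> \<tau>")
  case True
  have "(\<Sum>\<^sub>\<infinity>\<sigma>\<in>cofaces \<rho>. m \<sigma> * indicator {\<tau>} \<sigma> * \<theta> \<rho> \<sigma>)
      = (\<Sum>\<^sub>\<infinity>\<sigma>\<in>{\<tau>}. m \<sigma> * indicator {\<tau>} \<sigma> * \<theta> \<rho> \<sigma>)"
    using True \<tau> by (intro infsum_cong_neutral) auto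
  then show ?thesis using \<rho> by (simp add: boundary_def)
next
  case False
  then have "(\<Sum>\<^sub>\<infinity>\<sigma>\<in>cofaces \<rho>. m \<sigma> * indicator {\<tau>} \<sigma> * \<theta> \<rho> \<sigma>) = 0"
    by (intro infsum_0) (auto simp: indicator_def)
  then show ?thesis using False \<rho> \<theta>_nonzero[OF \<rho> \<tau>] by (simp add: boundary_def)
qed

text \<open>A simplex has finitely many faces, so its boundary is finitely supported.\<close>

lemma bd_indicator_L2:
  assumes \<tau>: "\<tau> \<in> X" shows "bd (indicator {\<tau>}) \<in> L2"
proof -
  have "\<rho> \<in> faces \<tau>" if "bd (indicator {\<tau>}) \<rho> \<noteq> 0" for \<rho>
  proof -
    have \<rho>: "\<rho> \<in> X" using that by (auto simp: boundary_def split: if_splits)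
    then show ?thesis using that \<theta>_nonzero[OF \<rho> \<tau>] by (simp add: bd_indicator[OF \<tau> \<rho>])
  qed
  then have "finite {\<rho>. bd (indicator {\<tau>}) \<rho> \<noteq> 0}"
    by (intro finite_subset[OF _ finite_faces[OF \<tau>]]) blast
  then have "bd (indicator {\<tau>}) \<in> Fun_c X" using bd_Fun by (simp add: Fun_c_def)
  then show ?thesis using Fun_c_subset by blast
qed

lemma ip_bd_indicator:
  assumes \<tau>: "\<tau> \<in> X" and f: "f \<in> Fun X" shows "ip (bd (indicator {\<tau>})) f = m \<tau> * \<delta> f \<tau>"
proof -
  have "ip (bd (indicator {\<tau>})) f = (\<Sum>\<^sub>\<infinity>\<rho>\<in>X. m \<tau> * (f \<rho> * \<theta> \<rho> \<tau>))"
    unfolding ell2_inner_def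
  proof (rule infsum_cong)
    fix \<rho> assume \<rho>: "\<rho> \<in> X"
    then show "m \<rho> * bd (indicator {\<tau>}) \<rho> * f \<rho> = m \<tau> * (f \<rho> * \<theta> \<rho> \<tau>)"
      using m_pos[OF \<rho>] by (simp add: bd_indicator[OF \<tau>])
  qed
  also have "\<dots> = (\<Sum>\<^sub>\<infinity>\<rho>\<in>faces \<tau>. m \<tau> * (f \<rho> * \<theta> \<rho> \<tau>))"
    by (rule infsum_support(1)) (use \<theta>_nonzero[OF _ \<tau>] in auto)
  also have "\<dots> = m \<tau> * \<delta> f \<tau>"
    using finite_faces[OF \<tau>] f \<tau> by (simp add: \<delta>_eq sum_distrib_left)
  finally show ?thesis .
qed

sublocale plus: formal_adjoint X m \<delta> bd "Q_plus X m \<delta>" "Q_minus X m \<delta>"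
  by unfold_locales
    (simp_all add: \<delta>_Fun bd_Fun \<delta>_add \<delta>_scale bd_add bd_scale \<delta>_indicator_L2 bd_indicator_L2
      ip_\<delta>_indicator ip_bd_indicator Q_plus_def Q_minus_def L2_Fun L2_Fun_1)

sublocale minus: formal_adjoint X m bd \<delta> "Q_minus X m \<delta>" "Q_plus X m \<delta>"
  by unfold_locales
    (simp_all add: \<delta>_Fun bd_Fun \<delta>_add \<delta>_scale bd_add bd_scale \<delta>_indicator_L2 bd_indicator_L2
      ip_\<delta>_indicator ip_bd_indicator Q_plus_def Q_minus_def L2_Fun L2_Fun_1)

abbreviation "\<D> f \<equiv> \<delta> f + bd f"

lemma \<D>_Fun: "f \<in> L2 \<Longrightarrow> \<D> f \<in> Fun X"
  using \<delta>_Fun[OF L2_Fun, of f] bd_Fun[of f] by (simp add: Fun_def)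

lemma \<D>_add: "f \<in> L2 \<Longrightarrow> g \<in> L2 \<Longrightarrow> \<D> (f + g) = \<D> f + \<D> g"
  by (simp add: \<delta>_add bd_add L2_Fun)

lemma \<D>_scale: "f \<in> L2 \<Longrightarrow> \<D> (c *\<^sub>R f) = c *\<^sub>R \<D> f"
  by (simp add: \<delta>_scale bd_scale L2_Fun scaleR_add_right)

lemma \<D>_indicator_L2: "\<tau> \<in> X \<Longrightarrow> \<D> (indicator {\<tau>}) \<in> L2"
  by (intro add_mem \<delta>_indicator_L2 bd_indicator_L2)

lemma ip_\<D>_indicator:
  assumes "\<tau> \<in> X" "f \<in> L2" shows "ip (\<D> (indicator {\<tau>})) f = m \<tau> * (\<D> f) \<tau>"
  using assms ip_add_left[OF \<delta>_indicator_L2 bd_indicator_L2, of \<tau> \<tau> f]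
  by (simp add: ip_\<delta>_indicator ip_bd_indicator L2_Fun distrib_left)

lemma Q_Hodge_eq: "f \<in> L2 \<Longrightarrow> Q_Hodge X m \<delta> f = norm_sq X m (\<D> f)"
  by (simp add: Q_Hodge_def L2_Fun_1)

text \<open>As \<open>\<delta>\<close> and \<open>bd\<close> are formally adjoint to each other,
  their sum is formally adjoint to itself; the pair consists of its minimal and maximal
  extensions.\<close>

sublocale hodge: formal_adjoint X m "\<lambda>\<omega>. \<D> \<omega>" "\<lambda>\<omega>. \<D> \<omega>" "Q_Hodge X m \<delta>" "Q_Hodge X m \<delta>"
  by unfold_locales (fact \<D>_Fun \<D>_add \<D>_scale \<D>_indicator_L2 ip_\<D>_indicator Q_Hodge_eq)+

end

theorem theorem5p1:
  fixes V :: "'a set" and S :: "'a set set" and m :: "'a set \<Rightarrow> real"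
    and \<delta> :: "('a set \<Rightarrow> real) \<Rightarrow> 'a set \<Rightarrow> real"
    and \<Sigma> :: "'a set set" and H :: "('a set \<Rightarrow> real) set" and ip :: "('a set \<Rightarrow> real) inner_prod"
  assumes "abstract_simplicial_complex V S"
    and "weight S m"
    and "\<Sigma> = complex_of S m"
    and "locally_summable \<Sigma> m"
    and "coboundary_operator \<Sigma> \<delta>"
    and "H = ell2 \<Sigma> m" and "ip = ell2_inner \<Sigma> m"
  shows "\<forall>spec \<in> {spectrum, essential_spectrum, pure_point_spectrum, ac_spectrum, sc_spectrum}.
      spec H ip (Laplacian_D \<Sigma> m (Q_plus \<Sigma> m \<delta>)) - {0} =
        spec H ip (Laplacian_N \<Sigma> m (Q_minus \<Sigma> m \<delta>)) - {0} \<and>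
      spec H ip (Laplacian_D \<Sigma> m (Q_minus \<Sigma> m \<delta>)) - {0} =
        spec H ip (Laplacian_N \<Sigma> m (Q_plus \<Sigma> m \<delta>)) - {0} \<and>
      spec H ip (Laplacian_D \<Sigma> m (Q_Hodge \<Sigma> m \<delta>)) - {0} =
        spec H ip (Laplacian_N \<Sigma> m (Q_Hodge \<Sigma> m \<delta>)) - {0}"
proof -
  have sub: "\<Sigma> \<subseteq> S" using assms(3) by (auto simp: complex_of_def)
  interpret weighted_complex \<Sigma> m \<delta>
    by unfold_locales
      (use assms sub in \<open>auto simp: weight_def abstract_simplicial_complex_def\<close>)
  show ?thesis
    unfolding assms(6,7)
    by (intro ballI conjI plus.Laplacian_spectra_eq minus.Laplacian_spectra_eq
        hodge.Laplacian_spectra_eq)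
qed

end
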